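(* Let $M=30000d$, let $C_M>0$, let $Q_{0}\in\Delta(\mathbb{R}^{d})$ and let $f:MQ_{0}\to\mathbb{R}^{D}$ be $\eta$-quasisymmetric such that $$\sum_{Q\in\Delta(Q_0)}\omega_{f}(MQ)^{2}|Q|\leq C_{M}|Q_{0}|.$$ Then for all $\theta>0$ there are $L=L(\eta,\theta,D,C_{M})$ and $E\subseteq Q_{0}$ such that $|E|\geq(1-\theta)|Q_{0}|$ and $\left(\frac{\operatorname{diam} f(Q_{0})}{\operatorname{diam} Q_{0}}\right)^{-1}f|_{E}$ is $L$-bi-Lipschitz.
   Context: For an increasing homeomorphism $\eta:(0,\infty)\to(0,\infty)$, a non-constant map $f:\Omega\to\mathbb{R}^{D}$, $\Omega\subseteq\mathbb{R}^d$, is $\eta$-quasisymmetric if $\frac{|f(x)-f(y)|}{|f(x)-f(z)|}\leq\eta\left(\frac{|x-y|}{|x-z|}\right)$ for all distinct $x,y,z\in\Omega$. $\Delta(\mathbb{R}^{d})$ is the collection of closed dyadic cubes $\prod_{i=1}^d[2^nj_i,2^n(j_i+1)]$, $n,j_i\in\mathbb{Z}$, and $\Delta(Q_0)$ is the set of dyadic cubes contained in $Q_0$. $|\cdot|$ of a set is Lebesgue measure. For a cube $Q$ and $\lambda>0$, $\lambda Q$ is the cube with the same center and side length $\lambda$ times that of $Q$. For an affine map $A:\mathbb{R}^d\to\mathbb{R}^D$, $A'$ is its linear part and $|A'|$ the operator norm. For a cube $Q$ in the domain of $f$, $$\omega_{f}(Q)=\inf_{A}\left(\frac{1}{|Q|}\int_{Q}\left(\frac{|f-A|}{|A'|\operatorname{diam}Q}\right)^{2}\right)^{1/2},$$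 the infimum being over affine maps $A$ with $|A'|\neq0$. A map $g$ is $L$-bi-Lipschitz if $L^{-1}|x-y|\leq|g(x)-g(y)|\leq L|x-y|$ for all $x,y$ in its domain. *)

theory Defs
  imports "HOL-Analysis.Analysis"
begin

text \<open>
  The bi-Lipschitz constant of the theorem depends on the dimension of the target but not on the
  dimension \<open>d\<close> of the domain, so \<open>d\<close> has to be quantified inside the statement
  and cannot be a type parameter. Points of \<open>\<real>\<^sup>d\<close> are therefore extensional
  functions on \<open>{..<d}\<close>, the representation of the points of the finite product measure
  space. The type class metric on \<^typ>\<open>nat \<Rightarrow> real\<close> is not the Euclidean one
  and is not used.
\<close>

definition Rn :: "nat \<Rightarrow> (nat \<Rightarrow> real) set" where
  "Rn d = (\<Pi>\<^sub>E i\<in>{..<d}. UNIV)"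

definition Rn_norm :: "nat \<Rightarrow> (nat \<Rightarrow> real) \<Rightarrow> real" where
  "Rn_norm d x = L2_set x {..<d}"

definition Rn_dist :: "nat \<Rightarrow> (nat \<Rightarrow> real) \<Rightarrow> (nat \<Rightarrow> real) \<Rightarrow> real" where
  "Rn_dist d x y = Rn_norm d (\<lambda>i. x i - y i)"

definition Rn_diameter :: "nat \<Rightarrow> (nat \<Rightarrow> real) set \<Rightarrow> real" where
  "Rn_diameter d S = (if S = {} then 0 else SUP (x, y)\<in>S \<times> S. Rn_dist d x y)"

definition Rn_lebesgue :: "nat \<Rightarrow> (nat \<Rightarrow> real) measure" where
  "Rn_lebesgue d = completion (\<Pi>\<^sub>M i\<in>{..<d}. lborel)"

definition Rn_linear :: "nat \<Rightarrow> ((nat \<Rightarrow> real) \<Rightarrow> 'b::real_vector) \<Rightarrow> bool" where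
  "Rn_linear d T \<longleftrightarrow>
     (\<forall>x\<in>Rn d. \<forall>y\<in>Rn d. T (\<lambda>i\<in>{..<d}. x i + y i) = T x + T y) \<and>
     (\<forall>c. \<forall>x\<in>Rn d. T (\<lambda>i\<in>{..<d}. c * x i) = c *\<^sub>R T x)"

definition Rn_onorm :: "nat \<Rightarrow> ((nat \<Rightarrow> real) \<Rightarrow> 'b::real_normed_vector) \<Rightarrow> real" where
  "Rn_onorm d T = (SUP x\<in>{x \<in> Rn d. Rn_norm d x \<le> 1}. norm (T x))"

definition cube :: "nat \<Rightarrow> (nat \<Rightarrow> real) \<Rightarrow> real \<Rightarrow> (nat \<Rightarrow> real) set" where
  "cube d c s = (\<Pi>\<^sub>E i\<in>{..<d}. {c i - s / 2 .. c i + s / 2})"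

definition dilate :: "nat \<Rightarrow> real \<Rightarrow> (nat \<Rightarrow> real) set \<Rightarrow> (nat \<Rightarrow> real) set" where
  "dilate d l Q = (THE R. \<exists>c s. 0 < s \<and> Q = cube d c s \<and> R = cube d c (l * s))"

definition dyadic_cubes :: "nat \<Rightarrow> (nat \<Rightarrow> real) set set" where
  "dyadic_cubes d =
     {Q. \<exists>(n::int) (j::nat \<Rightarrow> int).
        Q = (\<Pi>\<^sub>E i\<in>{..<d}. {2 powi n * real_of_int (j i) .. 2 powi n * (real_of_int (j i) + 1)})}"

definition dyadic_subcubes :: "nat \<Rightarrow> (nat \<Rightarrow> real) set \<Rightarrow> (nat \<Rightarrow> real) set set" where
  "dyadic_subcubes d Q0 = {Q \<in> dyadic_cubes d. Q \<subseteq> Q0}"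

definition increasing_homeo :: "(real \<Rightarrow> real) \<Rightarrow> bool" where
  "increasing_homeo \<eta> \<longleftrightarrow>
     strict_mono_on {0<..} \<eta> \<and> (\<exists>\<zeta>. homeomorphism {0<..} {0<..} \<eta> \<zeta>)"

text \<open>
  The condition \<open>f x \<noteq> f z\<close> says that the quotient of image distances makes sense;
  with \<open>a / 0 = 0\<close> the inequality alone would hold for coinciding image points.
\<close>

definition quasisymmetric_on ::
  "nat \<Rightarrow> (nat \<Rightarrow> real) set \<Rightarrow> (real \<Rightarrow> real) \<Rightarrow> ((nat \<Rightarrow> real) \<Rightarrow> 'b::real_normed_vector) \<Rightarrow> bool"
where
  "quasisymmetric_on d \<Omega> \<eta> f \<longleftrightarrow>
     \<not> f constant_on \<Omega> \<and>
     (\<forall>x\<in>\<Omega>. \<forall>y\<in>\<Omega>. \<forall>z\<in>\<Omega>. x \<noteq> y \<and> y \<noteq> z \<and> x \<noteq> z \<longrightarrow>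
        f x \<noteq> f z \<and>
        norm (f x - f y) / norm (f x - f z) \<le> \<eta> (Rn_dist d x y / Rn_dist d x z))"

text \<open>
  The affine map \<open>A\<close> is given as \<open>A x = b + T x\<close> with linear part
  \<open>A' = T\<close>. The integral is a Bochner integral, which is \<open>0\<close> for a non-integrable
  integrand; a quasisymmetric map is continuous, so on closed cubes in its domain
  this does not occur.
\<close>

definition omega :: "nat \<Rightarrow> ((nat \<Rightarrow> real) \<Rightarrow> 'b::euclidean_space) \<Rightarrow> (nat \<Rightarrow> real) set \<Rightarrow> real" where
  "omega d f Q =
     (INF (T, b)\<in>{T. Rn_linear d T \<and> Rn_onorm d T \<noteq> 0} \<times> UNIV.
        sqrt (1 / measure (Rn_lebesgue d) Q *
          (LINT x:Q|Rn_lebesgue d.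
             (norm (f x - (b + T x)) / (Rn_onorm d T * Rn_diameter d Q))\<^sup>2)))"

definition bi_lipschitz_on ::
  "nat \<Rightarrow> real \<Rightarrow> (nat \<Rightarrow> real) set \<Rightarrow> ((nat \<Rightarrow> real) \<Rightarrow> 'b::real_normed_vector) \<Rightarrow> bool"
where
  "bi_lipschitz_on d L S g \<longleftrightarrow>
     (\<forall>x\<in>S. \<forall>y\<in>S. inverse L * Rn_dist d x y \<le> norm (g x - g y) \<and>
                   norm (g x - g y) \<le> L * Rn_dist d x y)"

lemma cube_eq_iff:
  assumes "0 < s" "0 < t" "1 \<le> d"
  shows "cube d c s = cube d b t \<longleftrightarrow> s = t \<and> (\<forall>i<d. c i = b i)"
proof
  assume eq: "cube d c s = cube d b t"
  have "\<forall>i\<in>{..<d}. {c i - s / 2 .. c i + s / 2} = {b i - t / 2 .. b i + t / 2}"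
    using eq assms unfolding cube_def by (subst (asm) PiE_eq_iff_not_empty) auto
  then have e: "c i - s / 2 = b i - t / 2 \<and> c i + s / 2 = b i + t / 2" if "i < d" for i
    using that assms by (auto simp: Icc_eq_Icc)
  have st: "s = t"
    using e[of 0] assms by auto
  moreover have "c i = b i" if "i < d" for i
    using e[OF that] st by auto
  ultimately show "s = t \<and> (\<forall>i<d. c i = b i)"
    by blast
next
  assume "s = t \<and> (\<forall>i<d. c i = b i)"
  then show "cube d c s = cube d b t"
    unfolding cube_def by (intro PiE_cong) auto
qed

lemma dilate_cube:
  assumes "0 < s" "1 \<le> d"
  shows "dilate d l (cube d c s) = cube d c (l * s)"
  unfolding dilate_def
proof (rule the_equality)
  show "\<exists>b t. 0 < t \<and> cube d c s = cube d b t \<and> cube d c (l * s) = cube d b (l * t)"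
    using assms by blast
next
  fix R assume "\<exists>b t. 0 < t \<and> cube d c s = cube d b t \<and> R = cube d b (l * t)"
  then obtain b t where "0 < t" "cube d c s = cube d b t" and R: "R = cube d b (l * t)"
    by blast
  then have "s = t" "\<forall>i<d. c i = b i"
    using cube_eq_iff assms by auto
  then show "R = cube d c (l * s)"
    unfolding R cube_def by (intro PiE_cong) auto
qed

lemma dyadic_cube_is_cube:
  assumes "Q \<in> dyadic_cubes d"
  obtains c s where "0 < s" "Q = cube d c s"
proof -
  from assms obtain n :: int and j :: "nat \<Rightarrow> int" where
    Q: "Q = (\<Pi>\<^sub>E i\<in>{..<d}. {2 powi n * real_of_int (j i) .. 2 powi n * (real_of_int (j i) + 1)})"
    unfolding dyadic_cubes_def by blast
  have "Q = cube d (\<lambda>i. 2 powi n * (real_of_int (j i) + 1 / 2)) (2 powi n)"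
    unfolding Q cube_def by (intro PiE_cong) (auto simp: algebra_simps)
  then show ?thesis
    by (intro that[of "2 powi n"]) auto
qed

end

theory Submission imports Defs begin

text \<open>
  Up to constants from quasisymmetry, \<open>f\<close> distorts the distance of two points of a cube by the
  slope of \<open>f\<close> on that cube: the length of the image of a step of the side length, divided by
  the side length. So \<open>f\<close> is bi-Lipschitz on every set all of whose points lie, at every scale,
  near cubes with slope comparable to that of \<open>Q\<^sub>0\<close> (\<open>good_set_bi_lipschitz\<close>), and the theorem
  says that the logarithm of the slope stays bounded along the tree of dyadic subcubes, except on
  a set of small measure.

  When \<^const>\<open>omega\<close> is small, the passage to a subcube changes this logarithm by at most a
  multiple of \<^const>\<open>omega\<close>. The hypothesis controls only the sum of the squares, so cancellation
  is needed, and it comes from a martingale. Let \<open>e\<close> be the first unit vector, and let the mean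
  gradient of a cube \<open>P\<close> of side \<open>s\<close> be the difference of the averages of \<open>f\<close> over \<open>P + s e\<close> and
  over \<open>P\<close>, divided by \<open>s\<close>. Averages refine exactly and a step of length \<open>s\<close> is two steps of length
  \<open>s / 2\<close>, hence the mean gradient of \<open>P\<close> is the average of the mean gradients of the cubes
  \<open>P'\<close> and \<open>P' + (s / 2) e\<close>, where \<open>P'\<close> runs through the subcubes of half the side
  (\<open>mean_gradient_martingale\<close>). Since it is an average over a volume, an \<open>L\<^sup>2\<close> deviation from
  an affine map changes it by an amount that is linear in the deviation; a martingale of boundary
  integrals over a fixed grid would not have this property. One direction suffices, because steps
  in all directions have images of comparable length.

  Second order expansion of the logarithm of the norm of the mean gradient writes its change along
  a random path of this tree as a martingale increment of size \<^const>\<open>omega\<close> plus an error of size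
  \<open>omega\<^sup>2\<close>. Where \<^const>\<open>omega\<close> is not small, quasisymmetry bounds the change by a constant,
  which is again of size \<open>omega\<^sup>2\<close> (\<open>log_scale_step\<close>). Kolmogorov's inequality for the martingale
  part and Markov's inequality for the error bound the proportion of paths on which the logarithm
  moves far by a multiple of the expected sum of \<open>omega\<^sup>2\<close> (\<open>tracks_proportion\<close>). Because of the
  translations a cube lies on several paths, but no cube is visited more often than in a uniform
  distribution (\<open>level_flow\<close>); hence the expected sum is at most the sum in the hypothesis, and
  the end cubes of the remaining paths fill most of \<open>Q\<^sub>0\<close>. Intersecting over all generations gives
  the set \<open>E\<close> (\<open>measure_good_set\<close>).

  The constants depend on \<open>d\<close>. They can be made uniform because the images of the neighbours of
  a point along the axes are separated, which bounds \<open>d\<close> in terms of \<open>\<eta>\<close> and the target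
  (\<open>quasisymmetric_dimension_bound\<close>).
\<close>

section \<open>Euclidean geometry of the coordinate representation\<close>

lemma Rn_dist_nonneg [simp]: "0 \<le> Rn_dist d x y"
  by (simp add: Rn_dist_def Rn_norm_def)

lemma Rn_dist_commute: "Rn_dist d x y = Rn_dist d y x"
proof -
  have "L2_set (\<lambda>i. x i - y i) {..<d} = L2_set (\<lambda>i. y i - x i) {..<d}"
    by (simp add: L2_set_def power2_commute)
  then show ?thesis by (simp add: Rn_dist_def Rn_norm_def)
qed

lemma coordinate_le_Rn_norm: "i < d \<Longrightarrow> \<bar>x i\<bar> \<le> Rn_norm d x"
  using member_le_L2_set[of "{..<d}" i "\<lambda>i. \<bar>x i\<bar>"]
  by (simp add: Rn_norm_def L2_set_def)

lemma coordinate_le_Rn_dist: "i < d \<Longrightarrow> \<bar>x i - y i\<bar> \<le> Rn_dist d x y"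
  using coordinate_le_Rn_norm[of i d "\<lambda>i. x i - y i"] by (simp add: Rn_dist_def)

lemma Rn_dist_le_coordinates:
  assumes "\<And>i. i < d \<Longrightarrow> \<bar>x i - y i\<bar> \<le> r"
  shows "Rn_dist d x y \<le> d * r"
proof -
  have "Rn_dist d x y \<le> (\<Sum>i<d. \<bar>x i - y i\<bar>)"
    using L2_set_le_sum_abs[of "\<lambda>i. x i - y i" "{..<d}"] by (simp add: Rn_dist_def Rn_norm_def)
  also have "\<dots> \<le> (\<Sum>i<d. r)"
    by (intro sum_mono) (use assms in auto)
  finally show ?thesis by simp
qed

lemma Rn_eqI: "x \<in> Rn d \<Longrightarrow> y \<in> Rn d \<Longrightarrow> (\<And>i. i < d \<Longrightarrow> x i = y i) \<Longrightarrow> x = y"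
  unfolding Rn_def by (rule PiE_ext) auto

lemma Rn_dist_pos:
  assumes "x \<in> Rn d" "y \<in> Rn d" "x \<noteq> y"
  shows "0 < Rn_dist d x y"
proof -
  obtain i where "i < d" "x i \<noteq> y i"
    using assms Rn_eqI by blast
  then show ?thesis
    using coordinate_le_Rn_dist[of i d x y] by linarith
qed

lemma Rn_dist_self [simp]: "Rn_dist d x x = 0"
  by (simp add: Rn_dist_def Rn_norm_def L2_set_def)

definition shift :: "nat \<Rightarrow> nat \<Rightarrow> real \<Rightarrow> (nat \<Rightarrow> real) \<Rightarrow> nat \<Rightarrow> real" where
  "shift d i t x = (\<lambda>j\<in>{..<d}. x j + (if j = i then t else 0))"

definition unit_vec :: "nat \<Rightarrow> nat \<Rightarrow> nat \<Rightarrow> real" where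
  "unit_vec d i = (\<lambda>j\<in>{..<d}. if j = i then 1 else 0)"

lemma shift_in_Rn [simp]: "shift d i t x \<in> Rn d"
  by (simp add: shift_def Rn_def)

lemma unit_vec_in_Rn [simp]: "unit_vec d i \<in> Rn d"
  by (simp add: unit_vec_def Rn_def)

lemma shift_apply: "j < d \<Longrightarrow> shift d i t x j = x j + (if j = i then t else 0)"
  by (simp add: shift_def)

lemma Rn_dist_shift: "i < d \<Longrightarrow> Rn_dist d x (shift d i t x) = \<bar>t\<bar>"
proof -
  assume i: "i < d"
  have "(\<Sum>j<d. (x j - shift d i t x j)\<^sup>2) = (\<Sum>j<d. if j = i then t\<^sup>2 else 0)"
    by (intro sum.cong) (auto simp: shift_apply)
  also have "\<dots> = t\<^sup>2"
    using i by simp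
  finally show ?thesis
    by (simp add: Rn_dist_def Rn_norm_def L2_set_def)
qed

text \<open>
  The expansion in unit vectors makes the supremum in \<^const>\<open>Rn_onorm\<close> finite and bounds it by
  finitely many values, each of which can be estimated through increments of \<open>f\<close>.
\<close>

lemma Rn_linear_expand:
  assumes T: "Rn_linear d T" and x: "x \<in> Rn d"
  shows "T x = (\<Sum>i<d. x i *\<^sub>R T (unit_vec d i))"
proof -
  define y where "y k = (\<lambda>j\<in>{..<d}. if j < k then x j else 0)" for k :: nat
  have y: "y k \<in> Rn d" for k
    by (simp add: y_def Rn_def)
  have scale: "T (\<lambda>i\<in>{..<d}. c * z i) = c *\<^sub>R T z" if "z \<in> Rn d" for c z
    using T that by (auto simp: Rn_linear_def)
  have add: "T (\<lambda>i\<in>{..<d}. z i + w i) = T z + T w" if "z \<in> Rn d" "w \<in> Rn d" for z w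
    using T that by (auto simp: Rn_linear_def)
  have "T (y k) = (\<Sum>i<k. x i *\<^sub>R T (unit_vec d i))" if "k \<le> d" for k
    using that
  proof (induction k)
    case 0
    have "y 0 = (\<lambda>i\<in>{..<d}. 0 * x i)"
      by (auto simp: y_def)
    then show ?case using scale[OF x, of 0] by (simp only: mult_zero_left lessThan_0 sum.empty scaleR_zero_left)
  next
    case (Suc k)
    let ?u = "\<lambda>i\<in>{..<d}. x k * unit_vec d k i"
    have "y (Suc k) = (\<lambda>i\<in>{..<d}. y k i + ?u i)"
      by (rule ext) (auto simp: y_def unit_vec_def less_Suc_eq)
    moreover have "?u \<in> Rn d" by (simp add: Rn_def)
    ultimately have "T (y (Suc k)) = T (y k) + T ?u"
      using add[OF y[of k], of ?u] by (simp only:)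
    also have "T ?u = x k *\<^sub>R T (unit_vec d k)"
      by (rule scale) simp
    finally show ?case using Suc by simp
  qed
  moreover have "y d = x"
    by (rule Rn_eqI[OF y x]) (simp add: y_def)
  ultimately show ?thesis by force
qed

lemma Rn_linear_shift:
  assumes T: "Rn_linear d T" and x: "x \<in> Rn d" and i: "i < d"
  shows "T (shift d i t x) = T x + t *\<^sub>R T (unit_vec d i)"
proof -
  have "T (shift d i t x) = (\<Sum>j<d. x j *\<^sub>R T (unit_vec d j)
      + (if j = i then t *\<^sub>R T (unit_vec d j) else 0))"
    unfolding Rn_linear_expand[OF T shift_in_Rn]
    by (intro sum.cong) (auto simp: shift_apply algebra_simps)
  also have "\<dots> = T x + t *\<^sub>R T (unit_vec d i)"
    using i unfolding sum.distrib Rn_linear_expand[OF T x] by simp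
  finally show ?thesis .
qed

lemma
  assumes T: "Rn_linear d T"
  shows Rn_onorm_le_sum: "Rn_onorm d T \<le> (\<Sum>i<d. norm (T (unit_vec d i)))"
    and norm_le_Rn_onorm: "x \<in> Rn d \<Longrightarrow> Rn_norm d x \<le> 1 \<Longrightarrow> norm (T x) \<le> Rn_onorm d T"
    and Rn_onorm_nonneg: "0 \<le> Rn_onorm d T"
proof -
  have bound: "norm (T x) \<le> (\<Sum>i<d. norm (T (unit_vec d i)))"
    if x: "x \<in> Rn d" "Rn_norm d x \<le> 1" for x
  proof -
    have "norm (T x) \<le> (\<Sum>i<d. norm (x i *\<^sub>R T (unit_vec d i)))"
      unfolding Rn_linear_expand[OF T x(1)] by (rule norm_sum)
    also have "\<dots> \<le> (\<Sum>i<d. norm (T (unit_vec d i)))"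
    proof (intro sum_mono)
      fix i assume "i \<in> {..<d}"
      then have "\<bar>x i\<bar> \<le> 1"
        using coordinate_le_Rn_norm[of i d x] x(2) by simp
      then show "norm (x i *\<^sub>R T (unit_vec d i)) \<le> norm (T (unit_vec d i))"
        by (simp add: mult_left_le_one_le)
    qed
    finally show ?thesis .
  qed
  have zero: "(\<lambda>i\<in>{..<d}. 0) \<in> {x \<in> Rn d. Rn_norm d x \<le> 1}"
    by (simp add: Rn_def Rn_norm_def L2_set_def)
  show "Rn_onorm d T \<le> (\<Sum>i<d. norm (T (unit_vec d i)))"
    unfolding Rn_onorm_def using zero bound by (intro cSUP_least) blast+
  show upper: "norm (T x) \<le> Rn_onorm d T" if "x \<in> Rn d" "Rn_norm d x \<le> 1" for x
    unfolding Rn_onorm_def using that bound by (intro cSUP_upper bdd_aboveI2) blast+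
  have "norm (T (\<lambda>i\<in>{..<d}. 0)) \<le> Rn_onorm d T"
    using zero by (intro upper) auto
  then show "0 \<le> Rn_onorm d T"
    using norm_ge_zero order_trans by blast
qed

lemma
  assumes "1 \<le> d" "0 < s"
  shows side_le_Rn_diameter_cube: "s \<le> Rn_diameter d (cube d c s)"
    and Rn_diameter_cube_le: "Rn_diameter d (cube d c s) \<le> d * s"
    and Rn_dist_le_diameter_cube:
      "x \<in> cube d c s \<Longrightarrow> y \<in> cube d c s \<Longrightarrow> Rn_dist d x y \<le> Rn_diameter d (cube d c s)"
proof -
  have le: "Rn_dist d x y \<le> d * s" if "x \<in> cube d c s" "y \<in> cube d c s" for x y
  proof (rule Rn_dist_le_coordinates)
    fix i assume "i < d"
    then have "x i \<in> {c i - s / 2..c i + s / 2}" "y i \<in> {c i - s / 2..c i + s / 2}"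
      using that unfolding cube_def by (auto simp: PiE_iff simp del: atLeastAtMost_iff)
    then show "\<bar>x i - y i\<bar> \<le> s" by auto
  qed
  define p where "p = (\<lambda>i\<in>{..<d}. c i - s / 2)"
  have p: "p \<in> cube d c s" "shift d 0 s p \<in> cube d c s"
    using assms by (auto simp: p_def cube_def shift_def)
  show *: "Rn_dist d x y \<le> Rn_diameter d (cube d c s)"
    if "x \<in> cube d c s" "y \<in> cube d c s" for x y
  proof -
    have "cube d c s \<noteq> {}" using p by auto
    moreover have "(case (x, y) of (x, y) \<Rightarrow> Rn_dist d x y)
        \<le> (SUP (x, y)\<in>cube d c s \<times> cube d c s. Rn_dist d x y)"
      using that le by (intro cSUP_upper bdd_aboveI2[where M = "d * s"]) auto
    ultimately show ?thesis by (simp add: Rn_diameter_def)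
  qed
  show "s \<le> Rn_diameter d (cube d c s)"
    using *[OF p] Rn_dist_shift[of 0 d p s] assms by simp
  have ne: "cube d c s \<times> cube d c s \<noteq> {}" "cube d c s \<noteq> {}" using p by auto
  show "Rn_diameter d (cube d c s) \<le> d * s"
    unfolding Rn_diameter_def using le ne by (auto intro!: cSUP_least)
qed

section \<open>Lebesgue measure in coordinates\<close>

abbreviation Rn_borel :: "nat \<Rightarrow> (nat \<Rightarrow> real) measure" where
  "Rn_borel d \<equiv> \<Pi>\<^sub>M i\<in>{..<d}. lborel"

interpretation lborel_product: product_sigma_finite "\<lambda>i::nat. lborel :: real measure" ..

lemma space_Rn_borel [simp]: "space (Rn_borel d) = Rn d"
  by (simp add: space_PiM Rn_def)

lemma box_in_sets [measurable]:
  "(\<And>i. i < d \<Longrightarrow> A i \<in> sets borel) \<Longrightarrow> (\<Pi>\<^sub>E i\<in>{..<d}. A i) \<in> sets (Rn_borel d)"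
  by (rule sets_PiM_I_finite) auto

text \<open>
  Half-open cubes are used for averages, because the subcubes of one generation then form an exact
  partition; the first argument after the dimension is the lower corner.
\<close>

definition corner_cube :: "nat \<Rightarrow> (nat \<Rightarrow> real) \<Rightarrow> real \<Rightarrow> (nat \<Rightarrow> real) set" where
  "corner_cube d p s = (\<Pi>\<^sub>E i\<in>{..<d}. {p i..<p i + s})"

lemma corner_cube_in_sets [measurable]: "corner_cube d p s \<in> sets (Rn_borel d)"
  unfolding corner_cube_def by (rule box_in_sets) simp

lemma cube_in_sets [measurable]: "cube d p s \<in> sets (Rn_borel d)"
  unfolding cube_def by (rule box_in_sets) simp

lemma emeasure_corner_cube: "0 \<le> s \<Longrightarrow> emeasure (Rn_borel d) (corner_cube d p s) = ennreal (s ^ d)"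
  unfolding corner_cube_def
  by (subst lborel_product.emeasure_PiM) (auto simp: prod_ennreal ennreal_power)

lemma emeasure_cube: "0 \<le> s \<Longrightarrow> emeasure (Rn_borel d) (cube d c s) = ennreal (s ^ d)"
  unfolding cube_def
  by (subst lborel_product.emeasure_PiM) (auto simp: prod_ennreal ennreal_power)

lemma measure_corner_cube: "0 \<le> s \<Longrightarrow> measure (Rn_borel d) (corner_cube d p s) = s ^ d"
  by (simp add: measure_def emeasure_corner_cube)

lemma measure_cube: "0 \<le> s \<Longrightarrow> measure (Rn_borel d) (cube d c s) = s ^ d"
  by (simp add: measure_def emeasure_cube)

lemma measure_Rn_lebesgue:
  "A \<in> sets (Rn_borel d) \<Longrightarrow> measure (Rn_lebesgue d) A = measure (Rn_borel d) A"
  by (simp add: Rn_lebesgue_def measure_def emeasure_completion)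

lemma measure_Rn_lebesgue_cube: "0 \<le> s \<Longrightarrow> measure (Rn_lebesgue d) (cube d c s) = s ^ d"
  by (simp add: measure_Rn_lebesgue measure_cube)

lemma shift_measurable [measurable]: "shift d i t \<in> measurable (Rn_borel d) (Rn_borel d)"
  unfolding shift_def by measurable

lemma shift_invariant: "distr (Rn_borel d) (Rn_borel d) (shift d i t) = Rn_borel d"
proof (rule lborel_product.PiM_eqI)
  fix A :: "nat \<Rightarrow> real set" assume A: "\<And>j. j \<in> {..<d} \<Longrightarrow> A j \<in> sets lborel"
  let ?c = "\<lambda>j. if j = i then t else 0"
  have A': "(+) (?c j) -` A j \<in> sets borel" if "j < d" for j
    using measurable_sets[of "(+) (?c j)" borel borel "A j"] A that by simp
  have "emeasure (distr (Rn_borel d) (Rn_borel d) (shift d i t)) (Pi\<^sub>E {..<d} A)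
      = emeasure (Rn_borel d) (shift d i t -` Pi\<^sub>E {..<d} A \<inter> space (Rn_borel d))"
    using A by (intro emeasure_distr shift_measurable box_in_sets) auto
  also have "shift d i t -` Pi\<^sub>E {..<d} A \<inter> space (Rn_borel d)
      = (\<Pi>\<^sub>E j\<in>{..<d}. (+) (?c j) -` A j)"
    by (auto simp: Rn_def shift_def PiE_iff add.commute split: if_splits)
  also have "emeasure (Rn_borel d) \<dots> = (\<Prod>j<d. emeasure lborel ((+) (?c j) -` A j))"
    using A' by (intro lborel_product.emeasure_PiM) auto
  also have "\<dots> = (\<Prod>j<d. emeasure lborel (A j))"
  proof (intro prod.cong refl)
    fix j assume "j \<in> {..<d}"
    then show "emeasure lborel ((+) (?c j) -` A j) = emeasure lborel (A j)"
      using A emeasure_distr[of "(+) (?c j)" lborel borel "A j"]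
      by (simp add: lborel_distr_plus)
  qed
  finally show "emeasure (distr (Rn_borel d) (Rn_borel d) (shift d i t)) (Pi\<^sub>E {..<d} A)
      = (\<Prod>j<d. emeasure lborel (A j))" by simp
qed simp_all

lemma
  fixes g :: "(nat \<Rightarrow> real) \<Rightarrow> 'b::{banach, second_countable_topology}"
  assumes [measurable]: "g \<in> borel_measurable (Rn_borel d)"
  shows integral_shift: "(LINT x|Rn_borel d. g (shift d i t x)) = (LINT x|Rn_borel d. g x)"
    and integrable_shift:
      "integrable (Rn_borel d) g \<Longrightarrow> integrable (Rn_borel d) (\<lambda>x. g (shift d i t x))"
proof -
  show "(LINT x|Rn_borel d. g (shift d i t x)) = (LINT x|Rn_borel d. g x)"
    using integral_distr[of "shift d i t" "Rn_borel d" "Rn_borel d" g] by (simp add: shift_invariant)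
  show "integrable (Rn_borel d) (\<lambda>x. g (shift d i t x))" if "integrable (Rn_borel d) g"
    using integrable_distr_eq[of "shift d i t" "Rn_borel d" "Rn_borel d" g] that
    by (simp add: shift_invariant)
qed

text \<open>
  Cauchy-Schwarz against an indicator function, from the non-negativity of the quadratic
  polynomial \<open>\<integral>(g - c)\<^sup>2\<close> in \<open>c\<close>.
\<close>

lemma integral_norm_le_sqrt:
  fixes g :: "'a \<Rightarrow> real"
  assumes "integrable M (\<lambda>x. (g x)\<^sup>2)" "integrable M g" and A: "A \<in> sets M" "emeasure M A < \<infinity>"
    and g: "\<And>x. x \<in> space M \<Longrightarrow> x \<notin> A \<Longrightarrow> g x = 0" and nn: "\<And>x. x \<in> space M \<Longrightarrow> 0 \<le> g x"
  shows "(LINT x|M. g x) \<le> sqrt (measure M A * (LINT x|M. (g x)\<^sup>2))"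
proof -
  let ?I = "LINT x|M. g x" and ?J = "LINT x|M. (g x)\<^sup>2" and ?m = "measure M A"
  have iA: "integrable M (indicat_real A)" using A by (simp add: integrable_indicator_iff)
  have quad: "2 * c * ?I \<le> ?J + c\<^sup>2 * ?m" for c
  proof -
    have "(LINT x|M. 2 * c * g x) \<le> (LINT x|M. (g x)\<^sup>2 + c\<^sup>2 * indicat_real A x)"
    proof (rule integral_mono)
      fix x assume x: "x \<in> space M"
      show "2 * c * g x \<le> (g x)\<^sup>2 + c\<^sup>2 * indicat_real A x"
      proof (cases "x \<in> A")
        case True
        have "0 \<le> (g x - c)\<^sup>2" by simp
        then show ?thesis using True by (simp add: power2_diff mult_ac)
      next
        case False then show ?thesis using g x by simp
      qed
    qed (use assms iA in auto)
    then show ?thesis using assms iA A by (simp add: sets.sets_into_space Int_absorb2)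
  qed
  have J: "0 \<le> ?J" and I: "0 \<le> ?I" using nn by (auto intro: integral_nonneg_AE)
  have "?I\<^sup>2 \<le> ?m * ?J"
  proof (cases "?m = 0")
    case True
    have "?I = 0"
    proof (rule ccontr)
      assume "?I \<noteq> 0"
      with I have "?I > 0" by simp
      \<comment> \<open>If the set has measure zero, the polynomial is linear in \<open>c\<close>.\<close>
      with quad[of "(?J + 1) / (2 * ?I)"] True show False by simp
    qed
    then show ?thesis using True by simp
  next
    case False
    then have m: "?m > 0" by (simp add: less_le)
    from quad[of "?I / ?m"] m show ?thesis by (simp add: field_simps power2_eq_square)
  qed
  then show ?thesis using I real_le_rsqrt by blast
qed

section \<open>Quasisymmetric maps on a cube\<close>

text \<open>
  A ball of radius \<open>\<delta> / 2\<close> holds at most one of the points, and finitely many such balls cover.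
\<close>

lemma separated_points_bounded:
  fixes S :: "'a::metric_space set"
  assumes "compact S" "0 < \<delta>"
  shows "\<exists>N. \<forall>n. \<forall>u :: nat \<Rightarrow> 'a. (\<forall>i<n. u i \<in> S) \<and>
    (\<forall>i<n. \<forall>j<n. i \<noteq> j \<longrightarrow> \<delta> \<le> dist (u i) (u j)) \<longrightarrow> n \<le> N"
proof -
  have "0 < \<delta> / 2" using assms by simp
  then obtain k where k: "finite k" "S \<subseteq> (\<Union>x\<in>k. ball x (\<delta> / 2))"
    using assms(1) unfolding compact_eq_totally_bounded by blast
  have "n \<le> card k"
    if u: "\<And>i. i < n \<Longrightarrow> u i \<in> S" and sep: "\<And>i j. i < n \<Longrightarrow> j < n \<Longrightarrow> i \<noteq> j \<Longrightarrow> \<delta> \<le> dist (u i) (u j)"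
    for n and u :: "nat \<Rightarrow> 'a"
  proof -
    have "\<exists>x. x \<in> k \<and> dist x (u i) < \<delta> / 2" if "i < n" for i
      using u[OF that] k(2) unfolding ball_def by blast
    then obtain g where g: "\<And>i. i < n \<Longrightarrow> g i \<in> k \<and> dist (g i) (u i) < \<delta> / 2"
      by metis
    have "inj_on g {..<n}"
    proof (rule inj_onI, rule ccontr)
      fix i j assume ij: "i \<in> {..<n}" "j \<in> {..<n}" "g i = g j" "i \<noteq> j"
      have "dist (u i) (u j) \<le> dist (g i) (u i) + dist (g i) (u j)"
        by (rule dist_triangle3)
      then show False
        using ij g[of i] g[of j] sep[of i j] by auto
    qed
    then have "card {..<n} \<le> card k"
      using g k(1) by (intro card_inj_on_le) auto
    then show ?thesis by simp
  qed
  then show ?thesis by (intro exI[of _ "card k"]) metis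
qed

locale qs_cube =
  fixes d :: nat and \<eta> :: "real \<Rightarrow> real" and c :: "nat \<Rightarrow> real" and S :: real
    and f :: "(nat \<Rightarrow> real) \<Rightarrow> 'b::euclidean_space"
  assumes d: "1 \<le> d" and S: "0 < S" and homeo: "increasing_homeo \<eta>"
    and qs: "quasisymmetric_on d (cube d c S) \<eta> f"
begin

abbreviation \<Omega> :: "(nat \<Rightarrow> real) set" where
  "\<Omega> \<equiv> cube d c S"

lemma \<Omega>_in_Rn: "x \<in> \<Omega> \<Longrightarrow> x \<in> Rn d"
  by (auto simp: cube_def Rn_def PiE_iff)

lemma in_\<Omega>_iff: "x \<in> \<Omega> \<longleftrightarrow> x \<in> Rn d \<and> (\<forall>i<d. c i - S / 2 \<le> x i \<and> x i \<le> c i + S / 2)"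
  by (auto simp: cube_def Rn_def PiE_iff)

lemma distance_ratio_le:
  assumes "x \<in> \<Omega>" "y \<in> \<Omega>" "z \<in> \<Omega>" "x \<noteq> y" "y \<noteq> z" "x \<noteq> z"
  shows "f x \<noteq> f z \<and> norm (f x - f y) / norm (f x - f z) \<le> \<eta> (Rn_dist d x y / Rn_dist d x z)"
  using qs assms unfolding quasisymmetric_on_def by (elim conjE ballE) auto

text \<open>
  With the factor at least \<open>1\<close>, the inequality covers \<open>y = z\<close>, which the definition excludes.
\<close>

lemma distance_le:
  assumes "x \<in> \<Omega>" "y \<in> \<Omega>" "z \<in> \<Omega>" "x \<noteq> z" "0 < t" "Rn_dist d x y \<le> t * Rn_dist d x z"
  shows "norm (f x - f y) \<le> max 1 (\<eta> t) * norm (f x - f z)"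
proof (cases "y = x \<or> y = z")
  case True
  then show ?thesis
    using mult_right_mono[of 1 "max 1 (\<eta> t)" "norm (f x - f z)"] by auto
next
  case False
  let ?r = "Rn_dist d x y / Rn_dist d x z"
  have pos: "0 < Rn_dist d x y" "0 < Rn_dist d x z"
    using assms(1-4) False by (auto intro!: Rn_dist_pos \<Omega>_in_Rn)
  have "f x \<noteq> f z" and le: "norm (f x - f y) / norm (f x - f z) \<le> \<eta> ?r"
    using distance_ratio_le[of x y z] assms(1-4) False by auto
  have "?r \<le> t" using assms pos by (simp add: divide_le_eq)
  then have "\<eta> ?r \<le> \<eta> t"
    using homeo pos \<open>0 < t\<close> unfolding increasing_homeo_def
    by (intro strict_mono_on_leD[of "{0<..}" \<eta>]) auto
  then have "norm (f x - f y) / norm (f x - f z) \<le> max 1 (\<eta> t)"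
    using le by linarith
  then show ?thesis
    using \<open>f x \<noteq> f z\<close> by (simp add: pos_divide_le_eq)
qed

lemma injective: assumes "x \<in> \<Omega>" "z \<in> \<Omega>" "x \<noteq> z" shows "f x \<noteq> f z"
proof -
  \<comment> \<open>The definition speaks of three distinct points; the midpoint serves as the third.\<close>
  define y where "y = (\<lambda>i\<in>{..<d}. (x i + z i) / 2)"
  have y: "y \<in> \<Omega>"
    unfolding in_\<Omega>_iff
  proof (intro conjI allI impI)
    fix i assume i: "i < d"
    then have "c i - S / 2 \<le> x i" "x i \<le> c i + S / 2" "c i - S / 2 \<le> z i" "z i \<le> c i + S / 2"
      using assms unfolding in_\<Omega>_iff by auto
    then show "c i - S / 2 \<le> y i" "y i \<le> c i + S / 2"
      using i by (auto simp: y_def field_simps)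
  qed (simp add: y_def Rn_def)
  obtain i where i: "i < d" "x i \<noteq> z i"
    using Rn_eqI[OF \<Omega>_in_Rn[OF assms(1)] \<Omega>_in_Rn[OF assms(2)]] assms(3) by blast
  then have "y i \<noteq> x i" "y i \<noteq> z i" by (auto simp: y_def field_simps)
  then have "y \<noteq> x" "y \<noteq> z" by auto
  then show ?thesis
    using distance_ratio_le[of x y z] assms y by auto
qed

text \<open>
  The form in which quasisymmetry is used: pairs of points at a given scale and bounded relative
  distance have comparable image distances.
\<close>

lemma comparable:
  assumes "x \<in> \<Omega>" "y \<in> \<Omega>" "x' \<in> \<Omega>" "y' \<in> \<Omega>" "x \<noteq> y" "0 < t"
    and "Rn_dist d x x' \<le> t * Rn_dist d x y" "Rn_dist d x y' \<le> t * Rn_dist d x y"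
  shows "norm (f x' - f y') \<le> 2 * max 1 (\<eta> t) * norm (f x - f y)"
proof -
  have "norm (f x' - f y') \<le> norm (f x - f x') + norm (f x - f y')"
    using dist_triangle3[of "f x'" "f y'" "f x"] by (simp add: dist_norm)
  also have "\<dots> \<le> max 1 (\<eta> t) * norm (f x - f y) + max 1 (\<eta> t) * norm (f x - f y)"
    using assms by (intro add_mono distance_le) auto
  finally show ?thesis by simp
qed

lemma exists_other_point:
  assumes "x \<in> \<Omega>"
  obtains z where "z \<in> \<Omega>" "z \<noteq> x"
proof -
  define p where "p = (\<lambda>i\<in>{..<d}. c i - S / 2)"
  have p: "p \<in> \<Omega>" "shift d 0 S p \<in> \<Omega>"
    using d S by (auto simp: p_def cube_def shift_def)
  moreover have "p 0 \<noteq> shift d 0 S p 0"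
    using d S by (simp add: shift_apply)
  then have "p \<noteq> shift d 0 S p" by metis
  ultimately show ?thesis using that by metis
qed

lemma eta_attains: assumes "0 < e" obtains t where "0 < t" "\<eta> t = e"
proof -
  obtain \<zeta> where "homeomorphism {0<..} {0<..} \<eta> \<zeta>"
    using homeo unfolding increasing_homeo_def by blast
  then have "e \<in> \<eta> ` {0<..}"
    using assms unfolding homeomorphism_def by auto
  then show ?thesis using that by auto
qed

lemma continuous_at_point:
  assumes x: "x \<in> \<Omega>" and e: "0 < e"
  obtains \<delta> where "0 < \<delta>" "\<And>y. y \<in> \<Omega> \<Longrightarrow> Rn_dist d x y < \<delta> \<Longrightarrow> norm (f x - f y) < e"
proof -
  obtain z where z: "z \<in> \<Omega>" "z \<noteq> x" using exists_other_point x by blast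
  let ?a = "norm (f x - f z)" and ?D = "Rn_dist d x z"
  have a: "?a > 0" using injective x z by force
  have D: "?D > 0" using x z by (auto intro!: Rn_dist_pos \<Omega>_in_Rn)
  obtain t where t: "0 < t" "\<eta> t = e / (2 * ?a)"
    using eta_attains[of "e / (2 * ?a)"] a e by auto
  show ?thesis
  proof (rule that[of "min ?D (t * ?D)"])
    show "0 < min ?D (t * ?D)" using D t by simp
  next
    fix y assume y: "y \<in> \<Omega>" "Rn_dist d x y < min ?D (t * ?D)"
    show "norm (f x - f y) < e"
    proof (cases "y = x")
      case True then show ?thesis using e by simp
    next
      case False
      have "y \<noteq> z" using y by auto
      have "norm (f x - f y) / ?a \<le> \<eta> (Rn_dist d x y / ?D)"
        using distance_ratio_le[of x y z] x y z False \<open>y \<noteq> z\<close> by auto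
      also have "\<dots> \<le> \<eta> t"
        using homeo t y D Rn_dist_pos[OF \<Omega>_in_Rn[OF x] \<Omega>_in_Rn[OF y(1)]] False
        unfolding increasing_homeo_def
        by (intro strict_mono_on_leD[of "{0<..}" \<eta>]) (auto simp: divide_le_eq)
      finally show ?thesis using t a e by (simp add: field_simps)
    qed
  qed
qed

lemma bounded_image: obtains B where "\<And>x. x \<in> \<Omega> \<Longrightarrow> norm (f x) \<le> B"
proof -
  define x where "x = (\<lambda>i\<in>{..<d}. c i)"
  have "x \<in> \<Omega>" using S by (simp add: x_def cube_def)
  moreover from this obtain z where "z \<in> \<Omega>" "z \<noteq> x" using exists_other_point by blast
  ultimately have xz: "x \<in> \<Omega>" "z \<in> \<Omega>" "z \<noteq> x" by auto
  have D: "Rn_dist d x z > 0" using xz by (auto intro!: Rn_dist_pos \<Omega>_in_Rn)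
  let ?t = "d * S / Rn_dist d x z"
  have "norm (f x - f y) \<le> max 1 (\<eta> ?t) * norm (f x - f z)" if y: "y \<in> \<Omega>" for y
  proof (rule distance_le)
    show "0 < ?t" using D d S by simp
    show "Rn_dist d x y \<le> ?t * Rn_dist d x z"
      using D Rn_dist_le_diameter_cube[OF d S xz(1) y] Rn_diameter_cube_le[OF d S, of c] by simp
  qed (use xz y in auto)
  moreover have "norm (f y) \<le> norm (f x) + norm (f x - f y)" for y
    using norm_triangle_sub[of "f y" "f x"] by (simp add: norm_minus_commute)
  ultimately have "norm (f y) \<le> norm (f x) + max 1 (\<eta> ?t) * norm (f x - f z)" if "y \<in> \<Omega>" for y
    using that by (meson add_left_mono order_trans)
  then show ?thesis using that by blast
qed

text \<open>
  Measurability is transported from the countable product, where the product topology is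
  metrizable and the Borel sets are the product \<open>\<sigma>\<close>-algebra.
\<close>

lemma measurable_on_\<Omega>: "(\<lambda>x. indicat_real \<Omega> x *\<^sub>R f x) \<in> borel_measurable (Rn_borel d)"
proof -
  define r :: "(nat \<Rightarrow> real) \<Rightarrow> nat \<Rightarrow> real" where "r y = restrict y {..<d}" for y
  define e :: "(nat \<Rightarrow> real) \<Rightarrow> nat \<Rightarrow> real" where "e x i = (if i < d then x i else 0)" for x i
  define A where "A = {y. r y \<in> \<Omega>}"
  have A: "A = (\<Inter>i\<in>{..<d}. {y. c i - S / 2 \<le> y i} \<inter> {y. y i \<le> c i + S / 2})"
    unfolding A_def r_def cube_def by (auto simp: PiE_iff)
  have "closed A"
    unfolding A
    by (intro closed_INT ballI closed_Int closed_Collect_le continuous_on_const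
        continuous_on_product_coordinates)
  moreover have "continuous_on A (\<lambda>y. f (r y))"
    unfolding continuous_on_sequentially o_def
  proof (intro allI ballI impI, elim conjE)
    fix u :: "nat \<Rightarrow> nat \<Rightarrow> real" and a assume a: "a \<in> A" and u: "\<forall>n. u n \<in> A" "u \<longlonglongrightarrow> a"
    have co: "(\<lambda>n. u n i) \<longlonglongrightarrow> a i" for i
      using continuous_on_tendsto_compose[OF continuous_on_product_coordinates[of i] u(2)] by simp
    have "(\<lambda>n. Rn_dist d (r a) (r (u n))) \<longlonglongrightarrow> sqrt (\<Sum>i<d. (a i - a i)\<^sup>2)"
      unfolding Rn_dist_def Rn_norm_def L2_set_def r_def
      by (intro tendsto_intros) (auto intro!: tendsto_intros co)
    then have dist: "(\<lambda>n. Rn_dist d (r a) (r (u n))) \<longlonglongrightarrow> 0" by simp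
    show "(\<lambda>n. f (r (u n))) \<longlonglongrightarrow> f (r a)"
    proof (rule tendstoI)
      fix e :: real assume "0 < e"
      then obtain \<delta> where \<delta>: "0 < \<delta>" "\<And>y. y \<in> \<Omega> \<Longrightarrow> Rn_dist d (r a) y < \<delta> \<Longrightarrow> norm (f (r a) - f y) < e"
        using continuous_at_point[of "r a"] a unfolding A_def by blast
      show "\<forall>\<^sub>F n in sequentially. dist (f (r (u n))) (f (r a)) < e"
        using order_tendstoD(2)[OF dist \<delta>(1)]
      proof eventually_elim
        case (elim n)
        then show ?case using \<delta>(2)[of "r (u n)"] u(1) by (simp add: A_def dist_norm norm_minus_commute)
      qed
    qed
  qed
  ultimately have m: "(\<lambda>y. indicat_real A y *\<^sub>R f (r y)) \<in> borel_measurable borel"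
    by (intro borel_measurable_continuous_on_indicator) auto
  have "e \<in> measurable (Rn_borel d) (\<Pi>\<^sub>M i\<in>UNIV. borel)"
  proof (rule measurable_PiM_single')
    fix i :: nat
    show "(\<lambda>x. e x i) \<in> borel_measurable (Rn_borel d)"
      unfolding e_def by (cases "i < d") auto
  qed auto
  then have "e \<in> measurable (Rn_borel d) borel"
    using sets_PiM_equal_borel measurable_cong_sets by blast
  from measurable_compose[OF this m]
  have "(\<lambda>x. indicat_real A (e x) *\<^sub>R f (r (e x))) \<in> borel_measurable (Rn_borel d)" .
  moreover have "r (e x) = x" if "x \<in> Rn d" for x
    by (rule Rn_eqI[OF _ that]) (auto simp: r_def e_def Rn_def)
  ultimately show ?thesis
    by (subst measurable_cong[where g = "\<lambda>x. indicat_real A (e x) *\<^sub>R f (r (e x))"])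
      (auto simp: A_def indicator_def)
qed

text \<open>
  The centre and its \<open>d\<close> neighbours along the axes have mutual distances of the same order, so
  their images do as well. Seen from the image of the centre, at the scale of one of the
  neighbours, the neighbours become separated points of a ball.
\<close>

lemma vertex_star_images:
  defines "H \<equiv> max 1 (\<eta> 1)"
  obtains u :: "nat \<Rightarrow> 'b" where "\<And>i. i < d \<Longrightarrow> u i \<in> cball 0 H"
    "\<And>i j. i < d \<Longrightarrow> j < d \<Longrightarrow> i \<noteq> j \<Longrightarrow> 1 / H\<^sup>2 \<le> dist (u i) (u j)"
proof -
  define x where "x = (\<lambda>i\<in>{..<d}. c i)"
  define v where "v i = shift d i (S / 2) x" for i
  have x: "x \<in> \<Omega>" and v: "v i \<in> \<Omega>" for i
    using S by (simp_all add: in_\<Omega>_iff x_def v_def shift_apply) (simp add: Rn_def)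
  have dx: "Rn_dist d x (v i) = S / 2" if "i < d" for i
    using S that by (simp add: v_def Rn_dist_shift)
  have dv: "S / 2 \<le> Rn_dist d (v i) (v j)" if "i < d" "i \<noteq> j" for i j
    using coordinate_le_Rn_dist[OF that(1), of "v i" "v j"] that S by (simp add: v_def shift_apply)
  have ne: "x \<noteq> v i" if "i < d" for i
    using dx[OF that] S by auto
  have H: "1 \<le> H" by (simp add: H_def)
  let ?\<rho> = "norm (f x - f (v 0))"
  have \<rho>: "?\<rho> > 0" using injective[OF x v ne[of 0]] d by simp
  have up: "norm (f x - f (v i)) \<le> H * ?\<rho>" "?\<rho> \<le> H * norm (f x - f (v i))" if "i < d" for i
    using distance_le[OF x v v, of 0 1 i] distance_le[OF x v v, of i 1 0] ne that d dx unfolding H_def by auto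
  have sep: "norm (f x - f (v i)) \<le> H * norm (f (v i) - f (v j))" if "i < d" "j < d" "i \<noteq> j" for i j
  proof -
    have "norm (f (v i) - f x) \<le> H * norm (f (v i) - f (v j))"
      unfolding H_def
    proof (rule distance_le[OF v x v])
      show "v i \<noteq> v j" using dv[of i j] that S by auto
      show "Rn_dist d (v i) x \<le> 1 * Rn_dist d (v i) (v j)"
        using dv[of i j] that dx[of i] by (simp add: Rn_dist_commute)
    qed simp
    then show ?thesis by (simp add: norm_minus_commute)
  qed
  define u where "u i = (1 / ?\<rho>) *\<^sub>R (f (v i) - f x)" for i
  show ?thesis
  proof
    fix i assume "i < d"
    then have "norm (f (v i) - f x) / ?\<rho> \<le> H"
      using up(1)[of i] \<rho> by (simp add: norm_minus_commute divide_le_eq)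
    then show "u i \<in> cball 0 H"
      by (simp add: u_def del: scaleR_right_diff_distrib)
  next
    fix i j assume ij: "i < d" "j < d" "i \<noteq> j"
    have "?\<rho> \<le> H * norm (f x - f (v i))" using up ij by blast
    also have "\<dots> \<le> H * (H * norm (f (v i) - f (v j)))"
      using sep[OF ij] H by (intro mult_left_mono) auto
    finally have "?\<rho> / H\<^sup>2 \<le> norm (f (v i) - f (v j))"
      using H by (simp add: field_simps power2_eq_square)
    moreover have "u i - u j = (1 / ?\<rho>) *\<^sub>R (f (v i) - f (v j))"
      by (simp add: u_def algebra_simps)
    then have "dist (u i) (u j) = norm (f (v i) - f (v j)) / ?\<rho>"
      by (simp add: dist_norm)
    ultimately show "1 / H\<^sup>2 \<le> dist (u i) (u j)"
      using \<rho> divide_right_mono[of "?\<rho> / H\<^sup>2" "norm (f (v i) - f (v j))" ?\<rho>] by simp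
  qed
qed

end

lemma quasisymmetric_dimension_bound:
  assumes "increasing_homeo \<eta>"
  shows "\<exists>N. \<forall>d c S. \<forall>f :: (nat \<Rightarrow> real) \<Rightarrow> 'b::euclidean_space.
    1 \<le> d \<and> 0 < S \<and> quasisymmetric_on d (cube d c S) \<eta> f \<longrightarrow> d \<le> N"
proof -
  have "0 < 1 / (max 1 (\<eta> 1))\<^sup>2" by simp
  from separated_points_bounded[OF compact_cball[of "0::'b" "max 1 (\<eta> 1)"] this]
  obtain N where N: "\<And>n (u :: nat \<Rightarrow> 'b). (\<forall>i<n. u i \<in> cball 0 (max 1 (\<eta> 1))) \<Longrightarrow>
    (\<forall>i<n. \<forall>j<n. i \<noteq> j \<longrightarrow> 1 / (max 1 (\<eta> 1))\<^sup>2 \<le> dist (u i) (u j)) \<Longrightarrow> n \<le> N"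
    by metis
  show ?thesis
  proof (intro exI[of _ N] allI impI)
    fix d c S and f :: "(nat \<Rightarrow> real) \<Rightarrow> 'b"
    assume "1 \<le> d \<and> 0 < S \<and> quasisymmetric_on d (cube d c S) \<eta> f"
    then interpret qs_cube d \<eta> c S f
      using assms by unfold_locales auto
    show "d \<le> N" using vertex_star_images N by metis
  qed
qed

section \<open>Difference quotients and affine approximation\<close>

lemma Rn_linear_measurable:
  fixes T :: "(nat \<Rightarrow> real) \<Rightarrow> 'b::euclidean_space"
  assumes "Rn_linear d T"
  shows "T \<in> borel_measurable (Rn_borel d)"
proof -
  have "(\<lambda>x. \<Sum>i<d. x i *\<^sub>R T (unit_vec d i)) \<in> borel_measurable (Rn_borel d)"
    by measurable
  then show ?thesis
    by (subst measurable_cong[OF Rn_linear_expand[OF assms]]) auto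
qed

lemma corner_cube_Int_Rn [simp]: "corner_cube d p s \<inter> Rn d = corner_cube d p s"
  by (auto simp: corner_cube_def Rn_def PiE_iff)

lemma shift_in_corner_cube_iff:
  "x \<in> Rn d \<Longrightarrow> shift d i t x \<in> corner_cube d (shift d i t p) s \<longleftrightarrow> x \<in> corner_cube d p s"
  by (auto simp: corner_cube_def shift_def PiE_iff Rn_def)

context qs_cube
begin

text \<open>
  Cauchy-Schwarz passes from the mean square deviation \<open>v\<close>, whose infimum is \<^const>\<open>omega\<close>, to
  the mean absolute deviation. The normalisation by operator norm and diameter is undone here, and
  the completed measure is replaced by the product measure.
\<close>

lemma mean_deviation_le:
  fixes R v :: real
  assumes sub: "cube d a R \<subseteq> \<Omega>" and R: "0 < R" and T: "Rn_linear d T" "Rn_onorm d T \<noteq> 0"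
    and v: "v = sqrt (1 / measure (Rn_lebesgue d) (cube d a R) *
      (LINT x:cube d a R|Rn_lebesgue d.
         (norm (f x - (b + T x)) / (Rn_onorm d T * Rn_diameter d (cube d a R)))\<^sup>2))"
  shows "integrable (Rn_borel d) (\<lambda>x. indicat_real (cube d a R) x * norm (f x - (b + T x)))"
    and "(LINT x|Rn_borel d. indicat_real (cube d a R) x * norm (f x - (b + T x)))
      \<le> d * R ^ (d + 1) * v * Rn_onorm d T"
    and "0 \<le> v"
proof -
  let ?W = "cube d a R"
  define g where "g x = indicat_real ?W x * norm (f x - (b + T x))" for x
  let ?o = "Rn_onorm d T" and ?D = "Rn_diameter d ?W"
  have o: "?o > 0" using Rn_onorm_nonneg[OF T(1)] T(2) by linarith
  have D: "?D > 0" using side_le_Rn_diameter_cube[OF d R, of a] R by linarith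
  have [measurable]: "T \<in> borel_measurable (Rn_borel d)"
    "(\<lambda>x. indicat_real \<Omega> x *\<^sub>R f x) \<in> borel_measurable (Rn_borel d)"
    using Rn_linear_measurable[OF T(1)] measurable_on_\<Omega> by auto
  have "g = (\<lambda>x. indicat_real ?W x * norm (indicat_real \<Omega> x *\<^sub>R f x - (b + T x)))"
    using sub by (intro ext) (auto simp: g_def split: split_indicator)
  then have m[measurable]: "g \<in> borel_measurable (Rn_borel d)" by simp
  obtain B where B: "\<And>x. x \<in> \<Omega> \<Longrightarrow> norm (f x) \<le> B" using bounded_image by blast
  \<comment> \<open>A bound for the deviation on the cube, for integrability only.\<close>
  define B' where "B' = B + norm b + (\<Sum>i<d. (\<bar>a i\<bar> + R) * norm (T (unit_vec d i)))"
  have gB: "\<bar>g x\<bar> \<le> B' * indicat_real ?W x" for x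
  proof (cases "x \<in> ?W")
    case True
    then have xR: "x \<in> Rn d" and co: "\<And>i. i < d \<Longrightarrow> x i \<in> {a i - R / 2..a i + R / 2}"
      by (auto simp: cube_def Rn_def PiE_iff)
    have "norm (T x) \<le> (\<Sum>i<d. norm (x i *\<^sub>R T (unit_vec d i)))"
      unfolding Rn_linear_expand[OF T(1) xR] by (rule norm_sum)
    also have "\<dots> \<le> (\<Sum>i<d. (\<bar>a i\<bar> + R) * norm (T (unit_vec d i)))"
    proof (rule sum_mono)
      fix i assume "i \<in> {..<d}"
      then have "\<bar>x i\<bar> \<le> \<bar>a i\<bar> + R" using co[of i] R by auto
      then show "norm (x i *\<^sub>R T (unit_vec d i)) \<le> (\<bar>a i\<bar> + R) * norm (T (unit_vec d i))"
        by (simp add: mult_right_mono)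
    qed
    finally have "norm (T x) \<le> (\<Sum>i<d. (\<bar>a i\<bar> + R) * norm (T (unit_vec d i)))" .
    moreover have "norm (f x - (b + T x)) \<le> norm (f x) + (norm b + norm (T x))"
      using norm_triangle_ineq4[of "f x" "b + T x"] norm_triangle_ineq[of b "T x"] by linarith
    ultimately show ?thesis using B[of x] sub True by (auto simp: g_def B'_def)
  qed (simp add: g_def)
  have iW: "integrable (Rn_borel d) (\<lambda>x. K * indicat_real ?W x)" for K :: real
    using R by (intro integrable_mult_right integrable_real_indicator) (auto simp: emeasure_cube)
  show ig: "integrable (Rn_borel d) (\<lambda>x. indicat_real ?W x * norm (f x - (b + T x)))"
    unfolding g_def[symmetric]
    by (rule Bochner_Integration.integrable_bound[OF iW[of B'] m]) (simp add: order_trans[OF gB abs_ge_self])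
  have ig2: "integrable (Rn_borel d) (\<lambda>x. (g x)\<^sup>2)"
  proof (rule Bochner_Integration.integrable_bound[OF iW[of "B'\<^sup>2"]], measurable, intro AE_I2)
    fix x
    show "norm ((g x)\<^sup>2) \<le> norm (B'\<^sup>2 * indicat_real ?W x)"
      using power_mono[OF gB[of x], of 2] by (auto simp: indicator_def power_mult_distrib)
  qed
  have W: "measure (Rn_lebesgue d) ?W = R ^ d" "measure (Rn_borel d) ?W = R ^ d"
    using R by (auto simp: measure_Rn_lebesgue_cube measure_cube)
  have "(LINT x:?W|Rn_lebesgue d. (norm (f x - (b + T x)) / (?o * ?D))\<^sup>2)
      = (LINT x|Rn_lebesgue d. (g x)\<^sup>2 / (?o * ?D)\<^sup>2)"
    unfolding set_lebesgue_integral_def g_def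
    by (intro Bochner_Integration.integral_cong) (auto simp: indicator_def power_divide)
  also have "\<dots> = (LINT x|Rn_borel d. (g x)\<^sup>2 / (?o * ?D)\<^sup>2)"
    unfolding Rn_lebesgue_def by (intro integral_completion) measurable
  also have "\<dots> = (LINT x|Rn_borel d. (g x)\<^sup>2) / (?o * ?D)\<^sup>2" by simp
  finally have v2: "v = sqrt ((LINT x|Rn_borel d. (g x)\<^sup>2) / (?o * ?D)\<^sup>2 / R ^ d)"
    unfolding v W by simp
  have nn: "0 \<le> (LINT x|Rn_borel d. (g x)\<^sup>2)" by (intro integral_nonneg_AE) auto
  show v0: "0 \<le> v" unfolding v2 using nn R by simp
  have v3: "v\<^sup>2 = (LINT x|Rn_borel d. (g x)\<^sup>2) / (?o * ?D)\<^sup>2 / R ^ d"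
    unfolding v2 using nn R by simp
  have "(LINT x|Rn_borel d. g x) \<le> sqrt (R ^ d * (LINT x|Rn_borel d. (g x)\<^sup>2))"
    unfolding W(2)[symmetric]
    by (rule integral_norm_le_sqrt[OF ig2 ig[folded g_def]])
      (use R in \<open>auto simp: emeasure_cube g_def\<close>)
  also have "R ^ d * (LINT x|Rn_borel d. (g x)\<^sup>2) = (R ^ d * v * (?o * ?D))\<^sup>2"
    using v3 o D R by (simp add: field_simps power2_eq_square)
  also have "sqrt \<dots> = R ^ d * v * (?o * ?D)"
    using v0 R o D by simp
  also have "\<dots> \<le> R ^ d * v * (?o * (d * R))"
    using Rn_diameter_cube_le[OF d R, of a] o v0 R by (intro mult_left_mono) auto
  finally show "(LINT x|Rn_borel d. indicat_real ?W x * norm (f x - (b + T x)))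
      \<le> d * R ^ (d + 1) * v * ?o"
    by (simp add: g_def algebra_simps)
qed

definition step_integral :: "nat \<Rightarrow> (nat \<Rightarrow> real) \<Rightarrow> real \<Rightarrow> 'b" where
  "step_integral i p s =
     (LINT x|Rn_borel d. indicat_real (corner_cube d p s) x *\<^sub>R (f (shift d i s x) - f x))"

definition abs_step_integral :: "nat \<Rightarrow> (nat \<Rightarrow> real) \<Rightarrow> real \<Rightarrow> real" where
  "abs_step_integral i p s =
     (LINT x|Rn_borel d. indicat_real (corner_cube d p s) x * norm (f (shift d i s x) - f x))"

lemma integrable_on_corner_cube:
  assumes "corner_cube d p s \<subseteq> \<Omega>" "0 \<le> s"
  shows "integrable (Rn_borel d) (\<lambda>x. indicat_real (corner_cube d p s) x *\<^sub>R f x)"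
    and "(\<lambda>x. indicat_real (corner_cube d p s) x *\<^sub>R f x) \<in> borel_measurable (Rn_borel d)"
proof -
  have [measurable]: "(\<lambda>x. indicat_real \<Omega> x *\<^sub>R f x) \<in> borel_measurable (Rn_borel d)"
    by (rule measurable_on_\<Omega>)
  have eq: "(\<lambda>x. indicat_real (corner_cube d p s) x *\<^sub>R f x)
      = (\<lambda>x. indicat_real (corner_cube d p s) x *\<^sub>R (indicat_real \<Omega> x *\<^sub>R f x))"
    using assms(1) by (intro ext) (auto split: split_indicator)
  show m: "(\<lambda>x. indicat_real (corner_cube d p s) x *\<^sub>R f x) \<in> borel_measurable (Rn_borel d)"
    by (subst eq) measurable
  obtain B where B: "\<And>x. x \<in> \<Omega> \<Longrightarrow> norm (f x) \<le> B" using bounded_image by blast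
  have i: "integrable (Rn_borel d) (\<lambda>x. B * indicat_real (corner_cube d p s) x)"
    using assms(2)
    by (intro integrable_mult_right integrable_real_indicator) (auto simp: emeasure_corner_cube)
  show "integrable (Rn_borel d) (\<lambda>x. indicat_real (corner_cube d p s) x *\<^sub>R f x)"
  proof (rule Bochner_Integration.integrable_bound[OF i m], intro AE_I2)
    fix x
    show "norm (indicat_real (corner_cube d p s) x *\<^sub>R f x)
        \<le> norm (B * indicat_real (corner_cube d p s) x)"
      using B[of x] assms(1) by (cases "x \<in> corner_cube d p s") auto
  qed
qed

lemma
  assumes sub: "corner_cube d p s \<subseteq> \<Omega>" "corner_cube d (shift d i s p) s \<subseteq> \<Omega>" and s: "0 \<le> s"
  shows step_integrable: "integrable (Rn_borel d)
      (\<lambda>x. indicat_real (corner_cube d p s) x *\<^sub>R (f (shift d i s x) - f x))"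
    and step_integral_eq: "step_integral i p s
      = (LINT x|Rn_borel d. indicat_real (corner_cube d (shift d i s p) s) x *\<^sub>R f x)
        - (LINT x|Rn_borel d. indicat_real (corner_cube d p s) x *\<^sub>R f x)"
proof -
  let ?P = "corner_cube d p s" and ?P' = "corner_cube d (shift d i s p) s"
  note I = integrable_on_corner_cube[OF sub(1) s] and I' = integrable_on_corner_cube[OF sub(2) s]
  have eq: "indicat_real ?P x *\<^sub>R (f (shift d i s x) - f x)
      = indicat_real ?P' (shift d i s x) *\<^sub>R f (shift d i s x) - indicat_real ?P x *\<^sub>R f x"
    if "x \<in> space (Rn_borel d)" for x
    using that shift_in_corner_cube_iff[of x d i s p s] by (simp add: indicator_def)
  have J: "integrable (Rn_borel d) (\<lambda>x. indicat_real ?P' (shift d i s x) *\<^sub>R f (shift d i s x))"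
    by (rule integrable_shift[OF I'(2,1)])
  have "integrable (Rn_borel d) (\<lambda>x. indicat_real ?P' (shift d i s x) *\<^sub>R f (shift d i s x)
      - indicat_real ?P x *\<^sub>R f x)"
    by (rule Bochner_Integration.integrable_diff[OF J I(1)])
  then show "integrable (Rn_borel d) (\<lambda>x. indicat_real ?P x *\<^sub>R (f (shift d i s x) - f x))"
    by (subst Bochner_Integration.integrable_cong[OF refl eq])
  have "step_integral i p s = (LINT x|Rn_borel d.
      indicat_real ?P' (shift d i s x) *\<^sub>R f (shift d i s x) - indicat_real ?P x *\<^sub>R f x)"
    unfolding step_integral_def by (rule Bochner_Integration.integral_cong[OF refl eq])
  also have "\<dots> = (LINT x|Rn_borel d. indicat_real ?P' (shift d i s x) *\<^sub>R f (shift d i s x))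
      - (LINT x|Rn_borel d. indicat_real ?P x *\<^sub>R f x)"
    by (rule Bochner_Integration.integral_diff[OF J I(1)])
  also have "(LINT x|Rn_borel d. indicat_real ?P' (shift d i s x) *\<^sub>R f (shift d i s x))
      = (LINT x|Rn_borel d. indicat_real ?P' x *\<^sub>R f x)"
    by (rule integral_shift[OF I'(2)])
  finally show "step_integral i p s = (LINT x|Rn_borel d. indicat_real ?P' x *\<^sub>R f x)
      - (LINT x|Rn_borel d. indicat_real ?P x *\<^sub>R f x)" .
qed

text \<open>
  The error is an integral of the deviation over two cubes of positive volume, so it is linear in
  the \<open>L\<^sup>2\<close> deviation; this linearity is what makes the square sum of the errors controllable.
\<close>

lemma step_integral_near_affine:
  fixes R v :: real
  assumes sub: "cube d a R \<subseteq> \<Omega>" and R: "0 < R" and T: "Rn_linear d T" "Rn_onorm d T \<noteq> 0"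
    and v: "v = sqrt (1 / measure (Rn_lebesgue d) (cube d a R) *
      (LINT x:cube d a R|Rn_lebesgue d.
         (norm (f x - (b + T x)) / (Rn_onorm d T * Rn_diameter d (cube d a R)))\<^sup>2))"
    and s: "0 < s" and i: "i < d"
    and P: "corner_cube d p s \<subseteq> cube d a R" "corner_cube d (shift d i s p) s \<subseteq> cube d a R"
  shows "norm (step_integral i p s - s ^ (d + 1) *\<^sub>R T (unit_vec d i))
      \<le> 2 * (d * R ^ (d + 1) * v * Rn_onorm d T)"
    and "\<bar>abs_step_integral i p s - s ^ (d + 1) * norm (T (unit_vec d i))\<bar>
      \<le> 2 * (d * R ^ (d + 1) * v * Rn_onorm d T)"
proof -
  let ?P = "corner_cube d p s" and ?W = "cube d a R" and ?e = "s *\<^sub>R T (unit_vec d i)"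
  define g where "g x = indicat_real ?W x * norm (f x - (b + T x))" for x
  define h where "h x = f (shift d i s x) - f x" for x
  note dev = mean_deviation_le[OF sub R T v, folded g_def]
  have [measurable]: "g \<in> borel_measurable (Rn_borel d)" using dev(1) by auto
  have ih: "integrable (Rn_borel d) (\<lambda>x. indicat_real ?P x *\<^sub>R h x)"
    unfolding h_def using P sub s by (intro step_integrable) auto
  have ic: "integrable (Rn_borel d) (\<lambda>x. indicat_real ?P x *\<^sub>R w)" for w :: 'b
    using s by (intro integrable_scaleR_left integrable_real_indicator) (auto simp: emeasure_corner_cube)
  have cint: "(LINT x|Rn_borel d. indicat_real ?P x *\<^sub>R w) = s ^ d *\<^sub>R w" for w :: 'b
    using s by (subst integral_scaleR_left)
      (auto simp: emeasure_corner_cube measure_corner_cube)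
  have idiff: "integrable (Rn_borel d) (\<lambda>x. indicat_real ?P x *\<^sub>R (h x - ?e))"
    using Bochner_Integration.integrable_diff[OF ih ic[of ?e]] by (simp only: scaleR_diff_right)
  \<comment> \<open>The increments of \<open>f\<close> and of the affine map differ by the deviations at the two end points.\<close>
  have ptw: "norm (indicat_real ?P x *\<^sub>R (h x - ?e)) \<le> g (shift d i s x) + g x"
    if x: "x \<in> space (Rn_borel d)" for x
  proof (cases "x \<in> ?P")
    case True
    then have "x \<in> ?W" "shift d i s x \<in> ?W"
      using P shift_in_corner_cube_iff[of x d i s p s] x by auto
    moreover have "h x - ?e = (f (shift d i s x) - (b + T (shift d i s x))) - (f x - (b + T x))"
      using x Rn_linear_shift[OF T(1) _ i, of x s] by (simp add: h_def algebra_simps)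
    then have "norm (h x - ?e) \<le> norm (f (shift d i s x) - (b + T (shift d i s x)))
        + norm (f x - (b + T x))"
      using norm_triangle_ineq4 by metis
    ultimately show ?thesis using True by (simp add: g_def)
  qed (simp add: g_def)
  let ?E = "LINT x|Rn_borel d. norm (indicat_real ?P x *\<^sub>R (h x - ?e))"
  have "?E \<le> (LINT x|Rn_borel d. g (shift d i s x) + g x)"
    using dev(1) integrable_shift[OF _ dev(1)] ptw integrable_norm[OF idiff]
    by (intro Bochner_Integration.integral_mono) auto
  also have "\<dots> = 2 * (LINT x|Rn_borel d. g x)"
    using dev(1) integrable_shift[OF _ dev(1)] by (simp add: integral_shift)
  finally have E: "?E \<le> 2 * (d * R ^ (d + 1) * v * Rn_onorm d T)"
    using dev(2) by simp
  have "(LINT x|Rn_borel d. indicat_real ?P x *\<^sub>R (h x - ?e))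
      = step_integral i p s - s ^ (d + 1) *\<^sub>R T (unit_vec d i)"
    using Bochner_Integration.integral_diff[OF ih ic[of ?e]] cint[of ?e]
    by (simp add: scaleR_diff_right step_integral_def h_def mult.commute)
  then show "norm (step_integral i p s - s ^ (d + 1) *\<^sub>R T (unit_vec d i))
      \<le> 2 * (d * R ^ (d + 1) * v * Rn_onorm d T)"
    using E integral_norm_bound[of "Rn_borel d" "\<lambda>x. indicat_real ?P x *\<^sub>R (h x - ?e)"] by simp
  have ia: "integrable (Rn_borel d) (\<lambda>x. indicat_real ?P x * norm (h x))"
    using integrable_norm[OF ih] by simp
  have ica: "integrable (Rn_borel d) (\<lambda>x. indicat_real ?P x * w)" for w :: real
    using s by (intro integrable_mult_left integrable_real_indicator) (auto simp: emeasure_corner_cube)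
  have "abs_step_integral i p s - s ^ (d + 1) * norm (T (unit_vec d i))
      = (LINT x|Rn_borel d. indicat_real ?P x * norm (h x) - indicat_real ?P x * norm ?e)"
    using Bochner_Integration.integral_diff[OF ia ica[of "norm ?e"]] s
    by (simp add: abs_step_integral_def h_def measure_corner_cube)
  also have "\<bar>\<dots>\<bar> \<le> (LINT x|Rn_borel d. norm (indicat_real ?P x * norm (h x) - indicat_real ?P x * norm ?e))"
    unfolding real_norm_def[symmetric] by (rule integral_norm_bound)
  also have "\<dots> \<le> ?E"
  proof (intro Bochner_Integration.integral_mono)
    show "norm (indicat_real ?P x * norm (h x) - indicat_real ?P x * norm ?e)
        \<le> norm (indicat_real ?P x *\<^sub>R (h x - ?e))" for x
      using norm_triangle_ineq3[of "h x" ?e] by (cases "x \<in> ?P") auto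
  qed (use ia ica[of "norm ?e"] idiff in \<open>auto simp del: norm_scaleR\<close>)
  finally show "\<bar>abs_step_integral i p s - s ^ (d + 1) * norm (T (unit_vec d i))\<bar>
      \<le> 2 * (d * R ^ (d + 1) * v * Rn_onorm d T)"
    using E by simp
qed

end

text \<open>
  With \<open>u = 2 inner g h / (norm g)\<^sup>2 + (norm h)\<^sup>2 / (norm g)\<^sup>2\<close>, the square of \<open>norm (g + h)\<close> is
  \<open>(norm g)\<^sup>2 * (1 + u)\<close>; the first term of \<open>u\<close> is the linear part, and \<open>ln (1 + u) - u\<close> and the
  second term of \<open>u\<close> are quadratic in \<open>r\<close>.
\<close>

lemma abs_ln_norm_step:
  fixes g h :: "'a::real_inner"
  assumes g: "g \<noteq> 0" and h: "norm h \<le> r * norm g" and r: "r \<le> 1 / 5"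
  shows "\<bar>ln (norm (g + h)) - ln (norm g) - inner g h / (norm g)\<^sup>2\<bar> \<le> 10 * r\<^sup>2"
    and "\<bar>inner g h / (norm g)\<^sup>2\<bar> \<le> r" and "norm g / 2 \<le> norm (g + h)"
proof -
  let ?n = "norm g"
  have n: "?n > 0" using g by simp
  have r0: "0 \<le> r" using h n by (smt (verit) norm_ge_zero mult_neg_pos)
  have "\<bar>inner g h\<bar> \<le> ?n * norm h" by (rule Cauchy_Schwarz_ineq2)
  also have "\<dots> \<le> ?n * (r * ?n)" using h n by (intro mult_left_mono) auto
  finally have ip: "\<bar>inner g h\<bar> \<le> r * ?n\<^sup>2" by (simp add: power2_eq_square mult_ac)
  then show ip': "\<bar>inner g h / ?n\<^sup>2\<bar> \<le> r" using n by (simp add: abs_divide divide_le_eq)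
  have "norm g - norm h \<le> norm (g + h)" by (rule norm_diff_ineq)
  moreover have "r * ?n \<le> 1 / 5 * ?n" using r n by (intro mult_right_mono) auto
  ultimately show half: "?n / 2 \<le> norm (g + h)" using h n by linarith
  define u where "u = 2 * (inner g h / ?n\<^sup>2) + (norm h)\<^sup>2 / ?n\<^sup>2"
  have hh: "0 \<le> (norm h)\<^sup>2 / ?n\<^sup>2" "(norm h)\<^sup>2 / ?n\<^sup>2 \<le> r\<^sup>2"
    using power_mono[OF h norm_ge_zero, of 2] n by (auto simp: divide_le_eq power_mult_distrib)
  have r2: "r\<^sup>2 \<le> 1 / 5 * r" unfolding power2_eq_square using r r0 by (intro mult_right_mono)
  have u: "\<bar>u\<bar> \<le> 5 / 2 * r" unfolding u_def using hh ip' r2 by linarith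
  have "(norm (g + h))\<^sup>2 = ?n\<^sup>2 + 2 * inner g h + (norm h)\<^sup>2"
    by (simp add: power2_norm_eq_inner algebra_simps inner_commute)
  also have "\<dots> = ?n\<^sup>2 * (1 + u)"
    using n by (simp add: u_def field_simps)
  finally have "ln ((norm (g + h))\<^sup>2) = ln (?n\<^sup>2 * (1 + u))" by simp
  moreover have "0 < 1 + u" using u r by linarith
  moreover have "0 < norm (g + h)" using half n by linarith
  ultimately have "2 * ln (norm (g + h)) = 2 * ln ?n + ln (1 + u)"
    using n by (simp add: ln_mult ln_realpow)
  then have "ln (norm (g + h)) - ln ?n - inner g h / ?n\<^sup>2
      = (ln (1 + u) - u) / 2 + ((norm h)\<^sup>2 / ?n\<^sup>2) / 2"
    by (simp add: u_def field_simps)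
  moreover have "\<bar>ln (1 + u) - u\<bar> \<le> 2 * u\<^sup>2"
    using u r by (intro abs_ln_one_plus_x_minus_x_bound) linarith
  moreover have "u\<^sup>2 \<le> 25 / 4 * r\<^sup>2"
    using power_mono[OF u abs_ge_zero, of 2] by (simp add: power_mult_distrib power_divide)
  moreover have "\<bar>a\<bar> \<le> 10 * z"
    if "a = b / 2 + c / 2" "\<bar>b\<bar> \<le> 2 * w" "w \<le> 25 / 4 * z" "0 \<le> c" "c \<le> z" for a b c w z :: real
    using that by linarith
  ultimately show "\<bar>ln (norm (g + h)) - ln ?n - inner g h / ?n\<^sup>2\<bar> \<le> 10 * r\<^sup>2"
    using hh by blast
qed

text \<open>
  The points used in the comparison of a cube of side \<open>s\<close> with its subcubes of half the side have
  distance at most \<open>8 * d * s\<close>, the steps have length at least \<open>s / 2\<close>; hence the argument \<open>16 * d\<close>.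
\<close>

definition scale_const :: "nat \<Rightarrow> (real \<Rightarrow> real) \<Rightarrow> real" where
  "scale_const d \<eta> = 2 * max 1 (\<eta> (16 * real d))"

text \<open>
  The factor \<open>(30000 * d) ^ (d + 1)\<close> is the price for passing from the mean over the dilated cube
  to means over the cube, \<open>2 ^ (d + 1)\<close> that for halving the side,
  and \<open>d\<close> bounds the diameter of a cube by its side; a step has two end points.
\<close>

definition approx_const :: "nat \<Rightarrow> real" where
  "approx_const d = 4 * 2 ^ d * real d * (30000 * real d) ^ (d + 1)"

text \<open>
  The relative change of the mean gradient is at most this multiple of \<^const>\<open>omega\<close>; cubes with
  \<^const>\<open>omega\<close> at least \<open>1 / (5 * drift_const d \<eta>)\<close> are treated as exceptional.
\<close>

definition drift_const :: "nat \<Rightarrow> (real \<Rightarrow> real) \<Rightarrow> real" where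
  "drift_const d \<eta> = 8 * real d * scale_const d \<eta> * approx_const d"

text \<open>
  Large enough for the error on exceptional cubes: there \<open>error_const d \<eta> * omega\<^sup>2\<close> is at least
  \<open>8 * scale_const d \<eta>\<close>, which bounds the change of the logarithmic scale in any step.
\<close>

definition error_const :: "nat \<Rightarrow> (real \<Rightarrow> real) \<Rightarrow> real" where
  "error_const d \<eta> = 200 * scale_const d \<eta> * (drift_const d \<eta>)\<^sup>2"

lemma scale_const_ge: "2 \<le> scale_const d \<eta>"
  by (simp add: scale_const_def)

lemma approx_const_ge: "1 \<le> d \<Longrightarrow> 1 \<le> approx_const d"
proof -
  assume d: "1 \<le> d"
  have "1 * 1 * 1 * 1 \<le> 4 * 2 ^ d * real d * (30000 * real d) ^ (d + 1)"
    using d by (intro mult_mono one_le_power) auto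
  then show ?thesis by (simp add: approx_const_def)
qed

lemma drift_const_ge: "1 \<le> d \<Longrightarrow> 1 \<le> drift_const d \<eta>"
proof -
  assume d: "1 \<le> d"
  have "1 * 1 * 1 * 1 \<le> 8 * real d * scale_const d \<eta> * approx_const d"
    using d scale_const_ge[of d \<eta>] approx_const_ge[OF d] by (intro mult_mono) auto
  then show ?thesis by (simp add: drift_const_def)
qed

text \<open>
  The dilated cube \<open>M Q\<close> for the cube \<open>Q\<close> with lower corner \<open>p\<close> and side \<open>s\<close>.
\<close>

definition big_cube :: "nat \<Rightarrow> (nat \<Rightarrow> real) \<Rightarrow> real \<Rightarrow> (nat \<Rightarrow> real) set" where
  "big_cube d p s = cube d (\<lambda>i. p i + s / 2) (30000 * real d * s)"

lemma in_big_cube: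
  assumes "x \<in> Rn d" "0 < s" "\<And>i. i < d \<Longrightarrow> \<bar>x i - p i\<bar> \<le> 10 * s"
  shows "x \<in> big_cube d p s"
proof -
  have "x i \<in> {p i + s / 2 - 30000 * d * s / 2 .. p i + s / 2 + 30000 * d * s / 2}" if "i < d" for i
  proof -
    have "1 * s \<le> d * s" using that assms(2) by (intro mult_right_mono) auto
    then have "s \<le> d * s" by (simp only: mult_1_left)
    with assms(3)[OF that] assms(2) show ?thesis unfolding atLeastAtMost_iff by linarith
  qed
  then show ?thesis using assms(1) by (auto simp: big_cube_def cube_def Rn_def PiE_iff)
qed

lemma corner_cube_in_big_cube:
  assumes "0 < s" "\<And>i. i < d \<Longrightarrow> p i - 9 * s \<le> q i \<and> q i \<le> p i + 9 * s" "t \<le> s"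
  shows "corner_cube d q t \<subseteq> big_cube d p s"
proof
  fix x assume x: "x \<in> corner_cube d q t"
  show "x \<in> big_cube d p s"
  proof (rule in_big_cube[OF _ assms(1)])
    show "x \<in> Rn d" using x by (auto simp: corner_cube_def Rn_def PiE_iff)
    fix i assume i: "i < d"
    then have "x i \<in> {q i..<q i + t}" using x unfolding corner_cube_def by (auto simp: PiE_iff)
    then show "\<bar>x i - p i\<bar> \<le> 10 * s" using assms(2)[OF i] assms(1,3) by auto
  qed
qed

context qs_cube
begin

abbreviation K :: real where "K \<equiv> scale_const d \<eta>"

text \<open>
  \<open>mean_gradient\<close> allows cancellation and refines exactly; \<open>mean_stretch\<close>, with the norm inside the
  integral, is the quantity that quasisymmetry compares in different directions. The two agree up
  to a factor where \<open>f\<close> is nearly affine.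
\<close>

definition mean_gradient :: "(nat \<Rightarrow> real) \<Rightarrow> real \<Rightarrow> 'b" where
  "mean_gradient p s = (1 / s ^ (d + 1)) *\<^sub>R step_integral 0 p s"

definition mean_stretch :: "nat \<Rightarrow> (nat \<Rightarrow> real) \<Rightarrow> real \<Rightarrow> real" where
  "mean_stretch i p s = abs_step_integral i p s / s ^ (d + 1)"

definition slope :: "(nat \<Rightarrow> real) \<Rightarrow> real \<Rightarrow> real" where
  "slope p s = norm (f (shift d 0 s p) - f p) / s"

definition near :: "(nat \<Rightarrow> real) \<Rightarrow> real \<Rightarrow> (nat \<Rightarrow> real) set" where
  "near p s = {x \<in> Rn d. \<forall>i<d. \<bar>x i - p i\<bar> \<le> 4 * s}"

lemma near_in_\<Omega>: "big_cube d p s \<subseteq> \<Omega> \<Longrightarrow> 0 < s \<Longrightarrow> near p s \<subseteq> \<Omega>"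
  using in_big_cube[of _ d s p] unfolding near_def by fastforce

lemma near_comparable:
  assumes W: "big_cube d p s \<subseteq> \<Omega>" and s: "0 < s"
    and x: "x \<in> near p s" "y \<in> near p s" "x' \<in> near p s" "y' \<in> near p s"
    and xy: "s / 2 \<le> Rn_dist d x y"
  shows "norm (f x' - f y') \<le> K * norm (f x - f y)"
proof -
  have le: "Rn_dist d u w \<le> 16 * d * Rn_dist d x y" if "u \<in> near p s" "w \<in> near p s" for u w
  proof -
    have "Rn_dist d u w \<le> d * (8 * s)"
    proof (rule Rn_dist_le_coordinates)
      fix i assume i: "i < d"
      then have "\<bar>u i - p i\<bar> \<le> 4 * s" "\<bar>w i - p i\<bar> \<le> 4 * s" using that by (auto simp: near_def)
      then show "\<bar>u i - w i\<bar> \<le> 8 * s" by linarith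
    qed
    also have "\<dots> \<le> 16 * d * Rn_dist d x y"
      using mult_left_mono[OF xy, of "16 * real d"] by simp
    finally show ?thesis .
  qed
  have "x \<noteq> y" using xy s by auto
  then show ?thesis
    unfolding scale_const_def
    using near_in_\<Omega>[OF W s] x le d by (intro comparable) auto
qed

lemma corner_near: "0 < s \<Longrightarrow> p \<in> Rn d \<Longrightarrow> p \<in> near p s"
  by (simp add: near_def)

lemma shift_corner_near: "0 < s \<Longrightarrow> p \<in> Rn d \<Longrightarrow> shift d i s p \<in> near p s"
  by (simp add: near_def shift_apply)

lemma corner_cube_near:
  assumes "0 < s" "x \<in> corner_cube d p s"
  shows "x \<in> near p s" "shift d i s x \<in> near p s"
proof -
  have xR: "x \<in> Rn d" and co: "\<And>i. i < d \<Longrightarrow> x i \<in> {p i..<p i + s}"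
    using assms by (auto simp: corner_cube_def Rn_def PiE_iff)
  show "x \<in> near p s" using xR co assms(1) by (fastforce simp: near_def)
  show "shift d i s x \<in> near p s" using co assms(1) by (fastforce simp: near_def shift_apply)
qed

lemma slope_pos:
  assumes "big_cube d p s \<subseteq> \<Omega>" "0 < s" "p \<in> Rn d"
  shows "0 < slope p s"
proof -
  have "p \<in> \<Omega>" "shift d 0 s p \<in> \<Omega>"
    using near_in_\<Omega>[OF assms(1,2)] corner_near shift_corner_near assms by blast+
  moreover have "shift d 0 s p 0 \<noteq> p 0" using d assms by (simp add: shift_apply)
  then have "shift d 0 s p \<noteq> p" by metis
  ultimately show ?thesis using injective assms by (simp add: slope_def)
qed

text \<open>
  The image of an axis-parallel step has, up to \<open>K\<close>, the same length for all starting points in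
  the cube and for all directions. This is what allows one direction to control the whole
  linear part.
\<close>

lemma
  assumes W: "big_cube d p s \<subseteq> \<Omega>" and s: "0 < s" and p: "p \<in> Rn d"
  shows mean_stretch_le_direction0: "i < d \<Longrightarrow> mean_stretch i p s \<le> K * mean_stretch 0 p s"
    and mean_stretch_le_slope: "mean_stretch 0 p s \<le> K * slope p s"
    and slope_le_mean_stretch: "slope p s \<le> K * mean_stretch 0 p s"
    and mean_gradient_le_mean_stretch: "norm (mean_gradient p s) \<le> mean_stretch 0 p s"
proof -
  let ?P = "corner_cube d p s" and ?\<alpha> = "norm (f (shift d 0 s p) - f p)"
  have sub: "?P \<subseteq> \<Omega>" "corner_cube d (shift d i s p) s \<subseteq> \<Omega>" for i
    by (intro order_trans[OF corner_cube_in_big_cube W]; use s in \<open>simp add: shift_apply\<close>)+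
  have int: "integrable (Rn_borel d) (\<lambda>x. indicat_real ?P x * norm (f (shift d i s x) - f x))"
    if "i < d" for i
    using integrable_norm[OF step_integrable[OF sub]] s by simp
  have ic: "integrable (Rn_borel d) (\<lambda>x. indicat_real ?P x * w)" for w :: real
    using s by (intro integrable_mult_left integrable_real_indicator) (auto simp: emeasure_corner_cube)
  have cint: "(LINT x|Rn_borel d. indicat_real ?P x * w) = s ^ d * w" for w :: real
    using s by (simp add: measure_corner_cube)
  have d0: "0 < d" using d by simp
  have cmp: "norm (f (shift d i s x) - f x) \<le> K * norm (f (shift d 0 s y) - f y)"
    if "x \<in> insert p ?P" "y \<in> insert p ?P" for x y i
  proof -
    have "s / 2 \<le> Rn_dist d (shift d 0 s y) y"
      using s d0 by (simp add: Rn_dist_commute[of d _ y] Rn_dist_shift)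
    then show ?thesis
      using that corner_cube_near[OF s] corner_near[OF s p] shift_corner_near[OF s p]
      by (intro near_comparable[OF W s]) auto
  qed
  have sd: "0 < s ^ (d + 1)" using s by simp
  show "mean_stretch i p s \<le> K * mean_stretch 0 p s" if i: "i < d"
  proof -
    have "abs_step_integral i p s
        \<le> (LINT x|Rn_borel d. K * (indicat_real ?P x * norm (f (shift d 0 s x) - f x)))"
      unfolding abs_step_integral_def
      using int[OF i] int[OF d0] cmp
      by (intro Bochner_Integration.integral_mono) (auto split: split_indicator)
    then show ?thesis
      using sd by (simp add: mean_stretch_def abs_step_integral_def[of 0] divide_right_mono)
  qed
  have "abs_step_integral 0 p s \<le> (LINT x|Rn_borel d. indicat_real ?P x * (K * ?\<alpha>))"
    unfolding abs_step_integral_def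
    using int[OF d0] ic cmp by (intro Bochner_Integration.integral_mono) (auto split: split_indicator)
  then show "mean_stretch 0 p s \<le> K * slope p s"
    unfolding cint using s by (simp add: mean_stretch_def slope_def divide_le_eq mult_ac)
  have "(LINT x|Rn_borel d. indicat_real ?P x * ?\<alpha>)
      \<le> (LINT x|Rn_borel d. K * (indicat_real ?P x * norm (f (shift d 0 s x) - f x)))"
    using int[OF d0] ic cmp by (intro Bochner_Integration.integral_mono) (auto split: split_indicator)
  then show "slope p s \<le> K * mean_stretch 0 p s"
    unfolding cint using s
    by (simp add: mean_stretch_def slope_def abs_step_integral_def field_simps)
  have "norm (step_integral 0 p s) \<le> abs_step_integral 0 p s"
    unfolding step_integral_def abs_step_integral_def
    using integral_norm_bound[of "Rn_borel d" "\<lambda>x. indicat_real ?P x *\<^sub>R (f (shift d 0 s x) - f x)"]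
    by simp
  then show "norm (mean_gradient p s) \<le> mean_stretch 0 p s"
    using sd s by (simp add: mean_gradient_def mean_stretch_def divide_right_mono)
qed

text \<open>
  The affine map is close to \<open>f\<close> in the mean along every axis, so quasisymmetry bounds its operator
  norm by the stretch in the first direction alone. This makes the approximation errors small
  against the mean gradient itself, both on the cube and on a subcube of half the side.
\<close>

lemma gradient_of_nearly_affine:
  assumes W: "big_cube d p s \<subseteq> \<Omega>" and s: "0 < s" and p: "p \<in> Rn d"
    and T: "Rn_linear d T" "Rn_onorm d T \<noteq> 0"
    and v: "v = sqrt (1 / measure (Rn_lebesgue d) (big_cube d p s) *
      (LINT x:big_cube d p s|Rn_lebesgue d.
         (norm (f x - (b + T x)) / (Rn_onorm d T * Rn_diameter d (big_cube d p s)))\<^sup>2))"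
    and small: "v \<le> 1 / (5 * drift_const d \<eta>)"
  shows "mean_stretch 0 p s \<le> 2 * norm (mean_gradient p s)"
    and "(\<And>i. i < d \<Longrightarrow> p i \<le> q i \<and> q i \<le> p i + s) \<Longrightarrow>
      norm (mean_gradient q (s / 2) - mean_gradient p s) \<le> drift_const d \<eta> * v * norm (mean_gradient p s)"
proof -
  let ?o = "Rn_onorm d T" and ?C = "approx_const d" and ?D = "mean_stretch 0 p s"
    and ?G = "mean_gradient p s"
  have d0: "0 < d" using d by simp
  have R: "0 < 30000 * real d * s" using s d0 by simp
  have o: "0 < ?o" using Rn_onorm_nonneg[OF T(1)] T(2) by linarith
  have v0: "0 \<le> v"
    using mean_deviation_le(3)[OF W[unfolded big_cube_def] R T] v unfolding big_cube_def by blast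
  have approx: "norm (step_integral i q t - t ^ (d + 1) *\<^sub>R T (unit_vec d i)) \<le> t ^ (d + 1) * (?C * v * ?o)"
    "\<bar>abs_step_integral i q t - t ^ (d + 1) * norm (T (unit_vec d i))\<bar> \<le> t ^ (d + 1) * (?C * v * ?o)"
    if i: "i < d" and q: "\<And>i. i < d \<Longrightarrow> p i \<le> q i \<and> q i \<le> p i + s" and t: "s / 2 \<le> t" "t \<le> s" for i q t
  proof -
    have P: "corner_cube d q t \<subseteq> big_cube d p s" "corner_cube d (shift d i t q) t \<subseteq> big_cube d p s"
      using q t s by (intro corner_cube_in_big_cube; force simp: shift_apply)+
    have t0: "0 < t" using t s by simp
    have "s ^ (d + 1) \<le> (2 * t) ^ (d + 1)" using t s by (intro power_mono) auto
    then have "2 * (real d * (30000 * real d) ^ (d + 1) * v * ?o) * s ^ (d + 1)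
        \<le> 2 * (real d * (30000 * real d) ^ (d + 1) * v * ?o) * (2 * t) ^ (d + 1)"
      using v0 o by (intro mult_left_mono) auto
    then have le: "2 * (real d * (30000 * real d * s) ^ (d + 1) * v * ?o) \<le> t ^ (d + 1) * (?C * v * ?o)"
      unfolding approx_const_def power_mult_distrib by (simp add: mult_ac)
    note near_affine = step_integral_near_affine[OF W[unfolded big_cube_def] R T
        v[unfolded big_cube_def] t0 i P[unfolded big_cube_def]]
    show "norm (step_integral i q t - t ^ (d + 1) *\<^sub>R T (unit_vec d i)) \<le> t ^ (d + 1) * (?C * v * ?o)"
      using near_affine(1) le by (rule order_trans)
    show "\<bar>abs_step_integral i q t - t ^ (d + 1) * norm (T (unit_vec d i))\<bar> \<le> t ^ (d + 1) * (?C * v * ?o)"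
      using near_affine(2) le by (rule order_trans)
  qed
  have grad: "norm (mean_gradient q t - T (unit_vec d 0)) \<le> ?C * v * ?o"
    if q: "\<And>i. i < d \<Longrightarrow> p i \<le> q i \<and> q i \<le> p i + s" and t: "s / 2 \<le> t" "t \<le> s" for q t
  proof -
    have t0: "0 < t ^ (d + 1)" "t \<noteq> 0" using t s by simp_all
    have "mean_gradient q t - T (unit_vec d 0)
        = (1 / t ^ (d + 1)) *\<^sub>R (step_integral 0 q t - t ^ (d + 1) *\<^sub>R T (unit_vec d 0))"
      using t0 unfolding mean_gradient_def scaleR_diff_right scaleR_scaleR by simp
    also have "norm \<dots> = norm (step_integral 0 q t - t ^ (d + 1) *\<^sub>R T (unit_vec d 0)) / t ^ (d + 1)"
      using t0 unfolding norm_scaleR by simp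
    also have "\<dots> \<le> ?C * v * ?o"
      using approx(1)[OF d0 q t] t0 by (simp only: pos_divide_le_eq mult.commute)
    finally show ?thesis .
  qed
  have stretch: "\<bar>mean_stretch i p s - norm (T (unit_vec d i))\<bar> \<le> ?C * v * ?o" if i: "i < d" for i
  proof -
    have s0: "0 < s ^ (d + 1)" using s by simp
    have "mean_stretch i p s - norm (T (unit_vec d i))
        = (abs_step_integral i p s - s ^ (d + 1) * norm (T (unit_vec d i))) / s ^ (d + 1)"
      using s0 s by (simp add: mean_stretch_def diff_divide_distrib)
    also have "\<bar>\<dots>\<bar> = \<bar>abs_step_integral i p s - s ^ (d + 1) * norm (T (unit_vec d i))\<bar> / s ^ (d + 1)"
      using s0 by (simp only: abs_divide abs_of_pos)
    also have "\<dots> \<le> ?C * v * ?o"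
      using approx(2)[OF i, of p s] s s0 by (simp only: pos_divide_le_eq mult.commute) auto
    finally show ?thesis .
  qed
  have K: "2 \<le> K" by (rule scale_const_ge)
  have C: "1 \<le> ?C" using approx_const_ge d by blast
  have D0: "0 \<le> ?D"
    unfolding mean_stretch_def abs_step_integral_def using s
    by (intro divide_nonneg_pos integral_nonneg_AE AE_I2) auto
  have "drift_const d \<eta> * v \<le> 1 / 5"
    using small drift_const_ge[OF d, of \<eta>] by (simp add: field_simps)
  \<comment> \<open>The threshold in terms of the constants; all smallness below comes from this.\<close>
  then have sm: "40 * (d * K * ?C * v) \<le> 1"
    by (simp add: drift_const_def mult_ac)
  have "1 * (d * ?C * v) \<le> K * (d * ?C * v)"
    using K C v0 by (intro mult_right_mono) auto
  then have sm1: "d * ?C * v \<le> 1 / 2" using sm by (simp add: mult_ac)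
  have "?o \<le> (\<Sum>i<d. norm (T (unit_vec d i)))" by (rule Rn_onorm_le_sum[OF T(1)])
  also have "\<dots> \<le> (\<Sum>i<d. K * ?D + ?C * v * ?o)"
  proof (rule sum_mono)
    fix i assume "i \<in> {..<d}"
    then show "norm (T (unit_vec d i)) \<le> K * ?D + ?C * v * ?o"
      using stretch[of i] mean_stretch_le_direction0[OF W s p, of i] by auto
  qed
  also have "\<dots> = d * K * ?D + (d * ?C * v) * ?o" by (simp add: algebra_simps)
  also have "\<dots> \<le> d * K * ?D + 1 / 2 * ?o"
    using sm1 o by (intro add_left_mono mult_right_mono) auto
  \<comment> \<open>The operator norm is controlled by the stretch in a single direction.\<close>
  finally have oD: "?o \<le> 2 * d * K * ?D" by simp
  have "4 * (?C * v * ?o) \<le> 4 * (?C * v * (2 * d * K * ?D))"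
    using oD C v0 by (intro mult_left_mono) auto
  also have "\<dots> = 8 * (d * K * ?C * v) * ?D" by simp
  also have "\<dots> \<le> 1 * ?D" using sm D0 by (intro mult_right_mono) auto
  \<comment> \<open>So the approximation error is small against the stretch itself.\<close>
  finally have err: "4 * (?C * v * ?o) \<le> ?D" by simp
  have "?D \<le> norm (T (unit_vec d 0)) + ?C * v * ?o" using stretch[OF d0] by linarith
  moreover have g0: "norm (?G - T (unit_vec d 0)) \<le> ?C * v * ?o"
    using s by (intro grad) auto
  moreover have "norm (T (unit_vec d 0)) \<le> norm ?G + norm (?G - T (unit_vec d 0))"
    by (metis add.commute norm_minus_commute norm_triangle_sub)
  ultimately show half: "?D \<le> 2 * norm ?G" using err by linarith
  have "norm (mean_gradient q (s / 2) - ?G) \<le> drift_const d \<eta> * v * norm ?G"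
    if q: "\<And>i. i < d \<Longrightarrow> p i \<le> q i \<and> q i \<le> p i + s"
  proof -
    have "norm (mean_gradient q (s / 2) - T (unit_vec d 0)) \<le> ?C * v * ?o"
      using s q by (intro grad) auto
    with g0 have "norm (mean_gradient q (s / 2) - ?G) \<le> 2 * (?C * v * ?o)"
      using norm_triangle_ineq4[of "mean_gradient q (s / 2) - T (unit_vec d 0)" "?G - T (unit_vec d 0)"]
      by simp
    also have "\<dots> \<le> 2 * (?C * v * (2 * d * K * (2 * norm ?G)))"
    proof -
      have "?o \<le> 2 * d * K * (2 * norm ?G)"
        using oD half K mult_left_mono[OF half, of "2 * d * K"] by simp
      then show ?thesis using C v0 by (intro mult_left_mono) auto
    qed
    also have "\<dots> = drift_const d \<eta> * v * norm ?G" by (simp add: drift_const_def)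
    finally show ?thesis .
  qed
  then show "(\<And>i. i < d \<Longrightarrow> p i \<le> q i \<and> q i \<le> p i + s) \<Longrightarrow>
      norm (mean_gradient q (s / 2) - ?G) \<le> drift_const d \<eta> * v * norm ?G" .
qed

end

lemma exists_linear_nonzero:
  assumes "1 \<le> d"
  shows "\<exists>T :: (nat \<Rightarrow> real) \<Rightarrow> 'b::euclidean_space. Rn_linear d T \<and> Rn_onorm d T \<noteq> 0"
proof -
  obtain b :: 'b where b: "b \<in> Basis" using nonempty_Basis by blast
  define T where "T x = x 0 *\<^sub>R b" for x :: "nat \<Rightarrow> real"
  have T: "Rn_linear d T"
    using assms by (auto simp: Rn_linear_def T_def algebra_simps)
  have "(\<Sum>i<d. (unit_vec d 0 i)\<^sup>2) = (\<Sum>i<d. if i = 0 then 1 else 0)"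
    by (intro sum.cong) (auto simp: unit_vec_def)
  then have "Rn_norm d (unit_vec d 0) = 1"
    using assms by (simp add: Rn_norm_def L2_set_def)
  then have "norm (T (unit_vec d 0)) \<le> Rn_onorm d T"
    using T by (intro norm_le_Rn_onorm) auto
  moreover have "norm (T (unit_vec d 0)) = 1"
    using b assms by (simp add: T_def unit_vec_def)
  ultimately show ?thesis using T by (intro exI[of _ T]) auto
qed

lemma
  fixes f :: "(nat \<Rightarrow> real) \<Rightarrow> 'b::euclidean_space"
  assumes "1 \<le> d"
  shows omega_nonneg: "0 \<le> omega d f Q"
    and omega_less_obtain: "omega d f Q < y \<Longrightarrow> \<exists>T b. Rn_linear d T \<and> Rn_onorm d T \<noteq> 0 \<and>
      sqrt (1 / measure (Rn_lebesgue d) Q * (LINT x:Q|Rn_lebesgue d.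
        (norm (f x - (b + T x)) / (Rn_onorm d T * Rn_diameter d Q))\<^sup>2)) < y"
proof -
  let ?S = "{T :: (nat \<Rightarrow> real) \<Rightarrow> 'b. Rn_linear d T \<and> Rn_onorm d T \<noteq> 0} \<times> (UNIV :: 'b set)"
  have ne: "?S \<noteq> {}" using exists_linear_nonzero[OF assms, where 'b = 'b] by auto
  show "0 \<le> omega d f Q"
    unfolding omega_def
  proof (rule cINF_greatest[OF ne], clarify)
    fix T :: "(nat \<Rightarrow> real) \<Rightarrow> 'b" and b :: 'b
    have "0 \<le> (LINT x:Q|Rn_lebesgue d. (norm (f x - (b + T x)) / (Rn_onorm d T * Rn_diameter d Q))\<^sup>2)"
      unfolding set_lebesgue_integral_def by (intro integral_nonneg_AE AE_I2) auto
    then show "0 \<le> sqrt (1 / measure (Rn_lebesgue d) Q * (LINT x:Q|Rn_lebesgue d.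
        (norm (f x - (b + T x)) / (Rn_onorm d T * Rn_diameter d Q))\<^sup>2))" by simp
  qed
  show "\<exists>T b. Rn_linear d T \<and> Rn_onorm d T \<noteq> 0 \<and>
      sqrt (1 / measure (Rn_lebesgue d) Q * (LINT x:Q|Rn_lebesgue d.
        (norm (f x - (b + T x)) / (Rn_onorm d T * Rn_diameter d Q))\<^sup>2)) < y" if "omega d f Q < y"
    using cInf_lessD[OF _ that[unfolded omega_def]] ne by fastforce
qed

definition bits :: "nat \<Rightarrow> (nat \<Rightarrow> nat) set" where
  "bits d = (\<Pi>\<^sub>E i\<in>{..<d}. {0, 1})"

lemma finite_bits [simp]: "finite (bits d)"
  by (simp add: bits_def finite_PiE)

lemma card_bits: "card (bits d) = 2 ^ d"
  by (simp add: bits_def card_PiE numeral_2_eq_2)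

text \<open>
  The bits \<open>k\<close> select one of the subcubes of half the side, and \<open>e\<close> translates it by \<open>e\<close> half-sides
  in the direction of the step. Children in the tree have \<open>e \<le> 1\<close>; the value \<open>2\<close> appears only as
  an end point of steps.
\<close>

definition child :: "nat \<Rightarrow> (nat \<Rightarrow> real) \<Rightarrow> real \<Rightarrow> (nat \<Rightarrow> nat) \<Rightarrow> nat \<Rightarrow> nat \<Rightarrow> real" where
  "child d p s k e = (\<lambda>i\<in>{..<d}. p i + s / 2 * (real (k i) + (if i = 0 then real e else 0)))"

lemma child_in_Rn [simp]: "child d p s k e \<in> Rn d"
  by (simp add: child_def Rn_def)

lemma shift_child: "shift d 0 (s / 2) (child d p s k e) = child d p s k (Suc e)"
  by (auto simp: shift_def child_def algebra_simps)

lemma child_twice: "child d p s k 2 = child d (shift d 0 s p) s k 0"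
  by (auto simp: shift_def child_def algebra_simps)

lemma bits_bounds: "k \<in> bits d \<Longrightarrow> i < d \<Longrightarrow> k i = 0 \<or> k i = 1"
  by (auto simp: bits_def PiE_iff)

lemma corner_cube_partition:
  assumes s: "0 < s" and x: "x \<in> Rn d"
  shows "indicat_real (corner_cube d p s) x
    = (\<Sum>k\<in>bits d. indicat_real (corner_cube d (child d p s k 0) (s / 2)) x)"
proof -
  have box: "indicat_real (corner_cube d q t) x = (\<Prod>i<d. indicat_real {q i..<q i + t} (x i))" for q t
  proof (cases "x \<in> corner_cube d q t")
    case True then show ?thesis by (auto simp: corner_cube_def PiE_iff)
  next
    case False
    then obtain i where "i < d" "x i \<notin> {q i..<q i + t}"
      using x by (auto simp: corner_cube_def PiE_iff Rn_def)
    then have "(\<Prod>i<d. indicat_real {q i..<q i + t} (x i)) = 0"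
      by (intro prod_zero bexI[of _ i]) auto
    then show ?thesis using False by simp
  qed
  have "(\<Sum>k\<in>bits d. indicat_real (corner_cube d (child d p s k 0) (s / 2)) x)
      = (\<Sum>k\<in>bits d. \<Prod>i<d. indicat_real {p i + s / 2 * real (k i)..<p i + s / 2 * real (k i) + s / 2} (x i))"
    unfolding box by (intro sum.cong prod.cong refl) (simp add: child_def)
  also have "\<dots> = (\<Prod>i<d. \<Sum>b\<in>{0, 1::nat}. indicat_real {p i + s / 2 * real b..<p i + s / 2 * real b + s / 2} (x i))"
    unfolding bits_def by (rule prod_sum_PiE[symmetric]) auto
  also have "\<dots> = (\<Prod>i<d. indicat_real {p i..<p i + s} (x i))"
    using s by (intro prod.cong refl) (auto split: split_indicator)
  finally show ?thesis by (simp add: box)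
qed

context qs_cube
begin

lemma integral_corner_cube_refine:
  assumes s: "0 < s" and sub: "\<And>k. k \<in> bits d \<Longrightarrow> corner_cube d (child d p s k 0) (s / 2) \<subseteq> \<Omega>"
  shows "(LINT x|Rn_borel d. indicat_real (corner_cube d p s) x *\<^sub>R f x)
    = (\<Sum>k\<in>bits d. LINT x|Rn_borel d. indicat_real (corner_cube d (child d p s k 0) (s / 2)) x *\<^sub>R f x)"
proof -
  have "(LINT x|Rn_borel d. indicat_real (corner_cube d p s) x *\<^sub>R f x)
      = (LINT x|Rn_borel d. (\<Sum>k\<in>bits d. indicat_real (corner_cube d (child d p s k 0) (s / 2)) x *\<^sub>R f x))"
    by (intro Bochner_Integration.integral_cong refl)
      (simp add: corner_cube_partition[OF s] scaleR_sum_left)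
  also have "\<dots> = (\<Sum>k\<in>bits d. LINT x|Rn_borel d. indicat_real (corner_cube d (child d p s k 0) (s / 2)) x *\<^sub>R f x)"
    using sub s by (intro Bochner_Integration.integral_sum integrable_on_corner_cube(1)) auto
  finally show ?thesis .
qed

text \<open>
  The martingale identity. The averages of \<open>f\<close> refine exactly, and a step of length \<open>s\<close> is two
  steps of length \<open>s / 2\<close>; so the mean gradient of a cube is the average of those of its
  \<open>2\<^sup>d\<close> subcubes and of their translates by half a side in the direction of the step.
\<close>

lemma mean_gradient_martingale:
  assumes W: "big_cube d p s \<subseteq> \<Omega>" and s: "0 < s"
  shows "(\<Sum>k\<in>bits d. \<Sum>e\<in>{0, 1}. mean_gradient (child d p s k e) (s / 2))
    = 2 ^ (d + 1) *\<^sub>R mean_gradient p s"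
proof -
  define I where "I q t = (LINT x|Rn_borel d. indicat_real (corner_cube d q t) x *\<^sub>R f x)" for q t
  have sub: "corner_cube d (child d p s k e) (s / 2) \<subseteq> \<Omega>" if "k \<in> bits d" "e \<le> 3" for k e
  proof (rule order_trans[OF corner_cube_in_big_cube[OF s] W])
    fix i assume i: "i < d"
    define u where "u = real (k i) + (if i = 0 then real e else 0)"
    have "s / 2 * u \<le> s / 2 * 4"
      using bits_bounds[OF that(1) i] that(2) s unfolding u_def by (intro mult_left_mono) auto
    moreover have "0 \<le> s / 2 * u" using s by (simp add: u_def)
    moreover have "child d p s k e i = p i + s / 2 * u" using i by (simp add: child_def u_def)
    ultimately show "p i - 9 * s \<le> child d p s k e i \<and> child d p s k e i \<le> p i + 9 * s"
      using s by linarith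
  qed (use s in auto)
  have step: "step_integral 0 (child d p s k e) (s / 2)
      = I (child d p s k (Suc e)) (s / 2) - I (child d p s k e) (s / 2)" if "k \<in> bits d" "e \<le> 2" for k e
    unfolding I_def using sub[OF that(1)] that(2) s by (subst step_integral_eq) (auto simp: shift_child)
  have refine: "I p s = (\<Sum>k\<in>bits d. I (child d p s k 0) (s / 2))"
    unfolding I_def using sub s by (intro integral_corner_cube_refine) auto
  have refine': "I (shift d 0 s p) s = (\<Sum>k\<in>bits d. I (child d p s k 2) (s / 2))"
    unfolding I_def child_twice using sub[of _ 2] s
    by (intro integral_corner_cube_refine) (auto simp: child_twice)
  have P: "corner_cube d p s \<subseteq> \<Omega>" "corner_cube d (shift d 0 s p) s \<subseteq> \<Omega>"
    by (intro order_trans[OF corner_cube_in_big_cube W]; use s in \<open>simp add: shift_apply\<close>)+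
  \<comment> \<open>The two half-steps telescope.\<close>
  have "(\<Sum>k\<in>bits d. \<Sum>e\<in>{0, 1}. step_integral 0 (child d p s k e) (s / 2))
      = (\<Sum>k\<in>bits d. I (child d p s k 2) (s / 2) - I (child d p s k 0) (s / 2))"
    by (intro sum.cong refl) (simp add: step numeral_2_eq_2)
  also have "\<dots> = step_integral 0 p s"
    using step_integral_eq[OF P] s unfolding sum_subtractf I_def[symmetric] refine refine' by simp
  finally have sum: "(\<Sum>k\<in>bits d. \<Sum>e\<in>{0, 1}. step_integral 0 (child d p s k e) (s / 2))
      = step_integral 0 p s" .
  have "(\<Sum>k\<in>bits d. \<Sum>e\<in>{0, 1}. mean_gradient (child d p s k e) (s / 2))
      = (1 / (s / 2) ^ (d + 1)) *\<^sub>R (\<Sum>k\<in>bits d. \<Sum>e\<in>{0, 1}. step_integral 0 (child d p s k e) (s / 2))"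
    unfolding mean_gradient_def scaleR_sum_right by simp
  also have "\<dots> = 2 ^ (d + 1) *\<^sub>R mean_gradient p s"
    unfolding sum mean_gradient_def using s by (simp add: power_divide)
  finally show ?thesis .
qed

text \<open>
  The truncation of the mean gradient by the slope makes the logarithm defined, and within a
  bounded distance of the logarithm of the slope, on all cubes.
\<close>

definition log_scale :: "(nat \<Rightarrow> real) \<Rightarrow> real \<Rightarrow> real" where
  "log_scale p s = ln (max (norm (mean_gradient p s)) (slope p s / (8 * K\<^sup>2)))"

definition log_drift :: "(nat \<Rightarrow> real) \<Rightarrow> real \<Rightarrow> (nat \<Rightarrow> real) \<Rightarrow> real" where
  "log_drift p s q = (if omega d f (big_cube d p s) < 1 / (5 * drift_const d \<eta>)
     then inner (mean_gradient p s) (mean_gradient q (s / 2) - mean_gradient p s) / (norm (mean_gradient p s))\<^sup>2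
     else 0)"

lemma log_drift_sum:
  assumes "big_cube d p s \<subseteq> \<Omega>" "0 < s"
  shows "(\<Sum>k\<in>bits d. \<Sum>e\<in>{0, 1}. log_drift p s (child d p s k e)) = 0"
proof -
  let ?G = "mean_gradient p s"
  have "(\<Sum>k\<in>bits d. \<Sum>e\<in>{0, 1::nat}. mean_gradient (child d p s k e) (s / 2) - ?G) = 0"
    unfolding sum_subtractf mean_gradient_martingale[OF assms] by (simp add: card_bits scaleR_sum_left sum_constant_scaleR)
  moreover have "(\<Sum>k\<in>bits d. \<Sum>e\<in>{0, 1}.
        inner ?G (mean_gradient (child d p s k e) (s / 2) - ?G) / (norm ?G)\<^sup>2)
      = inner ?G (\<Sum>k\<in>bits d. \<Sum>e\<in>{0, 1::nat}. mean_gradient (child d p s k e) (s / 2) - ?G) / (norm ?G)\<^sup>2"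
    unfolding inner_sum_right sum_divide_distrib ..
  ultimately show ?thesis
    by (cases "omega d f (big_cube d p s) < 1 / (5 * drift_const d \<eta>)") (simp_all add: log_drift_def del: sum.insert)
qed

lemma log_scale_bounds:
  assumes W: "big_cube d p s \<subseteq> \<Omega>" and s: "0 < s" and p: "p \<in> Rn d"
  shows "log_scale p s \<le> ln (slope p s) + ln K"
    and "ln (slope p s) - ln (8 * K\<^sup>2) \<le> log_scale p s"
proof -
  have a: "0 < slope p s" by (rule slope_pos[OF assms])
  have K: "2 \<le> K" by (rule scale_const_ge)
  then have K2: "1 \<le> 8 * K\<^sup>2" using power_mono[of 2 K 2] by simp
  have "norm (mean_gradient p s) \<le> K * slope p s"
    using mean_gradient_le_mean_stretch[OF assms] mean_stretch_le_slope[OF assms] by linarith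
  moreover have "slope p s / (8 * K\<^sup>2) \<le> K * slope p s"
  proof -
    have "slope p s / (8 * K\<^sup>2) \<le> slope p s" using K2 a by (simp add: divide_le_eq mult_le_cancel_left1)
    also have "\<dots> \<le> K * slope p s" using K a by simp
    finally show ?thesis .
  qed
  ultimately have "max (norm (mean_gradient p s)) (slope p s / (8 * K\<^sup>2)) \<le> slope p s * K"
    by (simp add: mult.commute)
  moreover have pos: "0 < slope p s / (8 * K\<^sup>2)" using a K2 by (intro divide_pos_pos) linarith+
  ultimately have "log_scale p s \<le> ln (slope p s * K)"
    unfolding log_scale_def by (subst ln_le_cancel_iff) auto
  then show "log_scale p s \<le> ln (slope p s) + ln K" using a K by (simp add: ln_mult)
  have "ln (slope p s / (8 * K\<^sup>2)) \<le> log_scale p s"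
    unfolding log_scale_def using pos by (subst ln_le_cancel_iff) auto
  then show "ln (slope p s) - ln (8 * K\<^sup>2) \<le> log_scale p s"
    using a K by (simp add: ln_div)
qed

text \<open>
  The infimum in \<^const>\<open>omega\<close> need not be attained; but the estimate of the change is linear in
  the deviation and holds for affine maps with deviation arbitrarily close to the infimum.
\<close>

lemma gradient_of_small_omega:
  assumes W: "big_cube d p s \<subseteq> \<Omega>" and s: "0 < s" and p: "p \<in> Rn d"
    and small: "omega d f (big_cube d p s) < 1 / (5 * drift_const d \<eta>)"
  shows "slope p s \<le> 2 * K * norm (mean_gradient p s)"
    and "(\<And>i. i < d \<Longrightarrow> p i \<le> q i \<and> q i \<le> p i + s) \<Longrightarrow>
      norm (mean_gradient q (s / 2) - mean_gradient p s)
        \<le> drift_const d \<eta> * omega d f (big_cube d p s) * norm (mean_gradient p s)"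
proof -
  let ?\<omega> = "omega d f (big_cube d p s)" and ?G = "mean_gradient p s" and ?C = "drift_const d \<eta>"
  have C: "1 \<le> ?C" by (rule drift_const_ge[OF d])
  obtain T b where Tb: "Rn_linear d T" "Rn_onorm d T \<noteq> 0" "sqrt (1 / measure (Rn_lebesgue d) (big_cube d p s) *
      (LINT x:big_cube d p s|Rn_lebesgue d.
         (norm (f x - (b + T x)) / (Rn_onorm d T * Rn_diameter d (big_cube d p s)))\<^sup>2)) < 1 / (5 * ?C)"
    using omega_less_obtain[OF d small] by blast
  have "mean_stretch 0 p s \<le> 2 * norm ?G"
    by (rule gradient_of_nearly_affine(1)[OF W s p Tb(1,2) refl less_imp_le[OF Tb(3)]])
  then have "K * mean_stretch 0 p s \<le> K * (2 * norm ?G)"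
    using scale_const_ge[of d \<eta>] by (intro mult_left_mono) auto
  then show sl: "slope p s \<le> 2 * K * norm ?G"
    using slope_le_mean_stretch[OF W s p] by simp
  have G: "0 < norm ?G"
    using slope_pos[OF W s p] sl by (cases "?G = 0") auto
  show "norm (mean_gradient q (s / 2) - ?G) \<le> ?C * ?\<omega> * norm ?G"
    if q: "\<And>i. i < d \<Longrightarrow> p i \<le> q i \<and> q i \<le> p i + s"
  proof (rule ccontr)
    let ?h = "norm (mean_gradient q (s / 2) - ?G)"
    assume "\<not> ?h \<le> ?C * ?\<omega> * norm ?G"
    then have "?\<omega> < ?h / (?C * norm ?G)" using C G by (simp add: field_simps)
    with small have "?\<omega> < min (1 / (5 * ?C)) (?h / (?C * norm ?G))" by simp
    from omega_less_obtain[OF d this] obtain T b where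
      Tb: "Rn_linear d T" "Rn_onorm d T \<noteq> 0" "sqrt (1 / measure (Rn_lebesgue d) (big_cube d p s) *
      (LINT x:big_cube d p s|Rn_lebesgue d.
         (norm (f x - (b + T x)) / (Rn_onorm d T * Rn_diameter d (big_cube d p s)))\<^sup>2))
         < min (1 / (5 * ?C)) (?h / (?C * norm ?G))" (is "?v < _")
      by blast
    have v5: "?v \<le> 1 / (5 * ?C)" using Tb(3) by simp
    have "?h \<le> ?C * ?v * norm ?G"
      by (rule gradient_of_nearly_affine(2)[OF W s p Tb(1,2) refl v5 q])
    moreover have "?v < ?h / (?C * norm ?G)" using Tb(3) by simp
    then have "?C * ?v * norm ?G < ?h" using C G by (simp add: field_simps)
    ultimately show False by simp
  qed
qed

text \<open>
  On the cubes where \<^const>\<open>omega\<close> is small, this is the second order expansion of the logarithm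
  of the norm. On the others the martingale increment is zero, and the crude bound from
  quasisymmetry is absorbed into the quadratic error.
\<close>

lemma log_scale_step:
  assumes W: "big_cube d p s \<subseteq> \<Omega>" and s: "0 < s" and p: "p \<in> Rn d"
    and Wq: "big_cube d q (s / 2) \<subseteq> \<Omega>" and q: "q \<in> Rn d"
    and pq: "\<And>i. i < d \<Longrightarrow> p i \<le> q i \<and> q i \<le> p i + s"
  shows "\<bar>log_scale q (s / 2) - log_scale p s - log_drift p s q\<bar>
      \<le> error_const d \<eta> * (omega d f (big_cube d p s))\<^sup>2"
    and "\<bar>log_drift p s q\<bar> \<le> drift_const d \<eta> * omega d f (big_cube d p s)"
proof -
  let ?\<omega> = "omega d f (big_cube d p s)" and ?G = "mean_gradient p s" and ?C = "drift_const d \<eta>"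
    and ?H = "mean_gradient q (s / 2)"
  have C: "1 \<le> ?C" by (rule drift_const_ge[OF d])
  have K: "2 \<le> K" by (rule scale_const_ge)
  have s2: "0 < s / 2" using s by simp
  have om: "0 \<le> ?\<omega>" by (rule omega_nonneg[OF d])
  have a: "0 < slope p s" "0 < slope q (s / 2)"
    using slope_pos[OF W s p] slope_pos[OF Wq s2 q] by auto
  have d0: "0 < d" using d by simp
  have nq: "q \<in> near p s" "shift d 0 (s / 2) q \<in> near p s"
    using q pq s by (fastforce simp: near_def shift_apply)+
  have np: "p \<in> near p s" "shift d 0 s p \<in> near p s"
    using corner_near shift_corner_near s p by auto
  have "norm (f (shift d 0 (s / 2) q) - f q) \<le> K * norm (f (shift d 0 s p) - f p)"
    using nq np s d0 by (intro near_comparable[OF W s]) (auto simp: Rn_dist_commute[of d _ p] Rn_dist_shift)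
  then have aq: "slope q (s / 2) \<le> 2 * K * slope p s"
    using s by (simp add: slope_def field_simps)
  have "norm (f (shift d 0 s p) - f p) \<le> K * norm (f (shift d 0 (s / 2) q) - f q)"
    using nq np s d0 by (intro near_comparable[OF W s]) (auto simp: Rn_dist_commute[of d _ q] Rn_dist_shift)
  moreover have "\<dots> \<le> K * (4 * norm (f (shift d 0 (s / 2) q) - f q))"
    using K by (intro mult_left_mono) auto
  ultimately have ap: "slope p s \<le> 2 * K * slope q (s / 2)"
    using s by (simp add: slope_def field_simps)
  have step: "\<bar>log_scale q (s / 2) - log_scale p s - log_drift p s q\<bar> \<le> error_const d \<eta> * ?\<omega>\<^sup>2
      \<and> \<bar>log_drift p s q\<bar> \<le> ?C * ?\<omega>"
  proof (cases "?\<omega> < 1 / (5 * ?C)")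
    case True
    note S = gradient_of_small_omega(1)[OF W s p True] gradient_of_small_omega(2)[OF W s p True, of q, OF pq]
    have G: "?G \<noteq> 0" using S(1) a by auto
    have r: "?C * ?\<omega> \<le> 1 / 5" using True C by (simp add: field_simps)
    note ln = abs_ln_norm_step[OF G S(2) r, simplified]
    \<comment> \<open>The truncation in the logarithmic scale is inactive both on the cube and on its child.\<close>
    have K8: "2 * K \<le> 8 * K\<^sup>2" using K by (simp add: power2_eq_square)
    have "slope p s / (8 * K\<^sup>2) \<le> slope p s / (2 * K)"
      using K8 a K by (intro divide_left_mono) auto
    also have "\<dots> \<le> norm ?G" using S(1) K by (simp add: divide_le_eq mult_ac)
    finally have lp: "log_scale p s = ln (norm ?G)" unfolding log_scale_def by (simp add: max_def)
    have "slope q (s / 2) \<le> 2 * K * (2 * K * norm ?G)"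
      using aq S(1) K mult_left_mono[OF S(1), of "2 * K"] by linarith
    also have "\<dots> \<le> 2 * K * (2 * K * (2 * norm ?H))"
      using ln(3) K by (intro mult_left_mono) auto
    finally have "slope q (s / 2) / (8 * K\<^sup>2) \<le> norm ?H"
      using K by (simp add: divide_le_eq power2_eq_square mult_ac)
    then have lq: "log_scale q (s / 2) = ln (norm ?H)" unfolding log_scale_def by (simp add: max_def)
    have ld: "log_drift p s q = inner ?G (?H - ?G) / (norm ?G)\<^sup>2" using True by (simp add: log_drift_def)
    have "10 * (?C * ?\<omega>)\<^sup>2 \<le> (200 * K) * (?C * ?\<omega>)\<^sup>2" using K by (intro mult_right_mono) auto
    also have "\<dots> = error_const d \<eta> * ?\<omega>\<^sup>2" by (simp add: error_const_def power_mult_distrib)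
    finally show ?thesis using ln(1,2) unfolding lp lq ld by simp
  next
    case False
    then have h: "log_drift p s q = 0" by (simp add: log_drift_def)
    \<comment> \<open>On an exceptional cube the square of \<^const>\<open>omega\<close> is bounded below.\<close>
    have "(1 / (5 * ?C))\<^sup>2 \<le> ?\<omega>\<^sup>2" using False C by (intro power_mono) auto
    then have "error_const d \<eta> * (1 / (5 * ?C))\<^sup>2 \<le> error_const d \<eta> * ?\<omega>\<^sup>2"
      using K by (intro mult_left_mono) (auto simp: error_const_def)
    moreover have "error_const d \<eta> * (1 / (5 * ?C))\<^sup>2 = 8 * K"
      using C by (simp add: error_const_def power_divide power_mult_distrib)
    ultimately have big: "8 * K \<le> error_const d \<eta> * ?\<omega>\<^sup>2" by simp
    have "ln (slope q (s / 2)) \<le> ln (2 * K * slope p s)" "ln (slope p s) \<le> ln (2 * K * slope q (s / 2))"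
      using aq ap a K by auto
    then have "\<bar>ln (slope q (s / 2)) - ln (slope p s)\<bar> \<le> ln (2 * K)"
      using a K by (simp add: ln_mult abs_le_iff)
    then have "\<bar>log_scale q (s / 2) - log_scale p s\<bar> \<le> ln (2 * K) + ln K + ln (8 * K\<^sup>2)"
      using log_scale_bounds[OF W s p] log_scale_bounds[OF Wq s2 q] by linarith
    also have "\<dots> = 4 * ln (2 * K)"
    proof -
      have "ln (8 * K\<^sup>2) = ln ((2::real) ^ 3 * K\<^sup>2)" by simp
      also have "\<dots> = ln ((2::real) ^ 3) + ln (K\<^sup>2)" using K by (subst ln_mult) auto
      also have "\<dots> = 3 * ln 2 + 2 * ln K" using K by (simp add: ln_realpow del: power_numeral)
      finally show ?thesis using K by (simp add: ln_mult)
    qed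
    also have "\<dots> \<le> 8 * K" using ln_le_minus_one[of "2 * K"] K by simp
    finally show ?thesis using h big C om by simp
  qed
  then show "\<bar>log_scale q (s / 2) - log_scale p s - log_drift p s q\<bar> \<le> error_const d \<eta> * ?\<omega>\<^sup>2"
    and "\<bar>log_drift p s q\<bar> \<le> ?C * ?\<omega>" by auto
qed

end

section \<open>A maximal inequality on a tree\<close>

text \<open>
  Iterating \<open>child_avg\<close> takes the expectation over random paths that choose the next child
  uniformly from the index set \<open>\<K>\<close>; different indices may give the same child.
\<close>

definition child_avg :: "'k set \<Rightarrow> ('v \<Rightarrow> 'k \<Rightarrow> 'v) \<Rightarrow> ('v \<Rightarrow> real) \<Rightarrow> 'v \<Rightarrow> real" where
  "child_avg \<K> ch g v = (\<Sum>k\<in>\<K>. g (ch v k)) / card \<K>"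

text \<open>
  The expected sum of \<open>w\<^sup>2\<close> over the first \<open>n\<close> nodes of a random path.
\<close>

primrec energy :: "'k set \<Rightarrow> ('v \<Rightarrow> 'k \<Rightarrow> 'v) \<Rightarrow> ('v \<Rightarrow> real) \<Rightarrow> nat \<Rightarrow> 'v \<Rightarrow> real" where
  "energy \<K> ch w 0 = (\<lambda>v. 0)"
| "energy \<K> ch w (Suc n) = (\<lambda>v. (w v)\<^sup>2 + child_avg \<K> ch (energy \<K> ch w n) v)"

inductive tracks :: "'k set \<Rightarrow> ('v \<Rightarrow> 'k \<Rightarrow> 'v) \<Rightarrow> ('v \<Rightarrow> real) \<Rightarrow> real \<Rightarrow> 'v \<Rightarrow> 'v \<Rightarrow> bool"
  for \<K> ch \<phi> \<Lambda> r where
  root: "tracks \<K> ch \<phi> \<Lambda> r r"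
| step: "tracks \<K> ch \<phi> \<Lambda> r v \<Longrightarrow> k \<in> \<K> \<Longrightarrow> \<bar>\<phi> (ch v k) - \<phi> r\<bar> \<le> \<Lambda> \<Longrightarrow> tracks \<K> ch \<phi> \<Lambda> r (ch v k)"

lemma child_avg_mono:
  assumes "\<And>k. k \<in> \<K> \<Longrightarrow> g (ch v k) \<le> h (ch v k)"
  shows "child_avg \<K> ch g v \<le> child_avg \<K> ch h v"
  unfolding child_avg_def using assms by (intro divide_right_mono sum_mono) auto

lemma iterated_child_avg_nonneg:
  assumes "\<And>v. 0 \<le> g v"
  shows "0 \<le> (child_avg \<K> ch ^^ n) g v"
proof (induction n arbitrary: v)
  case (Suc n)
  then show ?case by (auto simp: child_avg_def intro!: divide_nonneg_nonneg sum_nonneg)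
qed (use assms in simp)

lemma iterated_child_avg_mono:
  assumes "\<And>v. g v \<le> h v"
  shows "(child_avg \<K> ch ^^ n) g v \<le> (child_avg \<K> ch ^^ n) h v"
proof (induction n arbitrary: v)
  case (Suc n)
  then show ?case by (auto intro: child_avg_mono)
qed (use assms in simp)

lemma energy_nonneg: "0 \<le> energy \<K> ch w n v"
  by (induction n arbitrary: v)
    (auto simp: child_avg_def intro!: add_nonneg_nonneg divide_nonneg_nonneg sum_nonneg)

text \<open>
  Beyond the stopping time, the lower bound propagated below is not positive.
\<close>

lemma stopped_bound:
  fixes m q \<Lambda> :: real
  assumes "\<not> (\<bar>m\<bar> < \<Lambda> \<and> q < \<Lambda>)" "1 \<le> \<Lambda>" "0 \<le> q"
  shows "1 \<le> (m\<^sup>2 + q) / \<Lambda>"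
proof -
  have "\<Lambda> \<le> m\<^sup>2 + q"
  proof (cases "q < \<Lambda>")
    case True
    then have "\<Lambda> \<le> \<bar>m\<bar>" using assms(1) by simp
    then have "\<Lambda> * 1 \<le> \<bar>m\<bar> * \<bar>m\<bar>" using assms(2) by (intro mult_mono) auto
    then show ?thesis using assms(3) by (simp add: power2_eq_square)
  qed (simp add: add_increasing)
  then show ?thesis using assms(2) by simp
qed

text \<open>
  Kolmogorov's inequality along random paths of the tree, together with Markov's inequality for
  the quadratic error. The value of the martingale part (\<open>m\<close>) and of the accumulated error
  (\<open>q\<close>) at the present node are parameters, so that the inequality propagates from the
  leaves to the root: the mean of \<open>(m + h)\<^sup>2\<close> over the children is \<open>m\<^sup>2\<close> plus the mean of
  \<open>h\<^sup>2\<close>, and once \<open>m\<close> or \<open>q\<close> has exceeded \<open>\<Lambda>\<close> the lower bound is trivial.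
\<close>

lemma tracks_proportion:
  fixes \<phi> w :: "'v \<Rightarrow> real" and \<Lambda> B :: real
  assumes \<K>: "finite \<K>" "\<K> \<noteq> {}" and closed: "\<And>v k. v \<in> V \<Longrightarrow> k \<in> \<K> \<Longrightarrow> ch v k \<in> V"
    and h0: "\<And>v. v \<in> V \<Longrightarrow> (\<Sum>k\<in>\<K>. h v k) = 0"
    and h2: "\<And>v k. v \<in> V \<Longrightarrow> k \<in> \<K> \<Longrightarrow> (h v k)\<^sup>2 \<le> B * (w v)\<^sup>2"
    and err: "\<And>v k. v \<in> V \<Longrightarrow> k \<in> \<K> \<Longrightarrow> \<bar>\<phi> (ch v k) - \<phi> v - h v k\<bar> \<le> B * (w v)\<^sup>2"
    and B: "0 \<le> B" and \<Lambda>: "1 \<le> \<Lambda>"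
  shows "v \<in> V \<Longrightarrow> 0 \<le> q \<Longrightarrow>
    (\<bar>m\<bar> < \<Lambda> \<Longrightarrow> q < \<Lambda> \<Longrightarrow> tracks \<K> ch \<phi> (2 * \<Lambda>) r v \<and> \<bar>\<phi> v - \<phi> r - m\<bar> \<le> q) \<Longrightarrow>
    1 - (m\<^sup>2 + q) / \<Lambda> - 2 * B / \<Lambda> * energy \<K> ch w n v
      \<le> (child_avg \<K> ch ^^ n) (indicator {u. tracks \<K> ch \<phi> (2 * \<Lambda>) r u}) v"
proof (induction n arbitrary: v m q)
  case (0 v m q)
  show ?case
  proof (cases "\<bar>m\<bar> < \<Lambda> \<and> q < \<Lambda>")
    case True
    then have "tracks \<K> ch \<phi> (2 * \<Lambda>) r v" using 0 by blast
    then show ?thesis using 0 \<Lambda> by simp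
  next
    case False
    then have "1 \<le> (m\<^sup>2 + q) / \<Lambda>" using \<Lambda> 0(2) by (rule stopped_bound)
    moreover have "0 \<le> indicat_real {u. tracks \<K> ch \<phi> (2 * \<Lambda>) r u} v" by simp
    ultimately have "1 - (m\<^sup>2 + q) / \<Lambda> \<le> indicat_real {u. tracks \<K> ch \<phi> (2 * \<Lambda>) r u} v" by linarith
    then show ?thesis by simp
  qed
next
  case (Suc n v m q)
  let ?I = "indicator {u. tracks \<K> ch \<phi> (2 * \<Lambda>) r u} :: 'v \<Rightarrow> real"
  show ?case
  proof (cases "\<bar>m\<bar> < \<Lambda> \<and> q < \<Lambda>")
    case False
    then have "1 \<le> (m\<^sup>2 + q) / \<Lambda>" using \<Lambda> Suc.prems(2) by (rule stopped_bound)
    moreover have "0 \<le> 2 * B / \<Lambda> * energy \<K> ch w (Suc n) v"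
      using B \<Lambda> by (intro mult_nonneg_nonneg divide_nonneg_nonneg energy_nonneg) auto
    moreover have "0 \<le> (child_avg \<K> ch ^^ Suc n) ?I v" by (rule iterated_child_avg_nonneg) simp
    ultimately show ?thesis by linarith
  next
    case True
    with Suc.prems have tr: "tracks \<K> ch \<phi> (2 * \<Lambda>) r v" "\<bar>\<phi> v - \<phi> r - m\<bar> \<le> q" by blast+
    let ?q = "q + B * (w v)\<^sup>2" and ?E = "energy \<K> ch w n"
    let ?N = "real (card \<K>)"
    have N: "0 < ?N" using \<K> by (simp add: card_gt_0_iff)
    \<comment> \<open>Before stopping: pass to the child with the updated martingale value and error.\<close>
    have child: "1 - ((m + h v k)\<^sup>2 + ?q) / \<Lambda> - 2 * B / \<Lambda> * ?E (ch v k) \<le> (child_avg \<K> ch ^^ n) ?I (ch v k)"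
      if k: "k \<in> \<K>" for k
    proof (rule Suc.IH)
      show "ch v k \<in> V" by (rule closed[OF Suc.prems(1) k])
      show "0 \<le> ?q" using Suc.prems(2) B by simp
      assume less: "\<bar>m + h v k\<bar> < \<Lambda>" "?q < \<Lambda>"
      have *: "\<bar>\<phi> (ch v k) - \<phi> r - (m + h v k)\<bar> \<le> ?q"
        using err[OF Suc.prems(1) k] tr(2) by linarith
      then have "\<bar>\<phi> (ch v k) - \<phi> r\<bar> \<le> 2 * \<Lambda>" using less by linarith
      with * show "tracks \<K> ch \<phi> (2 * \<Lambda>) r (ch v k) \<and> \<bar>\<phi> (ch v k) - \<phi> r - (m + h v k)\<bar> \<le> ?q"
        using tracks.step[OF tr(1) k] by blast
    qed
    \<comment> \<open>Orthogonality of the increment and the present value.\<close>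
    have "(\<Sum>k\<in>\<K>. (m + h v k)\<^sup>2) = ?N * m\<^sup>2 + 2 * m * (\<Sum>k\<in>\<K>. h v k) + (\<Sum>k\<in>\<K>. (h v k)\<^sup>2)"
      by (simp add: power2_sum sum.distrib sum_distrib_left algebra_simps)
    also have "\<dots> \<le> ?N * m\<^sup>2 + ?N * (B * (w v)\<^sup>2)"
      using h0[OF Suc.prems(1)] sum_bounded_above[of \<K> "\<lambda>k. (h v k)\<^sup>2" "B * (w v)\<^sup>2"] h2[OF Suc.prems(1)]
      by simp
    finally have sq: "(\<Sum>k\<in>\<K>. (m + h v k)\<^sup>2) \<le> ?N * (m\<^sup>2 + B * (w v)\<^sup>2)" by (simp add: algebra_simps)
    have "?N * (1 - (m\<^sup>2 + q) / \<Lambda> - 2 * B / \<Lambda> * energy \<K> ch w (Suc n) v)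
        = ?N - ?N * (m\<^sup>2 + B * (w v)\<^sup>2) / \<Lambda> - ?N * ?q / \<Lambda> - 2 * B / \<Lambda> * (\<Sum>k\<in>\<K>. ?E (ch v k))"
      using N \<Lambda> by (simp add: child_avg_def field_simps)
    also have "\<dots> \<le> ?N - (\<Sum>k\<in>\<K>. (m + h v k)\<^sup>2) / \<Lambda> - ?N * ?q / \<Lambda> - 2 * B / \<Lambda> * (\<Sum>k\<in>\<K>. ?E (ch v k))"
      using divide_right_mono[OF sq, of \<Lambda>] \<Lambda> by simp
    also have "\<dots> = (\<Sum>k\<in>\<K>. 1 - ((m + h v k)\<^sup>2 + ?q) / \<Lambda> - 2 * B / \<Lambda> * ?E (ch v k))"
      by (simp add: sum_subtractf add_divide_distrib sum.distrib sum_divide_distrib[symmetric]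
          sum_distrib_left[symmetric]) (simp add: distrib_left add_divide_distrib)
    also have "\<dots> \<le> (\<Sum>k\<in>\<K>. (child_avg \<K> ch ^^ n) ?I (ch v k))"
      by (rule sum_mono) (rule child)
    also have "\<dots> = ?N * (child_avg \<K> ch ^^ Suc n) ?I v"
      using N by (simp add: child_avg_def)
    finally show ?thesis using N by (simp only: mult_le_cancel_left_pos)
  qed
qed

lemma
  fixes \<rho> :: real
  assumes flow: "\<And>n (g :: 'v \<Rightarrow> real). (\<And>v. 0 \<le> g v) \<Longrightarrow>
      (\<Sum>v\<in>Lv n. child_avg \<K> ch g v) \<le> \<rho> * (\<Sum>u\<in>Lv (Suc n). g u)" and \<rho>: "0 \<le> \<rho>"
  shows level_sum_iterated: "(\<And>v. 0 \<le> g v) \<Longrightarrow>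
      (\<Sum>v\<in>Lv m. (child_avg \<K> ch ^^ n) g v) \<le> \<rho> ^ n * (\<Sum>u\<in>Lv (m + n). g u)"
    and level_sum_energy:
      "(\<Sum>v\<in>Lv m. energy \<K> ch w n v) \<le> (\<Sum>i<n. \<rho> ^ i * (\<Sum>u\<in>Lv (m + i). (w u)\<^sup>2))"
proof -
  show "(\<Sum>v\<in>Lv m. (child_avg \<K> ch ^^ n) g v) \<le> \<rho> ^ n * (\<Sum>u\<in>Lv (m + n). g u)"
    if g: "\<And>v. 0 \<le> g v"
  proof (induction n arbitrary: m)
    case (Suc n)
    have "(\<Sum>v\<in>Lv m. (child_avg \<K> ch ^^ Suc n) g v)
        \<le> \<rho> * (\<Sum>u\<in>Lv (Suc m). (child_avg \<K> ch ^^ n) g u)"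
      using flow[of "(child_avg \<K> ch ^^ n) g" m, OF iterated_child_avg_nonneg[of g, OF g]] by simp
    also have "\<dots> \<le> \<rho> * (\<rho> ^ n * (\<Sum>u\<in>Lv (Suc m + n). g u))"
      using Suc \<rho> by (intro mult_left_mono)
    finally show ?case by simp
  qed simp
  show "(\<Sum>v\<in>Lv m. energy \<K> ch w n v) \<le> (\<Sum>i<n. \<rho> ^ i * (\<Sum>u\<in>Lv (m + i). (w u)\<^sup>2))"
  proof (induction n arbitrary: m)
    case (Suc n)
    have "(\<Sum>v\<in>Lv m. energy \<K> ch w (Suc n) v)
        = (\<Sum>v\<in>Lv m. (w v)\<^sup>2) + (\<Sum>v\<in>Lv m. child_avg \<K> ch (energy \<K> ch w n) v)"
      by (simp add: sum.distrib)
    also have "\<dots> \<le> (\<Sum>v\<in>Lv m. (w v)\<^sup>2) + \<rho> * (\<Sum>u\<in>Lv (Suc m). energy \<K> ch w n u)"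
      by (intro add_left_mono flow energy_nonneg)
    also have "\<dots> \<le> (\<Sum>v\<in>Lv m. (w v)\<^sup>2)
        + \<rho> * (\<Sum>i<n. \<rho> ^ i * (\<Sum>u\<in>Lv (Suc m + i). (w u)\<^sup>2))"
      using Suc \<rho> by (intro add_left_mono mult_left_mono)
    also have "\<dots> = (\<Sum>i<Suc n. \<rho> ^ i * (\<Sum>u\<in>Lv (m + i). (w u)\<^sup>2))"
      by (simp add: sum.lessThan_Suc_shift sum_distrib_left mult_ac del: sum.lessThan_Suc)
    finally show ?case .
  qed simp
qed

text \<open>
  Counted with multiplicity, the paths from level \<open>m\<close> to level \<open>m + n\<close> visit each node of
  the last level at most \<open>(\<rho> * card \<K>) ^ n\<close> times, so a large proportion of tracking paths
  gives a large number of tracking end nodes.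
\<close>

lemma tracking_nodes_count:
  fixes \<phi> w :: "'v \<Rightarrow> real" and \<Lambda> B \<rho> :: real
  assumes \<K>: "finite \<K>" "\<K> \<noteq> {}" and fin: "\<And>n. finite (Lv n)"
    and closed: "\<And>n v k. v \<in> Lv n \<Longrightarrow> k \<in> \<K> \<Longrightarrow> ch v k \<in> Lv (Suc n)"
    and flow: "\<And>n (g :: 'v \<Rightarrow> real). (\<And>v. 0 \<le> g v) \<Longrightarrow>
      (\<Sum>v\<in>Lv n. child_avg \<K> ch g v) \<le> \<rho> * (\<Sum>u\<in>Lv (Suc n). g u)" and \<rho>: "0 \<le> \<rho>"
    and h0: "\<And>n v. v \<in> Lv n \<Longrightarrow> (\<Sum>k\<in>\<K>. h v k) = 0"
    and h2: "\<And>n v k. v \<in> Lv n \<Longrightarrow> k \<in> \<K> \<Longrightarrow> (h v k)\<^sup>2 \<le> B * (w v)\<^sup>2"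
    and err: "\<And>n v k. v \<in> Lv n \<Longrightarrow> k \<in> \<K> \<Longrightarrow> \<bar>\<phi> (ch v k) - \<phi> v - h v k\<bar> \<le> B * (w v)\<^sup>2"
    and B: "0 \<le> B" and \<Lambda>: "1 \<le> \<Lambda>"
  shows "card (Lv m) - 2 * B / \<Lambda> * (\<Sum>i<n. \<rho> ^ i * (\<Sum>u\<in>Lv (m + i). (w u)\<^sup>2))
    \<le> \<rho> ^ n * card {u \<in> Lv (m + n). \<exists>r\<in>Lv m. tracks \<K> ch \<phi> (2 * \<Lambda>) r u}"
proof -
  let ?W = "{u. \<exists>r\<in>Lv m. tracks \<K> ch \<phi> (2 * \<Lambda>) r u}"
  have node: "1 - 2 * B / \<Lambda> * energy \<K> ch w n r \<le> (child_avg \<K> ch ^^ n) (indicator ?W) r"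
    if r: "r \<in> Lv m" for r
  proof -
    have "1 - (0\<^sup>2 + 0) / \<Lambda> - 2 * B / \<Lambda> * energy \<K> ch w n r
        \<le> (child_avg \<K> ch ^^ n) (indicator {u. tracks \<K> ch \<phi> (2 * \<Lambda>) r u}) r"
    proof (rule tracks_proportion[where V = "\<Union> (range Lv)" and h = h])
      show "ch v k \<in> \<Union> (range Lv)" if "v \<in> \<Union> (range Lv)" "k \<in> \<K>" for v k
        using that closed by blast
      show "(\<Sum>k\<in>\<K>. h v k) = 0" if "v \<in> \<Union> (range Lv)" for v
        using that h0 by blast
      show "(h v k)\<^sup>2 \<le> B * (w v)\<^sup>2" if "v \<in> \<Union> (range Lv)" "k \<in> \<K>" for v k
        using that h2 by blast
      show "\<bar>\<phi> (ch v k) - \<phi> v - h v k\<bar> \<le> B * (w v)\<^sup>2" if "v \<in> \<Union> (range Lv)" "k \<in> \<K>" for v k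
        using that err by blast
    qed (use r \<K> B \<Lambda> in \<open>auto intro: tracks.root\<close>)
    also have "\<dots> \<le> (child_avg \<K> ch ^^ n) (indicator ?W) r"
      using r by (intro iterated_child_avg_mono) (auto simp: indicator_def)
    finally show ?thesis by simp
  qed
  have "card (Lv m) - 2 * B / \<Lambda> * (\<Sum>i<n. \<rho> ^ i * (\<Sum>u\<in>Lv (m + i). (w u)\<^sup>2))
      \<le> card (Lv m) - 2 * B / \<Lambda> * (\<Sum>r\<in>Lv m. energy \<K> ch w n r)"
    using B \<Lambda> by (intro diff_left_mono mult_left_mono level_sum_energy flow \<rho>) auto
  also have "\<dots> = (\<Sum>r\<in>Lv m. 1 - 2 * B / \<Lambda> * energy \<K> ch w n r)"
    by (simp add: sum_subtractf sum_distrib_left)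
  also have "\<dots> \<le> (\<Sum>r\<in>Lv m. (child_avg \<K> ch ^^ n) (indicator ?W) r)"
    by (rule sum_mono) (rule node)
  also have "\<dots> \<le> \<rho> ^ n * (\<Sum>u\<in>Lv (m + n). indicator ?W u)"
    by (intro level_sum_iterated flow \<rho>) auto
  also have "(\<Sum>u\<in>Lv (m + n). indicator ?W u) = real (card {u \<in> Lv (m + n). u \<in> ?W})"
    using fin[of "m + n"] by (simp add: indicator_def sum.If_cases Int_def)
  finally show ?thesis by simp
qed

section \<open>The tree of dyadic cubes with half-side translates\<close>

type_synonym node = "nat \<times> (nat \<Rightarrow> nat)"

definition steps :: "nat \<Rightarrow> ((nat \<Rightarrow> nat) \<times> nat) set" where
  "steps d = bits d \<times> {0, 1}"

definition node_child :: "nat \<Rightarrow> node \<Rightarrow> (nat \<Rightarrow> nat) \<times> nat \<Rightarrow> node" where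
  "node_child d v k = (Suc (fst v), \<lambda>i\<in>{..<d}. 2 * snd v i + fst k i + (if i = 0 then snd k else 0))"

text \<open>
  A node of generation \<open>n\<close> with index \<open>j\<close> stands for the cube with lower corner
  \<open>p0 + s0 / 2 ^ n * j\<close>. The last layer in the direction of the step is left out, so that the
  translated descendants of a node do not leave the initial cube.
\<close>

definition level :: "nat \<Rightarrow> nat \<Rightarrow> node set" where
  "level d n = {n} \<times> {j \<in> (\<Pi>\<^sub>E i\<in>{..<d}. {..<2 ^ n}). j 0 + 2 \<le> 2 ^ n}"

lemma level_iff: "v \<in> level d n \<longleftrightarrow> fst v = n \<and> snd v \<in> extensional {..<d} \<and>
    (\<forall>i<d. snd v i < 2 ^ n) \<and> snd v 0 + 2 \<le> 2 ^ n"
  by (cases v) (simp add: level_def PiE_iff Ball_def, blast)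

lemma finite_steps: "finite (steps d)" "steps d \<noteq> {}"
proof -
  have "(\<lambda>i\<in>{..<d}. 0) \<in> bits d" by (simp add: bits_def)
  then show "finite (steps d)" "steps d \<noteq> {}" by (auto simp: steps_def)
qed

lemma card_steps: "card (steps d) = 2 * 2 ^ d"
  by (simp add: steps_def card_cartesian_product card_bits)

lemma finite_level: "finite (level d n)"
proof -
  have "finite (\<Pi>\<^sub>E i\<in>{..<d}. {..<2 ^ n :: nat})" by (intro finite_PiE) auto
  then show ?thesis by (simp add: level_def)
qed

lemma node_child_in_level:
  assumes "1 \<le> d" "v \<in> level d n" "k \<in> steps d"
  shows "node_child d v k \<in> level d (Suc n)"
proof -
  have j: "snd v i < 2 ^ n" if "i < d" for i using assms(2) that by (auto simp: level_iff)
  have j0: "snd v 0 + 2 \<le> 2 ^ n" "fst v = n" using assms(2) by (auto simp: level_iff)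
  have k: "fst k i = 0 \<or> fst k i = 1" if "i < d" for i
    using bits_bounds[of "fst k" d i] assms(3) that unfolding steps_def by (metis mem_Times_iff)
  have e: "snd k = 0 \<or> snd k = 1" using assms(3) by (auto simp: steps_def)
  have "2 * snd v i + fst k i + (if i = 0 then snd k else 0) < 2 * 2 ^ n" if i: "i < d" for i
  proof (cases "i = 0")
    case True
    then have "snd v 0 + 2 \<le> 2 ^ n" "fst k 0 \<le> 1" "snd k \<le> 1" using j0 k[OF i] e by auto
    then show ?thesis using True by simp
  next
    case False
    have "snd v i + 1 \<le> 2 ^ n" "fst k i \<le> 1" using j[OF i] k[OF i] by auto
    then show ?thesis using False by simp
  qed
  moreover have "2 * snd v 0 + fst k 0 + snd k + 2 \<le> 2 * 2 ^ n"
    using j0 k[of 0] e assms(1) by auto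
  ultimately show ?thesis
    using assms(1) j0 by (auto simp: level_iff node_child_def)
qed

lemma node_child_inj:
  assumes "e \<le> 1"
  shows "inj_on (\<lambda>(v, k). node_child d v (k, e)) (level d n \<times> bits d)"
proof (rule inj_onI, clarify)
  fix a j k a' j' k'
  assume v: "(a, j) \<in> level d n" "(a', j') \<in> level d n" and k: "k \<in> bits d" "k' \<in> bits d"
    and eq: "node_child d (a, j) (k, e) = node_child d (a', j') (k', e)"
  have j: "j \<in> extensional {..<d}" "j' \<in> extensional {..<d}" and a: "a = n" "a' = n"
    using v by (auto simp: level_iff)
  have k': "k \<in> extensional {..<d}" "k' \<in> extensional {..<d}"
    using k by (auto simp: bits_def PiE_iff)
  have *: "j i = j' i \<and> k i = k' i" if i: "i < d" for i
  proof -
    have "2 * j i + k i + (if i = 0 then e else 0) = 2 * j' i + k' i + (if i = 0 then e else 0)"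
      using fun_cong[OF arg_cong[OF eq, of snd], of i] i unfolding node_child_def
      by (simp only: restrict_apply lessThan_iff if_True fst_conv snd_conv)
    then have "2 * j i + k i = 2 * j' i + k' i" by simp
    then show ?thesis using bits_bounds[OF k(1) i] bits_bounds[OF k(2) i] by presburger
  qed
  have "j = j'" using j * by (intro extensionalityI[of _ "{..<d}"]) auto
  moreover have "k = k'" using k' * by (intro extensionalityI[of _ "{..<d}"]) auto
  ultimately show "(a, j) = (a', j') \<and> k = k'" using a by simp
qed

text \<open>
  The index of a child determines, for each value of the translation bit, the parent and the
  position bits. So a node has at most two parents, which gives the factor
  \<open>2 / card (steps d) = 1 / 2 ^ d\<close>.
\<close>

lemma level_flow:
  fixes g :: "node \<Rightarrow> real"
  assumes d: "1 \<le> d" and g: "\<And>v. 0 \<le> g v"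
  shows "(\<Sum>v\<in>level d n. child_avg (steps d) (node_child d) g v) \<le> (1 / 2 ^ d) * (\<Sum>u\<in>level d (Suc n). g u)"
proof -
  let ?S = "\<Sum>u\<in>level d (Suc n). g u"
  have one: "(\<Sum>v\<in>level d n. \<Sum>k\<in>bits d. g (node_child d v (k, e))) \<le> ?S" if e: "e \<in> {0, 1}" for e
  proof -
    let ?m = "\<lambda>(v, k). node_child d v (k, e)"
    have "(\<Sum>v\<in>level d n. \<Sum>k\<in>bits d. g (node_child d v (k, e)))
        = (\<Sum>x\<in>level d n \<times> bits d. g (?m x))"
      by (simp add: sum.cartesian_product case_prod_unfold)
    also have "\<dots> = (\<Sum>u\<in>?m ` (level d n \<times> bits d). g u)"
      using node_child_inj[of e d n] e by (subst sum.reindex) auto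
    also have "\<dots> \<le> ?S"
    proof (rule sum_mono2[OF finite_level])
      show "?m ` (level d n \<times> bits d) \<subseteq> level d (Suc n)"
        using e node_child_in_level[OF d] by (fastforce simp: steps_def)
    qed (use g in auto)
    finally show ?thesis .
  qed
  have "(\<Sum>v\<in>level d n. \<Sum>k\<in>steps d. g (node_child d v k))
      = (\<Sum>v\<in>level d n. \<Sum>k\<in>bits d. \<Sum>e\<in>{0, 1}. g (node_child d v (k, e)))"
    unfolding steps_def by (simp only: sum.cartesian_product) (simp add: case_prod_unfold)
  also have "\<dots> = (\<Sum>e\<in>{0, 1}. \<Sum>v\<in>level d n. \<Sum>k\<in>bits d. g (node_child d v (k, e)))"
    by (simp add: sum.distrib)
  also have "\<dots> \<le> (\<Sum>e\<in>{0, 1::nat}. ?S)" by (rule sum_mono) (rule one)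
  also have "\<dots> = 2 * ?S" by simp
  finally have "(\<Sum>v\<in>level d n. \<Sum>k\<in>steps d. g (node_child d v k)) \<le> 2 * ?S" .
  then have "(\<Sum>v\<in>level d n. \<Sum>k\<in>steps d. g (node_child d v k)) / card (steps d) \<le> 2 * ?S / card (steps d)"
    by (intro divide_right_mono) auto
  then show ?thesis by (simp add: child_avg_def sum_divide_distrib card_steps)
qed

text \<open>
  The missing layer has the proportion \<open>1 / 2 ^ n\<close> of the volume.
\<close>

lemma card_level_ge:
  assumes "1 \<le> d"
  shows "(1 - 1 / 2 ^ n) \<le> (1 / 2 ^ d) ^ n * card (level d n)"
proof -
  obtain d' where d': "d = Suc d'" using assms by (cases d) auto
  have "{j \<in> (\<Pi>\<^sub>E i\<in>{..<d}. {..<2 ^ n}). j 0 + 2 \<le> 2 ^ n}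
      = (\<Pi>\<^sub>E i\<in>{..<d}. if i = 0 then {..<2 ^ n - 1} else {..<2 ^ n :: nat})"
    (is "?A = ?B")
  proof (intro set_eqI iffI)
    fix j assume j: "j \<in> ?A"
    show "j \<in> ?B" using j by (auto simp: PiE_iff)
  next
    fix j assume j: "j \<in> ?B"
    then have j0: "j 0 < 2 ^ n - 1" using assms PiE_mem[OF j, of 0] by simp
    moreover have "j i < 2 ^ n" if i: "i < d" for i
    proof (cases "i = 0")
      case True
      then show ?thesis using j0 by simp
    next
      case False
      then show ?thesis using PiE_mem[OF j, of i] i by simp
    qed
    ultimately show "j \<in> ?A" using j by (auto simp: PiE_iff)
  qed
  then have "card (level d n) = (2 ^ n - 1) * (2 ^ n) ^ d'"
    unfolding level_def d' by (simp add: card_cartesian_product card_PiE prod.lessThan_Suc_shift del: prod.lessThan_Suc)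
  then have "real (card (level d n)) = (2 ^ n - 1) * (2 ^ n) ^ d'" by (simp add: of_nat_diff)
  then have "(1 / 2 ^ d) ^ n * card (level d n) = (1 / 2 ^ d) ^ n * ((2 ^ n - 1) * (2 ^ n) ^ d')" by simp
  also have "\<dots> = (2 ^ n - 1) / 2 ^ n"
    by (simp add: d' power_divide power_mult_distrib field_simps flip: power_mult)
  finally show ?thesis by (simp add: diff_divide_distrib)
qed

definition side :: "real \<Rightarrow> node \<Rightarrow> real" where
  "side s0 v = s0 / 2 ^ fst v"

definition corner :: "nat \<Rightarrow> (nat \<Rightarrow> real) \<Rightarrow> real \<Rightarrow> node \<Rightarrow> nat \<Rightarrow> real" where
  "corner d p0 s0 v = (\<lambda>i\<in>{..<d}. p0 i + side s0 v * real (snd v i))"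

lemma corner_in_Rn [simp]: "corner d p0 s0 v \<in> Rn d"
  by (simp add: corner_def Rn_def)

lemma side_node_child: "side s0 (node_child d v k) = side s0 v / 2"
  by (simp add: side_def node_child_def)

lemma corner_node_child:
  "corner d p0 s0 (node_child d v k) = child d (corner d p0 s0 v) (side s0 v) (fst k) (snd k)"
  by (auto simp: corner_def child_def node_child_def side_def field_simps)

lemma corner_node_child_bounds:
  assumes s0: "0 < s0" and k: "k \<in> steps d" and i: "i < d"
  shows "corner d p0 s0 v i \<le> corner d p0 s0 (node_child d v k) i"
    and "corner d p0 s0 (node_child d v k) i \<le> corner d p0 s0 v i + side s0 v"
proof -
  define u where "u = real (fst k i) + (if i = 0 then real (snd k) else 0)"
  have u: "0 \<le> u" "u \<le> 2"
    using k bits_bounds[of "fst k" d i] i by (auto simp: steps_def u_def)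
  have s: "0 < side s0 v" using s0 by (simp add: side_def)
  have "side s0 v / 2 * u \<le> side s0 v / 2 * 2" "0 \<le> side s0 v / 2 * u"
    using u s by (auto intro!: mult_left_mono mult_nonneg_nonneg)
  moreover have "corner d p0 s0 (node_child d v k) i = corner d p0 s0 v i + side s0 v / 2 * u"
    unfolding corner_node_child using i by (simp add: child_def u_def)
  ultimately show "corner d p0 s0 v i \<le> corner d p0 s0 (node_child d v k) i"
    and "corner d p0 s0 (node_child d v k) i \<le> corner d p0 s0 v i + side s0 v" by simp_all
qed

lemma corner_cubes_disjoint:
  assumes s0: "0 < s0" and v: "u \<in> level d n" "v \<in> level d n" "u \<noteq> v"
  shows "corner_cube d (corner d p0 s0 u) (side s0 u) \<inter> corner_cube d (corner d p0 s0 v) (side s0 v) = {}"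
proof (rule ccontr)
  assume "\<not> ?thesis"
  then obtain x where x: "x \<in> corner_cube d (corner d p0 s0 u) (side s0 u)"
    "x \<in> corner_cube d (corner d p0 s0 v) (side s0 v)" by blast
  have fst: "fst u = n" "fst v = n" using v by (auto simp: level_iff)
  have s: "0 < s0 / 2 ^ n" using s0 by simp
  have "snd u i = snd v i" if i: "i < d" for i
  proof -
    have "x i \<in> {p0 i + s0 / 2 ^ n * real (snd u i)..<p0 i + s0 / 2 ^ n * real (snd u i) + s0 / 2 ^ n}"
      "x i \<in> {p0 i + s0 / 2 ^ n * real (snd v i)..<p0 i + s0 / 2 ^ n * real (snd v i) + s0 / 2 ^ n}"
      using x i fst by (auto simp: corner_cube_def PiE_iff corner_def side_def)
    then have "s0 / 2 ^ n * real (snd u i) < s0 / 2 ^ n * (real (snd v i) + 1)"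
      "s0 / 2 ^ n * real (snd v i) < s0 / 2 ^ n * (real (snd u i) + 1)"
      unfolding distrib_left atLeastLessThan_iff by linarith+
    then have "real (snd u i) < real (snd v i) + 1" "real (snd v i) < real (snd u i) + 1"
      using s by (simp_all only: mult_less_cancel_left_pos)
    then show ?thesis by linarith
  qed
  moreover have "snd u \<in> extensional {..<d}" "snd v \<in> extensional {..<d}"
    using v by (auto simp: level_iff)
  ultimately have "snd u = snd v" by (intro extensionalityI[of _ "{..<d}"]) auto
  then show False using fst v(3) by (simp add: prod_eq_iff)
qed

lemma side_level: "v \<in> level d n \<Longrightarrow> side s0 v = s0 / 2 ^ n"
  by (auto simp: level_iff side_def)

text \<open>
  A child starts at most one side above the corner of its parent, and twice its side is one side
  of the parent. Hence cubes of twice the side are nested along every path, although the cubes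
  themselves are not.
\<close>

definition fat_cube :: "nat \<Rightarrow> (nat \<Rightarrow> real) \<Rightarrow> real \<Rightarrow> node \<Rightarrow> (nat \<Rightarrow> real) set" where
  "fat_cube d p0 s0 v = (\<Pi>\<^sub>E i\<in>{..<d}. {corner d p0 s0 v i..corner d p0 s0 v i + 2 * side s0 v})"

lemma fat_cube_in_sets [measurable]: "fat_cube d p0 s0 v \<in> sets (Rn_borel d)"
  unfolding fat_cube_def by (rule box_in_sets) simp

lemma corner_cube_in_fat_cube:
  "0 < s0 \<Longrightarrow> corner_cube d (corner d p0 s0 v) (side s0 v) \<subseteq> fat_cube d p0 s0 v"
  unfolding corner_cube_def fat_cube_def by (intro PiE_mono) (auto simp: side_def intro: less_imp_le add_mono)

lemma fat_cube_node_child: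
  assumes s0: "0 < s0" and k: "k \<in> steps d"
  shows "fat_cube d p0 s0 (node_child d v k) \<subseteq> fat_cube d p0 s0 v"
  unfolding fat_cube_def
proof (intro PiE_mono)
  fix i assume "i \<in> {..<d}"
  then have "corner d p0 s0 v i \<le> corner d p0 s0 (node_child d v k) i"
    and "corner d p0 s0 (node_child d v k) i \<le> corner d p0 s0 v i + side s0 v"
    using corner_node_child_bounds[OF s0 k] by auto
  then show "{corner d p0 s0 (node_child d v k) i..corner d p0 s0 (node_child d v k) i + 2 * side s0 (node_child d v k)}
      \<subseteq> {corner d p0 s0 v i..corner d p0 s0 v i + 2 * side s0 v}"
    unfolding side_node_child by auto
qed

text \<open>
  A point of an end node is thus close, at every scale, to a node whose value of \<open>\<phi>\<close> is under
  control.
\<close>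

lemma tracks_ancestors:
  assumes d: "1 \<le> d" and s0: "0 < s0" and r: "r \<in> level d m" and \<Lambda>: "0 \<le> \<Lambda>"
    and t: "tracks (steps d) (node_child d) \<phi> \<Lambda> r u"
  shows "u \<in> level d (fst u) \<and> m \<le> fst u \<and> (\<forall>n\<in>{m..fst u}. \<exists>v\<in>level d n.
    \<bar>\<phi> v - \<phi> r\<bar> \<le> \<Lambda> \<and> fat_cube d p0 s0 u \<subseteq> fat_cube d p0 s0 v)"
  using t
proof induction
  case root
  have "fst r = m" using r by (auto simp: level_iff)
  then show ?case using r \<Lambda> by (auto intro!: bexI[of _ r])
next
  case (step v k)
  let ?c = "node_child d v k"
  have fst: "fst ?c = Suc (fst v)" by (simp add: node_child_def)
  have lev: "?c \<in> level d (Suc (fst v))"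
    using step.IH step.hyps(2) node_child_in_level[OF d] by blast
  have fat: "fat_cube d p0 s0 ?c \<subseteq> fat_cube d p0 s0 v"
    by (rule fat_cube_node_child[OF s0 step.hyps(2)])
  have "\<exists>v\<in>level d n. \<bar>\<phi> v - \<phi> r\<bar> \<le> \<Lambda> \<and> fat_cube d p0 s0 ?c \<subseteq> fat_cube d p0 s0 v"
    if n: "n \<in> {m..Suc (fst v)}" for n
  proof (cases "n = Suc (fst v)")
    case True
    then show ?thesis using lev step.hyps(3) by blast
  next
    case False
    then have "n \<in> {m..fst v}" using n by auto
    then show ?thesis using step.IH fat by blast
  qed
  then show ?case using lev step.IH unfolding fst by simp
qed

section \<open>The good set\<close>

locale qs_dyadic =
  fixes d :: nat and \<eta> :: "real \<Rightarrow> real" and p0 :: "nat \<Rightarrow> real" and s0 :: real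
    and f :: "(nat \<Rightarrow> real) \<Rightarrow> 'b::euclidean_space"
  assumes dim: "1 \<le> d" and s0: "0 < s0" and homeomorphism: "increasing_homeo \<eta>"
    and qs_big_cube: "quasisymmetric_on d (big_cube d p0 s0) \<eta> f"
begin

sublocale qs_cube d \<eta> "\<lambda>i. p0 i + s0 / 2" "30000 * real d * s0" f
  using dim s0 homeomorphism qs_big_cube by unfold_locales (auto simp: big_cube_def)

abbreviation Q\<^sub>0 :: "(nat \<Rightarrow> real) set" where
  "Q\<^sub>0 \<equiv> cube d (\<lambda>i. p0 i + s0 / 2) s0"

abbreviation (input) node_big_cube :: "node \<Rightarrow> (nat \<Rightarrow> real) set" where
  "node_big_cube v \<equiv> big_cube d (corner d p0 s0 v) (side s0 v)"

abbreviation (input) node_scale :: "node \<Rightarrow> real" where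
  "node_scale v \<equiv> log_scale (corner d p0 s0 v) (side s0 v)"

abbreviation (input) node_slope :: "node \<Rightarrow> real" where
  "node_slope v \<equiv> slope (corner d p0 s0 v) (side s0 v)"

lemma side_pos [simp]: "0 < side s0 v"
  using s0 by (simp add: side_def)

lemma side_nonneg [simp]: "0 \<le> side s0 v"
  by (rule less_imp_le) simp

lemma in_Q0_iff: "x \<in> Q\<^sub>0 \<longleftrightarrow> x \<in> Rn d \<and> (\<forall>i<d. p0 i \<le> x i \<and> x i \<le> p0 i + s0)"
proof -
  have "Q\<^sub>0 = (\<Pi>\<^sub>E i\<in>{..<d}. {p0 i..p0 i + s0})"
    unfolding cube_def by (intro PiE_cong) (simp add: add.assoc)
  then show ?thesis by (auto simp: Rn_def PiE_iff)
qed

lemma Q0_in_\<Omega>: "Q\<^sub>0 \<subseteq> \<Omega>"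
proof
  fix x assume x: "x \<in> Q\<^sub>0"
  have "x \<in> big_cube d p0 s0"
    using x s0 unfolding in_Q0_iff by (intro in_big_cube) (fastforce simp: abs_le_iff)+
  then show "x \<in> \<Omega>" by (simp add: big_cube_def)
qed

lemma index_bounds:
  assumes "v \<in> level d n" "i < d"
  shows "real (snd v i) + 1 \<le> 2 ^ n"
proof -
  have "snd v i + 1 \<le> 2 ^ n" using assms by (auto simp: level_iff)
  then have "real (snd v i + 1) \<le> real (2 ^ n)" by (rule of_nat_mono)
  then show ?thesis by simp
qed

lemma corner_cube_in_Q0:
  assumes v: "v \<in> level d n"
  shows "corner_cube d (corner d p0 s0 v) (side s0 v) \<subseteq> Q\<^sub>0"
    and "corner d p0 s0 v \<in> Q\<^sub>0" and "shift d 0 (side s0 v) (corner d p0 s0 v) \<in> Q\<^sub>0"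
proof -
  let ?s = "side s0 v"
  have b: "p0 i \<le> corner d p0 s0 v i" "corner d p0 s0 v i + ?s \<le> p0 i + s0" if i: "i < d" for i
  proof -
    have "?s * (real (snd v i) + 1) \<le> ?s * 2 ^ n"
      using index_bounds[OF v i] side_pos[of v] by (intro mult_left_mono) auto
    also have "\<dots> = s0" using side_level[OF v] by simp
    finally show "corner d p0 s0 v i + ?s \<le> p0 i + s0"
      using i by (simp add: corner_def algebra_simps)
    have "0 \<le> ?s * real (snd v i)" using side_pos[of v] by simp
    then show "p0 i \<le> corner d p0 s0 v i" using i by (simp add: corner_def)
  qed
  have s: "0 < ?s" by simp
  show "corner_cube d (corner d p0 s0 v) ?s \<subseteq> Q\<^sub>0"
  proof
    fix x assume x: "x \<in> corner_cube d (corner d p0 s0 v) ?s"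
    then have xi: "x i \<in> {corner d p0 s0 v i..<corner d p0 s0 v i + ?s}" if "i < d" for i
      using that by (auto simp: corner_cube_def PiE_iff)
    have "p0 i \<le> x i \<and> x i \<le> p0 i + s0" if i: "i < d" for i
      using b[OF i] xi[OF i] by auto
    moreover have "x \<in> Rn d" using x by (auto simp: corner_cube_def Rn_def PiE_iff)
    ultimately show "x \<in> Q\<^sub>0" by (simp add: in_Q0_iff)
  qed
  have c: "p0 i \<le> corner d p0 s0 v i \<and> corner d p0 s0 v i \<le> p0 i + s0" if "i < d" for i
    using b[OF that] s by linarith
  then show "corner d p0 s0 v \<in> Q\<^sub>0" unfolding in_Q0_iff by simp
  have "p0 i \<le> shift d 0 ?s (corner d p0 s0 v) i \<and> shift d 0 ?s (corner d p0 s0 v) i \<le> p0 i + s0"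
    if "i < d" for i
    using b[OF that] s c[OF that] shift_apply[OF that, of 0 ?s "corner d p0 s0 v"]
    by (cases "i = 0"; simp only: if_True if_False refl) linarith+
  then show "shift d 0 ?s (corner d p0 s0 v) \<in> Q\<^sub>0" unfolding in_Q0_iff by simp
qed

lemma node_big_cube_in_\<Omega>:
  assumes v: "v \<in> level d n"
  shows "node_big_cube v \<subseteq> \<Omega>"
proof
  fix x assume x: "x \<in> node_big_cube v"
  let ?s = "side s0 v"
  have "p0 i + s0 / 2 - 30000 * real d * s0 / 2 \<le> x i \<and> x i \<le> p0 i + s0 / 2 + 30000 * real d * s0 / 2"
    if i: "i < d" for i
  proof -
    define N :: real where "N = 2 ^ n"
    define j where "j = real (snd v i)"
    have N: "1 \<le> N" "s0 = N * ?s" "0 \<le> j" "j + 1 \<le> N"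
      using side_level[OF v] index_bounds[OF v i] by (auto simp: N_def j_def)
    have "x i \<in> {corner d p0 s0 v i + ?s / 2 - 30000 * real d * ?s / 2 ..
        corner d p0 s0 v i + ?s / 2 + 30000 * real d * ?s / 2}"
      using x i unfolding big_cube_def cube_def by (auto simp: PiE_iff simp del: atLeastAtMost_iff)
    then have x1: "p0 i + ?s * j + ?s / 2 - 15000 * (real d * ?s) \<le> x i"
      "x i \<le> p0 i + ?s * j + ?s / 2 + 15000 * (real d * ?s)"
      using i by (auto simp: corner_def j_def)
    have "?s * j \<le> ?s * (N - 1)" "0 \<le> ?s * j"
      using N side_pos[of v] by (auto intro: mult_left_mono)
    moreover have "(N - 1) * ?s \<le> (N - 1) * (real d * ?s)"
      using N dim side_pos[of v] by (intro mult_left_mono) auto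
    ultimately have "p0 i + N * ?s / 2 - 15000 * (real d * (N * ?s)) \<le> x i"
      "x i \<le> p0 i + N * ?s / 2 + 15000 * (real d * (N * ?s))"
      using x1 by (auto simp: algebra_simps)
    then show ?thesis by (simp add: N(2)[symmetric] mult_ac)
  qed
  moreover have "x \<in> Rn d" using x by (auto simp: big_cube_def cube_def Rn_def PiE_iff)
  ultimately show "x \<in> \<Omega>" unfolding in_\<Omega>_iff by blast
qed

text \<open>
  The sum in the assumption is the part of the Carleson sum of the theorem that belongs to the tree,
  divided by the volume of the initial cube. The starting generation \<open>m\<close> is free: a large \<open>m\<close> loses less volume to the missing layer.
\<close>

lemma tracking_nodes_ge:
  assumes energy: "\<And>N. (\<Sum>n<N. (1 / 2 ^ d) ^ n * (\<Sum>v\<in>level d n. (omega d f (node_big_cube v))\<^sup>2)) \<le> C"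
    and \<Lambda>: "1 \<le> \<Lambda>"
  shows "1 - 1 / 2 ^ m - 2 * error_const d \<eta> / \<Lambda> * C \<le> (1 / 2 ^ d) ^ (m + n) *
    card {u \<in> level d (m + n). \<exists>r\<in>level d m. tracks (steps d) (node_child d) (\<lambda>v. node_scale v) (2 * \<Lambda>) r u}"
    (is "_ \<le> _ * real ?c")
proof -
  let ?\<rho> = "1 / 2 ^ d :: real" and ?B = "error_const d \<eta>" and ?w = "\<lambda>v. omega d f (node_big_cube v)"
  have B: "0 \<le> ?B" using scale_const_ge[of d \<eta>] by (simp add: error_const_def)
  have CB: "(drift_const d \<eta>)\<^sup>2 \<le> ?B"
    using mult_right_mono[of 1 "200 * scale_const d \<eta>" "(drift_const d \<eta>)\<^sup>2"] scale_const_ge[of d \<eta>]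
    by (simp add: error_const_def)
  have stepL: "\<bar>node_scale (node_child d v k) - node_scale v - log_drift (corner d p0 s0 v) (side s0 v) (corner d p0 s0 (node_child d v k))\<bar>
      \<le> ?B * (?w v)\<^sup>2"
    "\<bar>log_drift (corner d p0 s0 v) (side s0 v) (corner d p0 s0 (node_child d v k))\<bar> \<le> drift_const d \<eta> * ?w v"
    if v: "v \<in> level d i" and k: "k \<in> steps d" for i v k
  proof -
    have W: "node_big_cube v \<subseteq> \<Omega>" by (rule node_big_cube_in_\<Omega>[OF v])
    have Wq: "big_cube d (corner d p0 s0 (node_child d v k)) (side s0 v / 2) \<subseteq> \<Omega>"
      using node_big_cube_in_\<Omega>[OF node_child_in_level[OF dim v k]] by (simp add: side_node_child)
    have pq: "corner d p0 s0 v l \<le> corner d p0 s0 (node_child d v k) l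
        \<and> corner d p0 s0 (node_child d v k) l \<le> corner d p0 s0 v l + side s0 v" if l: "l < d" for l
      using corner_node_child_bounds[OF s0 k l] by simp
    show "\<bar>node_scale (node_child d v k) - node_scale v - log_drift (corner d p0 s0 v) (side s0 v) (corner d p0 s0 (node_child d v k))\<bar>
        \<le> ?B * (?w v)\<^sup>2"
      "\<bar>log_drift (corner d p0 s0 v) (side s0 v) (corner d p0 s0 (node_child d v k))\<bar> \<le> drift_const d \<eta> * ?w v"
      using log_scale_step[OF W side_pos corner_in_Rn Wq corner_in_Rn pq] by (auto simp: side_node_child)
  qed
  have "real (card (level d m)) - 2 * ?B / \<Lambda> * (\<Sum>i<n. ?\<rho> ^ i * (\<Sum>u\<in>level d (m + i). (?w u)\<^sup>2))
      \<le> ?\<rho> ^ n * ?c"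
  proof (rule tracking_nodes_count[where h = "\<lambda>v k. log_drift (corner d p0 s0 v) (side s0 v) (corner d p0 s0 (node_child d v k))"])
    show "(\<Sum>k\<in>steps d. log_drift (corner d p0 s0 v) (side s0 v) (corner d p0 s0 (node_child d v k))) = 0"
      if v: "v \<in> level d i" for i v
      using log_drift_sum[OF node_big_cube_in_\<Omega>[OF v] side_pos]
      unfolding corner_node_child steps_def sum.cartesian_product by (simp add: case_prod_unfold)
    show "(log_drift (corner d p0 s0 v) (side s0 v) (corner d p0 s0 (node_child d v k)))\<^sup>2 \<le> ?B * (?w v)\<^sup>2"
      if v: "v \<in> level d i" and k: "k \<in> steps d" for i v k
    proof -
      have "(log_drift (corner d p0 s0 v) (side s0 v) (corner d p0 s0 (node_child d v k)))\<^sup>2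
          \<le> (drift_const d \<eta>)\<^sup>2 * (?w v)\<^sup>2"
        using power_mono[OF stepL(2)[OF v k] abs_ge_zero, of 2] by (simp add: power_mult_distrib)
      also have "\<dots> \<le> ?B * (?w v)\<^sup>2" using CB by (intro mult_right_mono) auto
      finally show ?thesis .
    qed
  qed (use finite_steps finite_level node_child_in_level[OF dim] level_flow[OF dim] stepL(1) B \<Lambda> in auto)
  then have "?\<rho> ^ m * (card (level d m) - 2 * ?B / \<Lambda> * (\<Sum>i<n. ?\<rho> ^ i * (\<Sum>u\<in>level d (m + i). (?w u)\<^sup>2)))
      \<le> ?\<rho> ^ m * (?\<rho> ^ n * ?c)"
    by (intro mult_left_mono) auto
  moreover have "?\<rho> ^ m * (\<Sum>i<n. ?\<rho> ^ i * (\<Sum>u\<in>level d (m + i). (?w u)\<^sup>2)) \<le> C"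
  proof -
    have "?\<rho> ^ m * (\<Sum>i<n. ?\<rho> ^ i * (\<Sum>u\<in>level d (m + i). (?w u)\<^sup>2))
        = (\<Sum>i<n. ?\<rho> ^ (m + i) * (\<Sum>u\<in>level d (m + i). (?w u)\<^sup>2))"
      by (simp add: sum_distrib_left power_add mult.assoc)
    also have "\<dots> = (\<Sum>i\<in>(+) m ` {..<n}. ?\<rho> ^ i * (\<Sum>u\<in>level d i. (?w u)\<^sup>2))"
      by (subst sum.reindex) auto
    also have "\<dots> \<le> (\<Sum>i<m + n. ?\<rho> ^ i * (\<Sum>u\<in>level d i. (?w u)\<^sup>2))"
      by (intro sum_mono2) (auto intro!: mult_nonneg_nonneg sum_nonneg)
    also have "\<dots> \<le> C" by (rule energy)
    finally show ?thesis .
  qed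
  then have "2 * ?B / \<Lambda> * (?\<rho> ^ m * (\<Sum>i<n. ?\<rho> ^ i * (\<Sum>u\<in>level d (m + i). (?w u)\<^sup>2))) \<le> 2 * ?B / \<Lambda> * C"
    using B \<Lambda> by (intro mult_left_mono) auto
  ultimately show ?thesis
    using card_level_ge[OF dim, of m] by (simp add: right_diff_distrib power_add mult_ac)
qed

definition admissible :: "nat \<Rightarrow> real \<Rightarrow> node \<Rightarrow> bool" where
  "admissible m \<Lambda> v \<longleftrightarrow> (\<exists>r\<in>level d m. \<bar>node_scale v - node_scale r\<bar> \<le> 2 * \<Lambda>)"

definition cover :: "nat \<Rightarrow> real \<Rightarrow> nat \<Rightarrow> (nat \<Rightarrow> real) set" where
  "cover m \<Lambda> n = (\<Union>v\<in>{v \<in> level d n. admissible m \<Lambda> v}. fat_cube d p0 s0 v)"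

text \<open>
  The nodes that cover a point at different scales are not required to form a path; only their
  slopes matter for the bi-Lipschitz bound. This makes the set a countable intersection of finite
  unions of boxes.
\<close>

definition good_set :: "nat \<Rightarrow> real \<Rightarrow> (nat \<Rightarrow> real) set" where
  "good_set m \<Lambda> = Q\<^sub>0 \<inter> (\<Inter>n. cover m \<Lambda> (m + n))"

lemma cover_in_sets [measurable]: "cover m \<Lambda> n \<in> sets (Rn_borel d)"
  unfolding cover_def using finite_level by (intro sets.finite_UN) auto

lemma good_set_in_sets [measurable]: "good_set m \<Lambda> \<in> sets (Rn_borel d)"
  unfolding good_set_def by measurable

text \<open>
  The conditions for the first generations hold on the end nodes of tracking paths, which are
  disjoint cubes of equal volume. Continuity from above then treats all generations at once.
\<close>

lemma measure_good_set:
  assumes energy: "\<And>N. (\<Sum>n<N. (1 / 2 ^ d) ^ n * (\<Sum>v\<in>level d n. (omega d f (node_big_cube v))\<^sup>2)) \<le> C"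
    and \<Lambda>: "1 \<le> \<Lambda>"
  shows "(1 - 1 / 2 ^ m - 2 * error_const d \<eta> / \<Lambda> * C) * s0 ^ d \<le> measure (Rn_borel d) (good_set m \<Lambda>)"
proof -
  let ?G = "\<lambda>N. Q\<^sub>0 \<inter> (\<Inter>n\<in>{..N}. cover m \<Lambda> (m + n))"
  have sets: "?G N \<in> sets (Rn_borel d)" for N by measurable
  have fin: "emeasure (Rn_borel d) (?G N) \<noteq> \<infinity>" for N
  proof -
    have "emeasure (Rn_borel d) (?G N) \<le> emeasure (Rn_borel d) Q\<^sub>0"
      by (intro emeasure_mono) auto
    then show ?thesis using s0 by (auto simp: emeasure_cube top_unique)
  qed
  have le: "(1 - 1 / 2 ^ m - 2 * error_const d \<eta> / \<Lambda> * C) * s0 ^ d \<le> measure (Rn_borel d) (?G N)" for N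
  proof -
    let ?W = "{u \<in> level d (m + N). \<exists>r\<in>level d m. tracks (steps d) (node_child d) (\<lambda>v. node_scale v) (2 * \<Lambda>) r u}"
    let ?c = "\<lambda>v. corner_cube d (corner d p0 s0 v) (side s0 v)"
    have finW: "finite ?W" using finite_level by simp
    have sub: "(\<Union>u\<in>?W. ?c u) \<subseteq> ?G N"
    proof (intro UN_least subsetI)
      fix u x assume u: "u \<in> ?W" and x: "x \<in> ?c u"
      then obtain r where r: "r \<in> level d m" "tracks (steps d) (node_child d) (\<lambda>v. node_scale v) (2 * \<Lambda>) r u" by blast
      have "fst u = m + N" using u by (auto simp: level_iff)
      then have anc: "\<exists>v\<in>level d n. \<bar>node_scale v - node_scale r\<bar> \<le> 2 * \<Lambda>
          \<and> fat_cube d p0 s0 u \<subseteq> fat_cube d p0 s0 v" if "n \<in> {m..m + N}" for n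
        using tracks_ancestors[OF dim s0 r(1) _ r(2), of p0] \<Lambda> that by simp
      have xf: "x \<in> fat_cube d p0 s0 u" using x corner_cube_in_fat_cube[OF s0] by blast
      have "x \<in> cover m \<Lambda> (m + n)" if "n \<le> N" for n
        using anc[of "m + n"] that xf r(1) unfolding cover_def admissible_def by auto
      moreover have "x \<in> Q\<^sub>0" using x u corner_cube_in_Q0(1) by blast
      ultimately show "x \<in> ?G N" by blast
    qed
    have disj: "disjoint_family_on ?c ?W"
      unfolding disjoint_family_on_def using corner_cubes_disjoint[OF s0] by blast
    have "measure (Rn_borel d) (\<Union>u\<in>?W. ?c u) = (\<Sum>u\<in>?W. measure (Rn_borel d) (?c u))"
      using finW disj by (intro measure_finite_Union) (auto simp: emeasure_corner_cube less_imp_le)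
    also have "\<dots> = (\<Sum>u\<in>?W. (s0 / 2 ^ (m + N)) ^ d)"
      by (intro sum.cong refl) (auto simp: measure_corner_cube less_imp_le side_level[symmetric])
    also have "\<dots> = (1 / 2 ^ d) ^ (m + N) * card ?W * s0 ^ d"
      by (simp add: power_divide power_mult[symmetric] mult.commute)
    finally have "(1 / 2 ^ d) ^ (m + N) * card ?W * s0 ^ d = measure (Rn_borel d) (\<Union>u\<in>?W. ?c u)" by simp
    also have "\<dots> \<le> measure (Rn_borel d) (?G N)"
      using sub sets finW fin by (intro measure_mono_fmeasurable) (auto simp: fmeasurable_def top.not_eq_extremum)
    finally have "(1 / 2 ^ d) ^ (m + N) * card ?W * s0 ^ d \<le> measure (Rn_borel d) (?G N)" .
    moreover have "(1 - 1 / 2 ^ m - 2 * error_const d \<eta> / \<Lambda> * C) * s0 ^ d \<le> (1 / 2 ^ d) ^ (m + N) * card ?W * s0 ^ d"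
      using s0 by (intro mult_right_mono tracking_nodes_ge energy \<Lambda>) auto
    ultimately show ?thesis by linarith
  qed
  have "(\<lambda>N. measure (Rn_borel d) (?G N)) \<longlonglongrightarrow> measure (Rn_borel d) (\<Inter>N. ?G N)"
  proof (rule Lim_measure_decseq)
    show "range ?G \<subseteq> sets (Rn_borel d)" using sets by blast
    show "decseq ?G" by (auto simp: decseq_def)
  qed (rule fin)
  moreover have "(\<Inter>N. ?G N) = good_set m \<Lambda>" unfolding good_set_def by auto
  ultimately show ?thesis using le by (intro LIMSEQ_le_const) auto
qed

end

text \<open>
  Two points at distance at least \<open>s0 / 2 ^ m\<close> are compared with the whole cube, whose diameter is
  at most \<open>d * s0\<close>.
\<close>

definition global_const :: "nat \<Rightarrow> (real \<Rightarrow> real) \<Rightarrow> nat \<Rightarrow> real" where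
  "global_const d \<eta> m = 2 * max 1 (\<eta> (real d * 2 ^ m))"

definition bilip_const :: "nat \<Rightarrow> (real \<Rightarrow> real) \<Rightarrow> nat \<Rightarrow> real \<Rightarrow> real" where
  "bilip_const d \<eta> m \<Lambda> = 2 * scale_const d \<eta> * global_const d \<eta> m *
     exp (2 * \<Lambda> + ln (scale_const d \<eta>) + ln (8 * (scale_const d \<eta>)\<^sup>2)) * (real d * 2 ^ m)"

lemma bilip_const_pos: "1 \<le> d \<Longrightarrow> 0 < bilip_const d \<eta> m \<Lambda>"
  using scale_const_ge[of d \<eta>] by (simp add: bilip_const_def global_const_def)

context qs_dyadic
begin

abbreviation (input) stretch :: real where
  "stretch \<equiv> diameter (f ` Q\<^sub>0) / Rn_diameter d Q\<^sub>0"

lemma image_dist_le_diameter: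
  assumes "x \<in> Q\<^sub>0" "y \<in> Q\<^sub>0"
  shows "norm (f x - f y) \<le> diameter (f ` Q\<^sub>0)"
proof -
  obtain B where "\<And>x. x \<in> \<Omega> \<Longrightarrow> norm (f x) \<le> B" using bounded_image by blast
  then have "bounded (f ` Q\<^sub>0)"
    using Q0_in_\<Omega> by (intro boundedI[of _ B]) auto
  then show ?thesis using diameter_bounded_bound[of "f ` Q\<^sub>0" "f x" "f y"] assms by (simp add: dist_norm)
qed

text \<open>
  At the scales above generation \<open>m\<close>, quasisymmetry alone gives the lower bound.
\<close>

lemma diameter_le_image_dist:
  assumes xy: "x \<in> Q\<^sub>0" "y \<in> Q\<^sub>0" and far: "s0 / 2 ^ m \<le> Rn_dist d x y"
  shows "diameter (f ` Q\<^sub>0) \<le> global_const d \<eta> m * norm (f x - f y)"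
proof (rule diameter_le)
  have pos: "0 < s0 / 2 ^ m" using s0 by simp
  show "f ` Q\<^sub>0 \<noteq> {} \<or> 0 \<le> global_const d \<eta> m * norm (f x - f y)" using xy by blast
  fix a b assume "a \<in> f ` Q\<^sub>0" "b \<in> f ` Q\<^sub>0"
  then obtain x' y' where x': "x' \<in> Q\<^sub>0" "a = f x'" and y': "y' \<in> Q\<^sub>0" "b = f y'" by blast
  have le: "Rn_dist d x u \<le> real d * 2 ^ m * Rn_dist d x y" if u: "u \<in> Q\<^sub>0" for u
  proof -
    have "Rn_dist d x u \<le> d * s0"
      using Rn_dist_le_diameter_cube[OF dim s0 xy(1) u] Rn_diameter_cube_le[OF dim s0] by (rule order_trans)
    also have "\<dots> = real d * 2 ^ m * (s0 / 2 ^ m)" by simp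
    also have "\<dots> \<le> real d * 2 ^ m * Rn_dist d x y" using far by (intro mult_left_mono) auto
    finally show ?thesis .
  qed
  have "x \<noteq> y" using far pos by auto
  then show "norm (a - b) \<le> global_const d \<eta> m * norm (f x - f y)"
    unfolding x'(2) y'(2) global_const_def
    using xy x'(1) y'(1) Q0_in_\<Omega> le dim by (intro comparable) auto
qed

lemma Q0_diameter: "s0 \<le> Rn_diameter d Q\<^sub>0" "Rn_diameter d Q\<^sub>0 \<le> d * s0"
  using side_le_Rn_diameter_cube[OF dim s0] Rn_diameter_cube_le[OF dim s0] by auto

text \<open>
  The nodes of generation \<open>m\<close> link the slopes in the tree with the normalisation of the theorem.
\<close>

lemma root_slope:
  assumes r: "r \<in> level d m"
  shows "stretch \<le> global_const d \<eta> m * node_slope r" and "node_slope r \<le> real d * 2 ^ m * stretch"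
    and "0 < node_slope r" and "0 < stretch"
proof -
  let ?p = "corner d p0 s0 r" and ?s = "side s0 r" and ?R = "Rn_diameter d Q\<^sub>0"
    and ?D = "diameter (f ` Q\<^sub>0)" and ?G = "global_const d \<eta> m"
  have s: "?s = s0 / 2 ^ m" "0 < ?s" using side_level[OF r, of s0] side_pos[of r] by blast+
  have R: "s0 \<le> ?R" "?R \<le> d * s0" "0 < ?R" using Q0_diameter s0 by auto
  have G: "2 \<le> ?G" by (simp add: global_const_def)
  show sl: "0 < node_slope r"
    using slope_pos[OF node_big_cube_in_\<Omega>[OF r]] by simp
  note q = corner_cube_in_Q0(2,3)[OF r]
  have eq: "norm (f (shift d 0 ?s ?p) - f ?p) = ?s * node_slope r"
    using less_imp_neq[OF s(2), symmetric] by (simp add: slope_def)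
  have far: "s0 / 2 ^ m \<le> Rn_dist d (shift d 0 ?s ?p) ?p"
    unfolding s(1)[symmetric] using dim by (simp add: Rn_dist_commute[of d _ ?p] Rn_dist_shift)
  have "?D \<le> ?G * (?s * node_slope r)"
    using diameter_le_image_dist[OF q(2,1) far] unfolding eq .
  also have "\<dots> \<le> ?G * (?R * node_slope r)"
  proof -
    have "?s \<le> s0" unfolding s(1) using s0 by (simp add: divide_le_eq)
    then show ?thesis using R G sl by (intro mult_left_mono mult_right_mono) auto
  qed
  finally show "stretch \<le> ?G * node_slope r" using R by (simp add: divide_le_eq mult_ac)
  have D: "?s * node_slope r \<le> ?D"
    using image_dist_le_diameter[OF q(2,1)] unfolding eq .
  then have "0 < ?D" using s sl by (smt (verit) mult_pos_pos)
  then show st: "0 < stretch" using R by simp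
  have "?s * node_slope r \<le> stretch * ?R" using D R by simp
  also have "\<dots> \<le> stretch * (d * s0)" using R st by (intro mult_left_mono) auto
  also have "\<dots> = ?s * (real d * 2 ^ m * stretch)" unfolding s(1) by simp
  finally show "node_slope r \<le> real d * 2 ^ m * stretch"
    using s(2) by (simp only: mult_le_cancel_left_pos)
qed

lemma admissible_slope:
  assumes v: "v \<in> level d n" and r: "r \<in> level d m" and close: "\<bar>node_scale v - node_scale r\<bar> \<le> 2 * \<Lambda>"
  defines "\<Gamma> \<equiv> exp (2 * \<Lambda> + ln K + ln (8 * K\<^sup>2))"
  shows "node_slope v \<le> \<Gamma> * node_slope r" and "node_slope r \<le> \<Gamma> * node_slope v"
proof -
  note V = node_big_cube_in_\<Omega>[OF v] and R = node_big_cube_in_\<Omega>[OF r]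
  have pos: "0 < node_slope v" "0 < node_slope r"
    using slope_pos[OF V] slope_pos[OF R] by auto
  note bv = log_scale_bounds[OF V side_pos corner_in_Rn] and br = log_scale_bounds[OF R side_pos corner_in_Rn]
  have "ln (node_slope v) \<le> (2 * \<Lambda> + ln K + ln (8 * K\<^sup>2)) + ln (node_slope r)"
    "ln (node_slope r) \<le> (2 * \<Lambda> + ln K + ln (8 * K\<^sup>2)) + ln (node_slope v)"
    using bv br close by linarith+
  then have "exp (ln (node_slope v)) \<le> exp ((2 * \<Lambda> + ln K + ln (8 * K\<^sup>2)) + ln (node_slope r))"
    "exp (ln (node_slope r)) \<le> exp ((2 * \<Lambda> + ln K + ln (8 * K\<^sup>2)) + ln (node_slope v))"
    by (simp_all only: exp_le_cancel_iff)
  then show "node_slope v \<le> \<Gamma> * node_slope r" and "node_slope r \<le> \<Gamma> * node_slope v"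
    unfolding \<Gamma>_def using pos by (simp_all only: exp_add[of _ "ln (slope _ _)"] exp_ln)
qed

lemma exists_scale:
  assumes "0 < \<delta>" "\<delta> < s0 / 2 ^ m"
  obtains n where "m \<le> n" "s0 / 2 ^ n \<le> \<delta>" "\<delta> < 2 * (s0 / 2 ^ n)"
proof -
  obtain N where "(1 / 2 :: real) ^ N < \<delta> / s0"
    using real_arch_pow_inv[of "\<delta> / s0" "1 / 2"] assms s0 by auto
  then have ex: "\<exists>n. s0 / 2 ^ n \<le> \<delta>" using s0 by (intro exI[of _ N]) (simp add: field_simps)
  define n where "n = (LEAST n. s0 / 2 ^ n \<le> \<delta>)"
  have n: "s0 / 2 ^ n \<le> \<delta>" unfolding n_def using ex by (rule LeastI_ex)
  have mn: "m < n"
  proof (rule ccontr)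
    assume "\<not> m < n"
    then have "s0 / 2 ^ m \<le> s0 / 2 ^ n" using s0 by (intro divide_left_mono power_increasing) auto
    then show False using n assms by linarith
  qed
  then obtain n' where n': "n = Suc n'" by (cases n) auto
  have "\<not> s0 / 2 ^ n' \<le> \<delta>" using not_less_Least[of n' "\<lambda>n. s0 / 2 ^ n \<le> \<delta>"] n' unfolding n_def by simp
  then have "\<delta> < 2 * (s0 / 2 ^ n)" by (simp add: n')
  with n show ?thesis using mn by (intro that[of n]) auto
qed

text \<open>
  Two points of the good set at distance \<open>\<delta>\<close> are compared with the step of a node of side about
  \<open>\<delta>\<close>; the slope of this node is comparable with that of a node of level \<open>m\<close>, hence with the
  stretch of the whole cube.
\<close>

lemma good_set_bi_lipschitz:
  assumes \<Lambda>: "0 \<le> \<Lambda>"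
  shows "bi_lipschitz_on d (bilip_const d \<eta> m \<Lambda>) (good_set m \<Lambda>) (\<lambda>x. inverse stretch *\<^sub>R f x)"
proof -
  define \<Gamma> where "\<Gamma> = exp (2 * \<Lambda> + ln K + ln (8 * K\<^sup>2))"
  let ?G = "global_const d \<eta> m" and ?L = "bilip_const d \<eta> m \<Lambda>" and ?D = "real d * 2 ^ m"
  have K: "2 \<le> K" by (rule scale_const_ge)
  have G: "2 \<le> ?G" by (simp add: global_const_def)
  have D: "1 \<le> ?D" using mult_mono[of 1 "real d" 1 "2 ^ m"] dim by simp
  have "1 \<le> 8 * K\<^sup>2" using power_mono[of 2 K 2] K by simp
  then have \<Gamma>: "1 \<le> \<Gamma>" unfolding \<Gamma>_def using \<Lambda> K by simp
  have L_eq: "?L = 2 * K * ?G * \<Gamma> * ?D" by (simp add: bilip_const_def \<Gamma>_def)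
  have L1: "K * \<Gamma> * ?D \<le> ?L" "2 * K * \<Gamma> * ?G \<le> ?L" "?D \<le> ?L" "?G \<le> ?L"
  proof -
    have "1 * (K * \<Gamma> * ?D) \<le> 2 * ?G * (K * \<Gamma> * ?D)" using G K \<Gamma> D by (intro mult_right_mono) auto
    then show a: "K * \<Gamma> * ?D \<le> ?L" unfolding L_eq by (simp add: mult_ac)
    have "1 * (2 * K * \<Gamma> * ?G) \<le> ?D * (2 * K * \<Gamma> * ?G)" using G K \<Gamma> D by (intro mult_right_mono) auto
    then show b: "2 * K * \<Gamma> * ?G \<le> ?L" unfolding L_eq by (simp add: mult_ac)
    have "1 * 1 \<le> K * \<Gamma>" using K \<Gamma> by (intro mult_mono) auto
    then have "1 * ?D \<le> K * \<Gamma> * ?D" "1 * ?G \<le> K * \<Gamma> * ?G" using D G by (intro mult_right_mono; simp)+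
    moreover have "K * \<Gamma> * ?G \<le> 2 * K * \<Gamma> * ?G" using K \<Gamma> G by simp
    ultimately show "?D \<le> ?L" "?G \<le> ?L" using a b by linarith+
  qed
  have L0: "0 < ?L" using L1 G by linarith
  have main: "norm (f x - f y) \<le> ?L * (stretch * Rn_dist d x y) \<and>
      stretch * Rn_dist d x y \<le> ?L * norm (f x - f y) \<and> 0 < stretch"
    if x: "x \<in> good_set m \<Lambda>" and y: "y \<in> good_set m \<Lambda>" and ne: "x \<noteq> y" for x y
  proof -
    let ?\<delta> = "Rn_dist d x y"
    have Q: "x \<in> Q\<^sub>0" "y \<in> Q\<^sub>0" using x y by (auto simp: good_set_def)
    have xR: "x \<in> Rn d" "y \<in> Rn d" using Q by (auto simp: in_Q0_iff)
    have \<delta>: "0 < ?\<delta>" using Rn_dist_pos[OF xR ne] .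
    have R: "0 < Rn_diameter d Q\<^sub>0" using Q0_diameter s0 by linarith
    have ex: "\<exists>v r. v \<in> level d n \<and> r \<in> level d m \<and> \<bar>node_scale v - node_scale r\<bar> \<le> 2 * \<Lambda> \<and> x \<in> fat_cube d p0 s0 v"
      if "m \<le> n" for n
    proof -
      have "x \<in> cover m \<Lambda> (m + (n - m))" using x unfolding good_set_def by blast
      then show ?thesis using that by (auto simp: cover_def admissible_def)
    qed
    obtain v0 r0 where "r0 \<in> level d m" using ex[of m] by blast
    then have st: "0 < stretch" by (rule root_slope(4))
    then have sd: "0 \<le> stretch * ?\<delta>" using \<delta> by (intro mult_nonneg_nonneg less_imp_le)
    have goal: "norm (f x - f y) \<le> ?L * (stretch * ?\<delta>) \<and> stretch * ?\<delta> \<le> ?L * norm (f x - f y)"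
    proof (cases "s0 / 2 ^ m \<le> ?\<delta>")
      case True
      have "norm (f x - f y) \<le> stretch * Rn_diameter d Q\<^sub>0"
        using image_dist_le_diameter[OF Q] R by simp
      also have "\<dots> \<le> stretch * (?D * ?\<delta>)"
      proof (intro mult_left_mono)
        have "Rn_diameter d Q\<^sub>0 \<le> ?D * (s0 / 2 ^ m)" using Q0_diameter(2) by simp
        also have "\<dots> \<le> ?D * ?\<delta>" using True D by (intro mult_left_mono) auto
        finally show "Rn_diameter d Q\<^sub>0 \<le> ?D * ?\<delta>" .
      qed (use st in simp)
      also have "\<dots> = ?D * (stretch * ?\<delta>)" by simp
      also have "\<dots> \<le> ?L * (stretch * ?\<delta>)" by (intro mult_right_mono L1 sd)
      finally have 1: "norm (f x - f y) \<le> ?L * (stretch * ?\<delta>)" .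
      have "stretch * ?\<delta> \<le> stretch * Rn_diameter d Q\<^sub>0"
        using Rn_dist_le_diameter_cube[OF dim s0 Q] st by (intro mult_left_mono) auto
      also have "\<dots> = diameter (f ` Q\<^sub>0)" using R by simp
      also have "\<dots> \<le> ?G * norm (f x - f y)" by (rule diameter_le_image_dist[OF Q True])
      also have "\<dots> \<le> ?L * norm (f x - f y)" using L1 by (intro mult_right_mono) auto
      finally show ?thesis using 1 by blast
    next
      case False
      then obtain n where n: "m \<le> n" "s0 / 2 ^ n \<le> ?\<delta>" "?\<delta> < 2 * (s0 / 2 ^ n)"
        using exists_scale[OF \<delta>, of m] by auto
      obtain v r where v: "v \<in> level d n" and r: "r \<in> level d m"
        and close: "\<bar>node_scale v - node_scale r\<bar> \<le> 2 * \<Lambda>" and xv: "x \<in> fat_cube d p0 s0 v"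
        using ex[OF n(1)] by blast
      let ?p = "corner d p0 s0 v" and ?s = "side s0 v" and ?a = "node_slope v"
      have s: "?s = s0 / 2 ^ n" "0 < ?s" using side_level[OF v, of s0] side_pos[of v] by blast+
      have xp: "0 \<le> x i - ?p i \<and> x i - ?p i \<le> 2 * ?s" if "i < d" for i
      proof -
        have "x i \<in> {?p i..?p i + 2 * ?s}"
          using xv that unfolding fat_cube_def PiE_iff by blast
        then show ?thesis by auto
      qed
      have nx: "x \<in> near ?p ?s" unfolding near_def using xR xp s(2) by fastforce
      have ny: "y \<in> near ?p ?s"
        unfolding near_def
      proof (intro CollectI conjI allI impI)
        fix i assume i: "i < d"
        have "\<bar>x i - y i\<bar> \<le> 2 * ?s" using coordinate_le_Rn_dist[OF i, of x y] n(3) s(1) by linarith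
        then show "\<bar>y i - ?p i\<bar> \<le> 4 * ?s" using xp[OF i] by linarith
      qed (rule xR)
      have W: "node_big_cube v \<subseteq> \<Omega>" by (rule node_big_cube_in_\<Omega>[OF v])
      have np: "?p \<in> near ?p ?s" "shift d 0 ?s ?p \<in> near ?p ?s"
        using corner_near shift_corner_near s by auto
      have eq: "norm (f (shift d 0 ?s ?p) - f ?p) = ?s * ?a" using less_imp_neq[OF s(2), symmetric] by (simp add: slope_def)
      have "?s / 2 \<le> Rn_dist d (shift d 0 ?s ?p) ?p"
        unfolding s(1)[symmetric] using dim by (simp add: Rn_dist_commute[of d _ ?p] Rn_dist_shift)
      then have up: "norm (f x - f y) \<le> K * (?s * ?a)"
        using near_comparable[OF W s(2) np(2,1) nx ny] unfolding eq by blast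
      have "?s / 2 \<le> ?\<delta>" using n(2) s by linarith
      then have lo: "?s * ?a \<le> K * norm (f x - f y)"
        using near_comparable[OF W s(2) nx ny np(2,1)] unfolding eq by blast
      note sl = admissible_slope[OF v r close, folded \<Gamma>_def] and rt = root_slope[OF r]
      have "?a \<le> \<Gamma> * (?D * stretch)"
        using sl(1) rt(2) \<Gamma> by (meson mult_left_mono order_trans zero_le_one)
      then have "K * (?s * ?a) \<le> K * (?\<delta> * (\<Gamma> * (?D * stretch)))"
        using n(2) s K st \<Gamma> D slope_pos[OF W s(2)] by (intro mult_left_mono mult_mono) auto
      also have "\<dots> = (K * \<Gamma> * ?D) * (stretch * ?\<delta>)" by simp
      also have "\<dots> \<le> ?L * (stretch * ?\<delta>)" by (intro mult_right_mono L1 sd)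
      finally have 1: "norm (f x - f y) \<le> ?L * (stretch * ?\<delta>)" using up by linarith
      have "stretch \<le> ?G * (\<Gamma> * ?a)"
        using rt(1) sl(2) G by (meson mult_left_mono order_trans zero_le_numeral)
      then have "stretch * ?\<delta> \<le> (?G * (\<Gamma> * ?a)) * (2 * ?s)"
        using n(3) s \<delta> st by (intro mult_mono) auto
      also have "\<dots> = 2 * \<Gamma> * ?G * (?s * ?a)" by simp
      also have "\<dots> \<le> 2 * \<Gamma> * ?G * (K * norm (f x - f y))"
        using lo \<Gamma> G by (intro mult_left_mono) auto
      also have "\<dots> = (2 * K * \<Gamma> * ?G) * norm (f x - f y)" by simp
      also have "\<dots> \<le> ?L * norm (f x - f y)" using L1 by (intro mult_right_mono) auto
      finally show ?thesis using 1 by blast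
    qed
    with st show ?thesis by blast
  qed
  show ?thesis
    unfolding bi_lipschitz_on_def
  proof (intro ballI)
    fix x y assume x: "x \<in> good_set m \<Lambda>" and y: "y \<in> good_set m \<Lambda>"
    show "inverse ?L * Rn_dist d x y \<le> norm (inverse stretch *\<^sub>R f x - inverse stretch *\<^sub>R f y) \<and>
        norm (inverse stretch *\<^sub>R f x - inverse stretch *\<^sub>R f y) \<le> ?L * Rn_dist d x y"
    proof (cases "x = y")
      case False
      note m = main[OF x y False]
      have "norm (inverse stretch *\<^sub>R f x - inverse stretch *\<^sub>R f y) = norm (inverse stretch *\<^sub>R (f x - f y))"
        by (simp only: scaleR_diff_right)
      also have "\<dots> = inverse stretch * norm (f x - f y)"
        using m by (simp only: norm_scaleR abs_inverse abs_of_pos)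
      finally have eq: "norm (inverse stretch *\<^sub>R f x - inverse stretch *\<^sub>R f y) = inverse stretch * norm (f x - f y)" .
      define \<sigma> where "\<sigma> = stretch"
      have "inverse ?L * Rn_dist d x y \<le> inverse \<sigma> * norm (f x - f y) \<and> inverse \<sigma> * norm (f x - f y) \<le> ?L * Rn_dist d x y"
        using m L0 unfolding \<sigma>_def[symmetric] by (simp add: field_simps)
      then show ?thesis unfolding eq \<sigma>_def .
    qed simp
  qed
qed

end

section \<open>Uniformity of the constant\<close>

lemma bi_lipschitz_on_mono:
  assumes "bi_lipschitz_on d L E g" "0 < L" "L \<le> L'"
  shows "bi_lipschitz_on d L' E g"
  unfolding bi_lipschitz_on_def
proof (intro ballI conjI)
  fix x y assume "x \<in> E" "y \<in> E"
  then have *: "inverse L * Rn_dist d x y \<le> norm (g x - g y)" "norm (g x - g y) \<le> L * Rn_dist d x y"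
    using assms(1) by (auto simp: bi_lipschitz_on_def)
  have "inverse L' * Rn_dist d x y \<le> inverse L * Rn_dist d x y"
    using assms by (intro mult_right_mono le_imp_inverse_le) auto
  then show "inverse L' * Rn_dist d x y \<le> norm (g x - g y)" using * by linarith
  have "L * Rn_dist d x y \<le> L' * Rn_dist d x y" using assms by (intro mult_right_mono) auto
  then show "norm (g x - g y) \<le> L' * Rn_dist d x y" using * by linarith
qed

definition node_cube :: "nat \<Rightarrow> (nat \<Rightarrow> real) \<Rightarrow> real \<Rightarrow> node \<Rightarrow> (nat \<Rightarrow> real) set" where
  "node_cube d p0 s0 v = cube d (\<lambda>i. corner d p0 s0 v i + side s0 v / 2) (side s0 v)"

lemma dilate_node_cube:
  "0 < s0 \<Longrightarrow> 1 \<le> d \<Longrightarrow> dilate d (30000 * real d) (node_cube d p0 s0 v) = big_cube d (corner d p0 s0 v) (side s0 v)"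
  unfolding node_cube_def big_cube_def by (rule dilate_cube) (auto simp: side_def)

text \<open>
  Distinct nodes are distinct dyadic cubes, so a sum over nodes is a partial sum of the sum over
  all dyadic subcubes.
\<close>

lemma node_cube_inj:
  assumes "0 < s0" "1 \<le> d"
  shows "inj_on (node_cube d p0 s0) (\<Union>n. level d n)"
proof (rule inj_onI)
  fix u v assume uv: "u \<in> (\<Union>n. level d n)" "v \<in> (\<Union>n. level d n)"
    and eq: "node_cube d p0 s0 u = node_cube d p0 s0 v"
  have pos: "0 < side s0 u" "0 < side s0 v" using assms by (auto simp: side_def)
  have eq': "side s0 u = side s0 v \<and> (\<forall>i<d. corner d p0 s0 u i + side s0 u / 2 = corner d p0 s0 v i + side s0 v / 2)"
    using eq unfolding node_cube_def by (subst (asm) cube_eq_iff[OF pos assms(2)])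
  then have "fst u = fst v" using assms by (simp add: side_def)
  moreover have "snd u i = snd v i" if "i < d" for i
  proof -
    have "corner d p0 s0 u i = corner d p0 s0 v i" using eq' that by auto
    then have "side s0 u * real (snd u i) = side s0 u * real (snd v i)"
      using eq' that by (simp add: corner_def)
    then show ?thesis using pos by simp
  qed
  moreover have "snd u \<in> extensional {..<d}" "snd v \<in> extensional {..<d}"
    using uv by (auto simp: level_iff)
  ultimately show "u = v" by (intro prod_eqI extensionalityI[of _ "{..<d}"]) auto
qed

lemma fixed_dimension:
  assumes \<eta>: "increasing_homeo \<eta>" and C: "0 < C" and \<theta>: "0 < \<theta>" and d: "1 \<le> d"
  shows "\<exists>L\<ge>1. \<forall>Q\<^sub>0 \<in> dyadic_cubes d. \<forall>f :: (nat \<Rightarrow> real) \<Rightarrow> 'b::euclidean_space.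
      quasisymmetric_on d (dilate d (30000 * real d) Q\<^sub>0) \<eta> f \<and>
      (\<lambda>Q. (omega d f (dilate d (30000 * real d) Q))\<^sup>2 * measure (Rn_lebesgue d) Q)
        summable_on dyadic_subcubes d Q\<^sub>0 \<and>
      (\<Sum>\<^sub>\<infinity>Q\<in>dyadic_subcubes d Q\<^sub>0.
          (omega d f (dilate d (30000 * real d) Q))\<^sup>2 * measure (Rn_lebesgue d) Q)
        \<le> C * measure (Rn_lebesgue d) Q\<^sub>0
      \<longrightarrow> (\<exists>E \<in> sets (Rn_lebesgue d). E \<subseteq> Q\<^sub>0 \<and>
            measure (Rn_lebesgue d) E \<ge> (1 - \<theta>) * measure (Rn_lebesgue d) Q\<^sub>0 \<and>
            bi_lipschitz_on d L E
              (\<lambda>x. inverse (diameter (f ` Q\<^sub>0) / Rn_diameter d Q\<^sub>0) *\<^sub>R f x))"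
proof -
  \<comment> \<open>One half of \<open>\<theta>\<close> pays for the missing layer, the other half for the paths that do not track.\<close>
  obtain m where m: "(1 / 2 :: real) ^ m < \<theta> / 2"
    using real_arch_pow_inv[of "\<theta> / 2" "1 / 2"] \<theta> by auto
  define B where "B = error_const d \<eta>"
  have B: "0 \<le> B" using scale_const_ge[of d \<eta>] by (simp add: B_def error_const_def)
  define \<Lambda> where "\<Lambda> = max 1 (4 * B * C / \<theta>)"
  have \<Lambda>: "1 \<le> \<Lambda>" "4 * B * C / \<theta> \<le> \<Lambda>" by (auto simp: \<Lambda>_def)
  have "4 * B * C \<le> \<Lambda> * \<theta>" using \<Lambda>(2) \<theta> by (simp add: divide_le_eq)
  then have "2 * B / \<Lambda> * C \<le> \<theta> / 2" using \<Lambda>(1) by (simp add: divide_le_eq mult_ac)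
  then have small: "1 - \<theta> \<le> 1 - 1 / 2 ^ m - 2 * B / \<Lambda> * C"
    using m unfolding power_one_over by linarith
  let ?L = "max 1 (bilip_const d \<eta> m \<Lambda>)"
  show ?thesis
  proof (intro exI[of _ ?L] conjI ballI allI impI)
    show "1 \<le> ?L" by simp
    fix Q and f :: "(nat \<Rightarrow> real) \<Rightarrow> 'b"
    let ?w = "\<lambda>Q. (omega d f (dilate d (30000 * real d) Q))\<^sup>2 * measure (Rn_lebesgue d) Q"
    assume Q: "Q \<in> dyadic_cubes d"
      and "quasisymmetric_on d (dilate d (30000 * real d) Q) \<eta> f \<and> ?w summable_on dyadic_subcubes d Q \<and>
        infsum ?w (dyadic_subcubes d Q) \<le> C * measure (Rn_lebesgue d) Q"
    then have qs: "quasisymmetric_on d (dilate d (30000 * real d) Q) \<eta> f"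
      and summable: "?w summable_on dyadic_subcubes d Q"
      and sum_le: "infsum ?w (dyadic_subcubes d Q) \<le> C * measure (Rn_lebesgue d) Q" by blast+
    obtain n0 :: int and J :: "nat \<Rightarrow> int" where
      QJ: "Q = (\<Pi>\<^sub>E i\<in>{..<d}. {2 powi n0 * real_of_int (J i) .. 2 powi n0 * (real_of_int (J i) + 1)})"
      using Q unfolding dyadic_cubes_def by blast
    define s0 :: real where "s0 = 2 powi n0"
    define p0 :: "nat \<Rightarrow> real" where "p0 i = s0 * real_of_int (J i)" for i
    have s0: "0 < s0" by (simp add: s0_def)
    have Q_eq: "Q = cube d (\<lambda>i. p0 i + s0 / 2) s0"
      unfolding QJ cube_def s0_def[symmetric] by (intro PiE_cong) (auto simp: p0_def algebra_simps)
    have big: "dilate d (30000 * real d) Q = big_cube d p0 s0"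
      unfolding Q_eq big_cube_def using s0 d by (intro dilate_cube)
    interpret qs_dyadic d \<eta> p0 s0 f
      using d s0 \<eta> qs unfolding big by unfold_locales
    have mQ: "measure (Rn_lebesgue d) Q = s0 ^ d"
      unfolding Q_eq using s0 by (simp add: measure_Rn_lebesgue_cube)
    have sub: "node_cube d p0 s0 v \<in> dyadic_subcubes d Q" if v: "v \<in> level d n" for v n
    proof -
      have side: "side s0 v = 2 powi (n0 - int n)"
        unfolding side_level[OF v] s0_def by (simp add: power_int_diff)
      have c: "corner d p0 s0 v i = 2 powi (n0 - int n) * real_of_int (2 ^ n * J i + int (snd v i))" if "i < d" for i
      proof -
        have "p0 i = side s0 v * 2 ^ n * real_of_int (J i)"
          unfolding p0_def side_level[OF v] by simp
        then show ?thesis using that by (simp add: corner_def side algebra_simps)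
      qed
      have "node_cube d p0 s0 v = (\<Pi>\<^sub>E i\<in>{..<d}. {2 powi (n0 - int n) * real_of_int (2 ^ n * J i + int (snd v i)) ..
          2 powi (n0 - int n) * (real_of_int (2 ^ n * J i + int (snd v i)) + 1)})"
        unfolding node_cube_def cube_def using c side by (intro PiE_cong) (simp add: distrib_left)
      then have "node_cube d p0 s0 v \<in> dyadic_cubes d"
        unfolding dyadic_cubes_def mem_Collect_eq
        by (intro exI[of _ "n0 - int n"] exI[of _ "\<lambda>i. 2 ^ n * J i + int (snd v i)"])
      moreover have "node_cube d p0 s0 v \<subseteq> Q"
      proof
        fix x assume x: "x \<in> node_cube d p0 s0 v"
        then have "x i \<in> {corner d p0 s0 v i + side s0 v / 2 - side s0 v / 2 ..
            corner d p0 s0 v i + side s0 v / 2 + side s0 v / 2}" if "i < d" for i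
          using that unfolding node_cube_def cube_def PiE_iff by blast
        then have xi: "corner d p0 s0 v i \<le> x i \<and> x i \<le> corner d p0 s0 v i + side s0 v" if "i < d" for i
          using that by fastforce
        have p: "p0 i \<le> x i \<and> x i \<le> p0 i + s0" if i: "i < d" for i
        proof -
          have "side s0 v * (real (snd v i) + 1) \<le> side s0 v * 2 ^ n"
            using index_bounds[OF v i] by (intro mult_left_mono) auto
          also have "\<dots> = s0" using side_level[OF v] by simp
          finally have "side s0 v * real (snd v i) + side s0 v \<le> s0" by (simp add: distrib_left)
          moreover have "0 \<le> side s0 v * real (snd v i)" by simp
          moreover have "corner d p0 s0 v i = p0 i + side s0 v * real (snd v i)" using i by (simp add: corner_def)
          ultimately show ?thesis using xi[OF i] by linarith
        qed
        have "x \<in> Rn d" using x by (auto simp: node_cube_def cube_def Rn_def PiE_iff)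
        then show "x \<in> Q" unfolding Q_eq in_Q0_iff using p by blast
      qed
      ultimately show ?thesis by (simp add: dyadic_subcubes_def)
    qed
    have energy: "(\<Sum>n<N. (1 / 2 ^ d) ^ n *
        (\<Sum>v\<in>level d n. (omega d f (big_cube d (corner d p0 s0 v) (side s0 v)))\<^sup>2)) \<le> C" for N
    proof -
      let ?F = "node_cube d p0 s0 ` (\<Union>n<N. level d n)"
      have fin: "finite (\<Union>n<N. level d n)" using finite_level by blast
      have w: "?w (node_cube d p0 s0 v)
          = (omega d f (big_cube d (corner d p0 s0 v) (side s0 v)))\<^sup>2 * ((1 / 2 ^ d) ^ n * s0 ^ d)"
        if v: "v \<in> level d n" for v n
      proof -
        have "measure (Rn_lebesgue d) (node_cube d p0 s0 v) = side s0 v ^ d"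
          unfolding node_cube_def by (simp add: measure_Rn_lebesgue_cube)
        also have "\<dots> = (1 / 2 ^ d) ^ n * s0 ^ d"
          unfolding side_level[OF v] by (simp add: power_divide power_mult[symmetric] mult.commute)
        finally show ?thesis using dilate_node_cube[OF s0 d] by simp
      qed
      have "(\<Sum>n<N. (1 / 2 ^ d) ^ n *
          (\<Sum>v\<in>level d n. (omega d f (big_cube d (corner d p0 s0 v) (side s0 v)))\<^sup>2)) * s0 ^ d
          = (\<Sum>n<N. \<Sum>v\<in>level d n. ?w (node_cube d p0 s0 v))"
        unfolding sum_distrib_left sum_distrib_right
      proof (intro sum.cong refl)
        fix n v assume v: "v \<in> level d n"
        show "(1 / 2 ^ d) ^ n * (omega d f (big_cube d (corner d p0 s0 v) (side s0 v)))\<^sup>2 * s0 ^ d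
            = ?w (node_cube d p0 s0 v)"
          unfolding w[OF v] by (simp only: mult_ac)
      qed
      also have "\<dots> = (\<Sum>v\<in>(\<Union>n<N. level d n). ?w (node_cube d p0 s0 v))"
        by (rule sum.UNION_disjoint[symmetric]) (auto simp: finite_level level_iff)
      also have "\<dots> = (\<Sum>Q\<in>?F. ?w Q)"
        using inj_on_subset[OF node_cube_inj[OF s0 d, of p0], of "\<Union>n<N. level d n"]
        by (subst sum.reindex) auto
      also have "\<dots> \<le> infsum ?w (dyadic_subcubes d Q)"
        using fin sub by (intro finite_sum_le_infsum[OF summable]) auto
      also have "\<dots> \<le> C * s0 ^ d" using sum_le unfolding mQ .
      finally show ?thesis using s0 by (simp only: mult_le_cancel_right_pos zero_less_power)
    qed
    show "\<exists>E \<in> sets (Rn_lebesgue d). E \<subseteq> Q \<and>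
        measure (Rn_lebesgue d) E \<ge> (1 - \<theta>) * measure (Rn_lebesgue d) Q \<and>
        bi_lipschitz_on d ?L E (\<lambda>x. inverse (diameter (f ` Q) / Rn_diameter d Q) *\<^sub>R f x)"
    proof (intro bexI[of _ "good_set m \<Lambda>"] conjI)
      show "good_set m \<Lambda> \<subseteq> Q" unfolding good_set_def Q_eq by blast
      have "(1 - \<theta>) * s0 ^ d \<le> (1 - 1 / 2 ^ m - 2 * B / \<Lambda> * C) * s0 ^ d"
        using small s0 by (intro mult_right_mono) auto
      also have "\<dots> \<le> measure (Rn_borel d) (good_set m \<Lambda>)"
        unfolding B_def by (rule measure_good_set[OF energy \<Lambda>(1)])
      finally show "(1 - \<theta>) * measure (Rn_lebesgue d) Q \<le> measure (Rn_lebesgue d) (good_set m \<Lambda>)"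
        by (simp add: mQ measure_Rn_lebesgue[OF good_set_in_sets])
      show "good_set m \<Lambda> \<in> sets (Rn_lebesgue d)"
        unfolding Rn_lebesgue_def using good_set_in_sets by (rule sets_completionI_sets)
      show "bi_lipschitz_on d ?L (good_set m \<Lambda>) (\<lambda>x. inverse (diameter (f ` Q) / Rn_diameter d Q) *\<^sub>R f x)"
        unfolding Q_eq using \<Lambda>(1) d
        by (intro bi_lipschitz_on_mono[OF good_set_bi_lipschitz bilip_const_pos]) auto
    qed
  qed
qed

theorem theorem3p21:
  fixes \<eta> :: "real \<Rightarrow> real" and \<theta> C\<^sub>M :: real
  assumes "increasing_homeo \<eta>" and "C\<^sub>M > 0" and "\<theta> > 0"
  shows "\<exists>L\<ge>1. \<forall>(d::nat)\<ge>1. \<forall>Q\<^sub>0 \<in> dyadic_cubes d.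
    \<forall>f :: (nat \<Rightarrow> real) \<Rightarrow> real ^ 'D.
      let M = 30000 * real d in
      quasisymmetric_on d (dilate d M Q\<^sub>0) \<eta> f \<and>
      (\<lambda>Q. (omega d f (dilate d M Q))\<^sup>2 * measure (Rn_lebesgue d) Q)
        summable_on dyadic_subcubes d Q\<^sub>0 \<and>
      (\<Sum>\<^sub>\<infinity>Q\<in>dyadic_subcubes d Q\<^sub>0.
          (omega d f (dilate d M Q))\<^sup>2 * measure (Rn_lebesgue d) Q)
        \<le> C\<^sub>M * measure (Rn_lebesgue d) Q\<^sub>0
      \<longrightarrow> (\<exists>E \<in> sets (Rn_lebesgue d). E \<subseteq> Q\<^sub>0 \<and>
            measure (Rn_lebesgue d) E \<ge> (1 - \<theta>) * measure (Rn_lebesgue d) Q\<^sub>0 \<and>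
            bi_lipschitz_on d L E
              (\<lambda>x. inverse (diameter (f ` Q\<^sub>0) / Rn_diameter d Q\<^sub>0) *\<^sub>R f x))"
proof -
  obtain N where N: "\<And>d c S (f :: (nat \<Rightarrow> real) \<Rightarrow> real ^ 'D).
      1 \<le> d \<Longrightarrow> 0 < S \<Longrightarrow> quasisymmetric_on d (cube d c S) \<eta> f \<Longrightarrow> d \<le> N"
    using quasisymmetric_dimension_bound[OF assms(1), where 'b = "real ^ 'D"] by blast
  define good where "good d L \<longleftrightarrow> (\<forall>Q\<^sub>0 \<in> dyadic_cubes d. \<forall>f :: (nat \<Rightarrow> real) \<Rightarrow> real ^ 'D.
      quasisymmetric_on d (dilate d (30000 * real d) Q\<^sub>0) \<eta> f \<and>
      (\<lambda>Q. (omega d f (dilate d (30000 * real d) Q))\<^sup>2 * measure (Rn_lebesgue d) Q)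
        summable_on dyadic_subcubes d Q\<^sub>0 \<and>
      (\<Sum>\<^sub>\<infinity>Q\<in>dyadic_subcubes d Q\<^sub>0.
          (omega d f (dilate d (30000 * real d) Q))\<^sup>2 * measure (Rn_lebesgue d) Q)
        \<le> C\<^sub>M * measure (Rn_lebesgue d) Q\<^sub>0 \<longrightarrow>
      (\<exists>E \<in> sets (Rn_lebesgue d). E \<subseteq> Q\<^sub>0 \<and>
            measure (Rn_lebesgue d) E \<ge> (1 - \<theta>) * measure (Rn_lebesgue d) Q\<^sub>0 \<and>
            bi_lipschitz_on d L E
              (\<lambda>x. inverse (diameter (f ` Q\<^sub>0) / Rn_diameter d Q\<^sub>0) *\<^sub>R f x)))" for d L
  have "\<exists>L\<ge>1. good d L" if "1 \<le> d" for d
    unfolding good_def by (rule fixed_dimension[OF assms that])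
  then obtain L where L: "\<And>d. 1 \<le> d \<Longrightarrow> 1 \<le> L d" and good: "\<And>d. 1 \<le> d \<Longrightarrow> good d (L d)"
    by metis
  \<comment> \<open>In dimensions above \<open>N\<close> there are no quasisymmetric maps, so finitely many constants remain.\<close>
  let ?L = "Max (insert 1 (L ` {1..N}))"
  show ?thesis
    unfolding Let_def
  proof (intro exI[of _ ?L] conjI allI ballI impI)
    show "1 \<le> ?L" by simp
    fix d :: nat and Q\<^sub>0 and f :: "(nat \<Rightarrow> real) \<Rightarrow> real ^ 'D"
    assume d: "1 \<le> d" and Q: "Q\<^sub>0 \<in> dyadic_cubes d"
      and hyp: "quasisymmetric_on d (dilate d (30000 * real d) Q\<^sub>0) \<eta> f \<and>
      (\<lambda>Q. (omega d f (dilate d (30000 * real d) Q))\<^sup>2 * measure (Rn_lebesgue d) Q)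
        summable_on dyadic_subcubes d Q\<^sub>0 \<and>
      (\<Sum>\<^sub>\<infinity>Q\<in>dyadic_subcubes d Q\<^sub>0.
          (omega d f (dilate d (30000 * real d) Q))\<^sup>2 * measure (Rn_lebesgue d) Q)
        \<le> C\<^sub>M * measure (Rn_lebesgue d) Q\<^sub>0"
    obtain c s where cs: "0 < s" "Q\<^sub>0 = cube d c s" using dyadic_cube_is_cube[OF Q] .
    have "dilate d (30000 * real d) Q\<^sub>0 = cube d c (30000 * real d * s)"
      unfolding cs(2) using cs(1) d by (rule dilate_cube)
    moreover have "0 < 30000 * real d * s" using d cs by simp
    ultimately have "d \<le> N" using hyp N[OF d] by metis
    then have "L d \<le> ?L" using d by (intro Max_ge) auto
    moreover have "0 < L d" using L[OF d] by linarith
    moreover obtain E where "E \<in> sets (Rn_lebesgue d)" "E \<subseteq> Q\<^sub>0"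
      "measure (Rn_lebesgue d) E \<ge> (1 - \<theta>) * measure (Rn_lebesgue d) Q\<^sub>0"
      "bi_lipschitz_on d (L d) E (\<lambda>x. inverse (diameter (f ` Q\<^sub>0) / Rn_diameter d Q\<^sub>0) *\<^sub>R f x)"
      using good[OF d, unfolded good_def, rule_format, OF Q hyp] by blast
    ultimately show "\<exists>E \<in> sets (Rn_lebesgue d). E \<subseteq> Q\<^sub>0 \<and>
            measure (Rn_lebesgue d) E \<ge> (1 - \<theta>) * measure (Rn_lebesgue d) Q\<^sub>0 \<and>
            bi_lipschitz_on d ?L E
              (\<lambda>x. inverse (diameter (f ` Q\<^sub>0) / Rn_diameter d Q\<^sub>0) *\<^sub>R f x)"
      using bi_lipschitz_on_mono by blast
  qed
qed

end
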